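(* Let $(X, \perp)$ be a divisibly transitive orthoset of rank $\geq 4$. Then there is an ordered field $K$ and a positive-definite quadratic space $H$ over $K$, possessing a unit vector in each one-dimensional subspace, such that $(X, \perp)$ is isomorphic to $(P(H), \perp)$.
   Context: An orthoset is a non-empty set $X$ with a symmetric, irreflexive binary relation $\perp$. An automorphism of $(X,\perp)$ is a bijection $\varphi$ of $X$ with $p \perp q \Leftrightarrow \varphi(p)\perp\varphi(q)$; the group of automorphisms is denoted $\mathbf O(X)$. The rank of $X$ is the smallest cardinal $\lambda$ such that every subset of mutually orthogonal elements has cardinality $\leq \lambda$. For distinct $e,f\in X$, let $G_{ef} = \{\varphi\in\mathbf O(X) : \varphi(x)=x \text{ for all } x \text{ with } x \perp e \text{ and } x\perp f\}$ and $R_{ef} = \{\varphi\in G_{ef} : \text{for any } k\geq 1 \text{ there is } \psi\in G_{ef} \text{ with } \varphi=\psi^k\}$. $(X,\perp)$ is divisibly transitive if for any distinct $e,f\in X$: (DT0) $R_{ef}$ is an abelian subgroup of $\mathbf O(X)$; (DT1) there is $\varphi\in R_{ef}$ with $\varphi(e)=f$; (DT2) for any further distinct elements $e',f' \in X$ there is $\tau\in\mathbf O(X)$ with $\tau(e)=e'$ and $R_{ef}=\tau^{-1}R_{e'f'}\tau$. A quadratic space over a (commutative) field $K$ of characteristic $\neq 2$ is a linear space $H$ over $K$ (possibly infinite-dimensional) with a symmetric bilinear form $(\cdot,\cdot)$ that is anisotropic: $(u,u)=0$ implies $u=0$. If $K$ is ordered, it is positive definite if $(u,u)>0$ for all $u\neq0$.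 A unit vector is a vector $u$ with $(u,u)=1$. $P(H)$ is the set of one-dimensional subspaces $[u]$, and $[u]\perp[v]$ if $(u,v)=0$. An isomorphism of orthosets is a bijection preserving and reflecting $\perp$. *)

theory Defs
  imports "HOL-Algebra.Bij" "HOL-Algebra.Module"
begin

unbundle cardinal_syntax

section \<open>Orthosets\<close>

locale orthoset =
  fixes X :: "'a set" and perp :: "'a \<Rightarrow> 'a \<Rightarrow> bool"
  assumes nonempty: "X \<noteq> {}"
    and perp_sym: "\<lbrakk>x \<in> X; y \<in> X; perp x y\<rbrakk> \<Longrightarrow> perp y x"
    and perp_irrefl: "x \<in> X \<Longrightarrow> \<not> perp x x"

definition orthoset_iso ::
    "('a \<Rightarrow> 'b) \<Rightarrow> 'a set \<Rightarrow> ('a \<Rightarrow> 'a \<Rightarrow> bool) \<Rightarrow> 'b set \<Rightarrow> ('b \<Rightarrow> 'b \<Rightarrow> bool) \<Rightarrow> bool" where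
  "orthoset_iso f X perp Y perp' \<longleftrightarrow>
     bij_betw f X Y \<and> (\<forall>x\<in>X. \<forall>y\<in>X. perp x y \<longleftrightarrow> perp' (f x) (f y))"

definition orthoset_isomorphic ::
    "'a set \<Rightarrow> ('a \<Rightarrow> 'a \<Rightarrow> bool) \<Rightarrow> 'b set \<Rightarrow> ('b \<Rightarrow> 'b \<Rightarrow> bool) \<Rightarrow> bool" where
  "orthoset_isomorphic X perp Y perp' \<longleftrightarrow> (\<exists>f. orthoset_iso f X perp Y perp')"

definition orthogonal_subset :: "'a set \<Rightarrow> ('a \<Rightarrow> 'a \<Rightarrow> bool) \<Rightarrow> 'a set \<Rightarrow> bool" where
  "orthogonal_subset X perp D \<longleftrightarrow> D \<subseteq> X \<and> pairwise perp D"

text \<open>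
  The rank is a cardinal, i.e. a well-order as in the library's theory of cardinals, determined up
  to order isomorphism. Minimising over cardinals on the type of the points is no restriction,
  since \<open>|X|\<close> itself bounds the size of all orthogonal subsets.
\<close>

definition bounds_orthogonal_subsets ::
    "'a set \<Rightarrow> ('a \<Rightarrow> 'a \<Rightarrow> bool) \<Rightarrow> 'b rel \<Rightarrow> bool" where
  "bounds_orthogonal_subsets X perp r \<longleftrightarrow>
     Card_order r \<and> (\<forall>D. orthogonal_subset X perp D \<longrightarrow> |D| \<le>o r)"

definition is_rank :: "'a set \<Rightarrow> ('a \<Rightarrow> 'a \<Rightarrow> bool) \<Rightarrow> 'a rel \<Rightarrow> bool" where
  "is_rank X perp r \<longleftrightarrow>
     bounds_orthogonal_subsets X perp r \<and>
     (\<forall>r' :: 'a rel. bounds_orthogonal_subsets X perp r' \<longrightarrow> r \<le>o r')"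

lemma rank_exists: "\<exists>r. is_rank X perp r"
proof -
  let ?Q = "{r :: 'a rel. bounds_orthogonal_subsets X perp r}"
  have "|X| \<in> ?Q"
    by (auto simp: bounds_orthogonal_subsets_def orthogonal_subset_def card_of_Card_order
        intro: card_of_mono1)
  then obtain r where r: "r \<in> ?Q" "\<And>r'. (r', r) \<in> ordLess \<Longrightarrow> r' \<notin> ?Q"
    by (rule wfE_min[OF wf_ordLess]) blast
  have "r \<le>o r'" if "r' \<in> ?Q" for r'
  proof -
    have "Well_order r" "Well_order r'"
      using r(1) that by (auto simp: bounds_orthogonal_subsets_def card_order_on_def)
    then show ?thesis
      using r(2)[of r'] that not_ordLess_iff_ordLeq[of r r'] by fast
  qed
  with r(1) show ?thesis by (auto simp: is_rank_def)
qed

lemma is_rank_minimal: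
  fixes r :: "'a rel" and s :: "'b rel"
  assumes r: "is_rank X perp r" and s: "bounds_orthogonal_subsets X perp s"
  shows "r \<le>o s"
proof (rule ccontr)
  have cr: "Card_order r" and cs: "Card_order s"
    using r s by (auto simp: is_rank_def bounds_orthogonal_subsets_def)
  have wr: "Well_order r" and ws: "Well_order s"
    using cr cs by (auto simp: card_order_on_def)
  assume "\<not> r \<le>o s"
  then have less: "s <o r" using not_ordLeq_iff_ordLess[OF ws wr] by simp
  have "|Field s| \<le>o |Field r|"
    by (rule card_of_mono2[OF ordLess_imp_ordLeq[OF less]])
  then obtain g where g: "inj_on g (Field s)" "g ` Field s \<subseteq> Field r"
    by (auto simp: card_of_ordLeq[symmetric])
  have "|Field s| =o |g ` Field s|"
    by (rule card_of_ordIsoI[OF bij_betw_imageI[OF g(1) refl]])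
  with ordIso_symmetric[OF card_of_Field_ordIso[OF cs]] have iso: "s =o |g ` Field s|"
    by (rule ordIso_transitive)
  have "bounds_orthogonal_subsets X perp |g ` Field s|"
    using s by (auto simp: bounds_orthogonal_subsets_def card_of_Card_order
        intro: ordLeq_ordIso_trans[OF _ iso])
  then have "r \<le>o |g ` Field s|" using r unfolding is_rank_def by blast
  then have "r \<le>o s" by (rule ordLeq_ordIso_trans[OF _ ordIso_symmetric[OF iso]])
  with \<open>\<not> r \<le>o s\<close> show False by blast
qed

section \<open>Automorphisms and divisible transitivity\<close>

definition orthoset_aut_group :: "'a set \<Rightarrow> ('a \<Rightarrow> 'a \<Rightarrow> bool) \<Rightarrow> ('a \<Rightarrow> 'a) monoid" where
  "orthoset_aut_group X perp =
     BijGroup X\<lparr>carrier := {\<phi> \<in> Bij X. \<forall>p\<in>X. \<forall>q\<in>X. perp p q \<longleftrightarrow> perp (\<phi> p) (\<phi> q)}\<rparr>"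

lemma group_orthoset_aut_group: "group (orthoset_aut_group X perp)"
proof -
  let ?A = "{\<phi> \<in> Bij X. \<forall>p\<in>X. \<forall>q\<in>X. perp p q \<longleftrightarrow> perp (\<phi> p) (\<phi> q)}"
  interpret B: group "BijGroup X" by (rule group_BijGroup)
  have "subgroup ?A (BijGroup X)"
  proof (rule B.subgroupI)
    show "?A \<subseteq> carrier (BijGroup X)" by (auto simp: BijGroup_def)
    show "?A \<noteq> {}" using id_Bij[of X] by fastforce
  next
    fix \<phi> assume \<phi>: "\<phi> \<in> ?A"
    then have bij: "bij_betw \<phi> X X" by (simp add: Bij_def)
    have "perp p q \<longleftrightarrow> perp (inv_into X \<phi> p) (inv_into X \<phi> q)" if "p \<in> X" "q \<in> X" for p q
      using \<phi> that bij_betw_inv_into_right[OF bij] Bij_inv_into_mem[of \<phi> X] by auto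
    then show "inv\<^bsub>BijGroup X\<^esub> \<phi> \<in> ?A"
      using \<phi> by (simp add: inv_BijGroup restrict_inv_into_Bij)
  next
    fix \<phi> \<psi> assume "\<phi> \<in> ?A" "\<psi> \<in> ?A"
    then show "\<phi> \<otimes>\<^bsub>BijGroup X\<^esub> \<psi> \<in> ?A"
      using Bij_imp_funcset[of \<psi> X]
      by (auto simp: BijGroup_def compose_Bij compose_eq Pi_iff)
  qed
  then show ?thesis
    unfolding orthoset_aut_group_def by (rule B.subgroup_imp_group)
qed

definition fix_group :: "'a set \<Rightarrow> ('a \<Rightarrow> 'a \<Rightarrow> bool) \<Rightarrow> 'a \<Rightarrow> 'a \<Rightarrow> ('a \<Rightarrow> 'a) set" where
  "fix_group X perp e f =
     {\<phi> \<in> carrier (orthoset_aut_group X perp). \<forall>x\<in>X. perp x e \<and> perp x f \<longrightarrow> \<phi> x = x}"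

definition divisible_part :: "'a set \<Rightarrow> ('a \<Rightarrow> 'a \<Rightarrow> bool) \<Rightarrow> 'a \<Rightarrow> 'a \<Rightarrow> ('a \<Rightarrow> 'a) set" where
  "divisible_part X perp e f =
     {\<phi> \<in> fix_group X perp e f.
        \<forall>k::nat. k \<ge> 1 \<longrightarrow> (\<exists>\<psi>\<in>fix_group X perp e f. \<phi> = \<psi> [^]\<^bsub>orthoset_aut_group X perp\<^esub> k)}"

definition DT0 :: "'a set \<Rightarrow> ('a \<Rightarrow> 'a \<Rightarrow> bool) \<Rightarrow> 'a \<Rightarrow> 'a \<Rightarrow> bool" where
  "DT0 X perp e f \<longleftrightarrow>
     subgroup (divisible_part X perp e f) (orthoset_aut_group X perp) \<and>
     comm_group (orthoset_aut_group X perp\<lparr>carrier := divisible_part X perp e f\<rparr>)"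

definition DT1 :: "'a set \<Rightarrow> ('a \<Rightarrow> 'a \<Rightarrow> bool) \<Rightarrow> 'a \<Rightarrow> 'a \<Rightarrow> bool" where
  "DT1 X perp e f \<longleftrightarrow> (\<exists>\<phi>\<in>divisible_part X perp e f. \<phi> e = f)"

definition DT2 :: "'a set \<Rightarrow> ('a \<Rightarrow> 'a \<Rightarrow> bool) \<Rightarrow> 'a \<Rightarrow> 'a \<Rightarrow> bool" where
  "DT2 X perp e f \<longleftrightarrow>
     (\<forall>e'\<in>X. \<forall>f'\<in>X. e' \<noteq> f' \<longrightarrow>
        (\<exists>\<tau>\<in>carrier (orthoset_aut_group X perp). \<tau> e = e' \<and>
           divisible_part X perp e f =
             (\<lambda>\<rho>. inv\<^bsub>orthoset_aut_group X perp\<^esub> \<tau> \<otimes>\<^bsub>orthoset_aut_group X perp\<^esub> \<rho>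
                    \<otimes>\<^bsub>orthoset_aut_group X perp\<^esub> \<tau>) ` divisible_part X perp e' f'))"

definition divisibly_transitive :: "'a set \<Rightarrow> ('a \<Rightarrow> 'a \<Rightarrow> bool) \<Rightarrow> bool" where
  "divisibly_transitive X perp \<longleftrightarrow>
     (\<forall>e\<in>X. \<forall>f\<in>X. e \<noteq> f \<longrightarrow> DT0 X perp e f \<and> DT1 X perp e f \<and> DT2 X perp e f)"

section \<open>Ordered fields and quadratic spaces\<close>

locale ordered_field = field K for K (structure) +
  fixes le :: "'k \<Rightarrow> 'k \<Rightarrow> bool"
  constrains K :: "('k, 'm) ring_scheme"
  assumes le_refl: "a \<in> carrier K \<Longrightarrow> le a a"
    and le_antisym: "\<lbrakk>a \<in> carrier K; b \<in> carrier K; le a b; le b a\<rbrakk> \<Longrightarrow> a = b"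
    and le_trans: "\<lbrakk>a \<in> carrier K; b \<in> carrier K; c \<in> carrier K; le a b; le b c\<rbrakk> \<Longrightarrow> le a c"
    and le_total: "\<lbrakk>a \<in> carrier K; b \<in> carrier K\<rbrakk> \<Longrightarrow> le a b \<or> le b a"
    and le_add: "\<lbrakk>a \<in> carrier K; b \<in> carrier K; c \<in> carrier K; le a b\<rbrakk> \<Longrightarrow> le (a \<oplus> c) (b \<oplus> c)"
    and le_mult: "\<lbrakk>a \<in> carrier K; b \<in> carrier K; le \<zero> a; le \<zero> b\<rbrakk> \<Longrightarrow> le \<zero> (a \<otimes> b)"

locale quadratic_space = field K + module K H for K (structure) and H (structure) +
  fixes form :: "'h \<Rightarrow> 'h \<Rightarrow> 'k"
  constrains K :: "('k, 'm) ring_scheme" and H :: "('k, 'h, 'n) module_scheme"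
  assumes char_not_2: "\<one> \<oplus> \<one> \<noteq> \<zero>"
    and form_closed: "\<lbrakk>u \<in> carrier H; v \<in> carrier H\<rbrakk> \<Longrightarrow> form u v \<in> carrier K"
    and form_sym: "\<lbrakk>u \<in> carrier H; v \<in> carrier H\<rbrakk> \<Longrightarrow> form u v = form v u"
    and form_add_left: "\<lbrakk>u \<in> carrier H; v \<in> carrier H; w \<in> carrier H\<rbrakk> \<Longrightarrow>
      form (u \<oplus>\<^bsub>H\<^esub> v) w = form u w \<oplus> form v w"
    and form_add_right: "\<lbrakk>u \<in> carrier H; v \<in> carrier H; w \<in> carrier H\<rbrakk> \<Longrightarrow>
      form u (v \<oplus>\<^bsub>H\<^esub> w) = form u v \<oplus> form u w"
    and form_smult_left: "\<lbrakk>a \<in> carrier K; u \<in> carrier H; v \<in> carrier H\<rbrakk> \<Longrightarrow>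
      form (a \<odot>\<^bsub>H\<^esub> u) v = a \<otimes> form u v"
    and form_smult_right: "\<lbrakk>a \<in> carrier K; u \<in> carrier H; v \<in> carrier H\<rbrakk> \<Longrightarrow>
      form u (a \<odot>\<^bsub>H\<^esub> v) = a \<otimes> form u v"
    and anisotropic: "\<lbrakk>u \<in> carrier H; form u u = \<zero>\<rbrakk> \<Longrightarrow> u = \<zero>\<^bsub>H\<^esub>"

locale positive_definite_quadratic_space = ordered_field K le + quadratic_space K H form
  for K (structure) and le and H (structure) and form +
  assumes positive_definite:
    "\<lbrakk>u \<in> carrier H; u \<noteq> \<zero>\<^bsub>H\<^esub>\<rbrakk> \<Longrightarrow> le \<zero> (form u u) \<and> form u u \<noteq> \<zero>"

definition line_span :: "('k, 'm) ring_scheme \<Rightarrow> ('k, 'h, 'n) module_scheme \<Rightarrow> 'h \<Rightarrow> 'h set" where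
  "line_span K H u = (\<lambda>a. a \<odot>\<^bsub>H\<^esub> u) ` carrier K"

definition proj_points :: "('k, 'm) ring_scheme \<Rightarrow> ('k, 'h, 'n) module_scheme \<Rightarrow> 'h set set" where
  "proj_points K H = line_span K H ` (carrier H - {\<zero>\<^bsub>H\<^esub>})"

definition proj_perp ::
    "('k, 'm) ring_scheme \<Rightarrow> ('k, 'h, 'n) module_scheme \<Rightarrow> ('h \<Rightarrow> 'h \<Rightarrow> 'k) \<Rightarrow> 'h set \<Rightarrow> 'h set \<Rightarrow> bool" where
  "proj_perp K H form S T \<longleftrightarrow>
     (\<exists>u\<in>carrier H - {\<zero>\<^bsub>H\<^esub>}. \<exists>v\<in>carrier H - {\<zero>\<^bsub>H\<^esub>}.
        S = line_span K H u \<and> T = line_span K H v \<and> form u v = \<zero>\<^bsub>K\<^esub>)"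

definition unit_vector_in_each_line ::
    "('k, 'm) ring_scheme \<Rightarrow> ('k, 'h, 'n) module_scheme \<Rightarrow> ('h \<Rightarrow> 'h \<Rightarrow> 'k) \<Rightarrow> bool" where
  "unit_vector_in_each_line K H form \<longleftrightarrow>
     (\<forall>S\<in>proj_points K H. \<exists>u\<in>S. form u u = \<one>\<^bsub>K\<^esub>)"

text \<open>
  HOL has no quantification over types, so a representation theorem for an orthoset \<open>X\<close> asserts the
  existence of \<open>K\<close> and \<open>H\<close> with carriers inside the type of the points. This loses nothing: an ordered field is infinite, each projective line of \<open>P(H)\<close>
  has \<open>|K|\<close> points, and every non-zero vector is a multiple of a chosen representative of a
  point, so that \<open>|K| \<le> |X|\<close> and \<open>|H| \<le> |X|\<close> whenever \<open>X\<close> is isomorphic to \<open>P(H)\<close> with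
  \<open>H\<close> of dimension at least 2.
\<close>

end

theory Submission
  imports Defs
begin

text \<open>
  Divisible transitivity makes \<open>X\<close> linear: every line \<open>{e, f}\<^sup>\<bottom>\<^sup>\<bottom>\<close> contains a point
  orthogonal to \<open>e\<close>. It follows that every line meets every polar \<open>x\<^sup>\<bottom>\<close>, so biorthogonal closure
  satisfies the exchange and modular laws and \<open>X\<close> is a projective space of dimension at least 3.
  Fix a point \<open>e\<close> and take its polar \<open>M\<close> as hyperplane at infinity. Non-planar Desargues
  configurations yield all central collineations with axis \<open>M\<close>; the elations turn the affine space
  \<open>A = X - M\<close> into an abelian group with zero \<open>e\<close>, and the homologies with centre \<open>e\<close> become the
  scalars of a division ring \<open>K\<close>.

  For \<open>a\<close> in \<open>A\<close> the polar of \<open>a\<close> is an affine hyperplane missing \<open>e\<close>; the linear functional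
  taking the value \<open>-1\<close> on it is \<open>form a\<close>. Rotations in a line at infinity are linear because, by
  the rank condition, they fix some line through \<open>e\<close> pointwise. If \<open>J\<close> is a rotation taking a point
  of that line to the orthogonal one, with \<open>J a = b\<close>, then all other rotations commute with \<open>J\<close>,
  and since they preserve orthogonality this forces \<open>form (t b) b = t form b b\<close> for all scalars \<open>t\<close>.
  Hence \<open>K\<close> is commutative and the form symmetric. A rotation moving \<open>e\<close> into \<open>M\<close> shows that each
  direction contains a unit vector. So sums of squares are squares and \<open>-1\<close> is not a square,
  \<open>K\<close> can be ordered, and \<open>X\<close> is the projective space of the orthogonal sum of \<open>K\<close> and \<open>A\<close>.
\<close>

section \<open>Linear orthosets as projective spaces\<close>

text \<open>Coordinatising an orthogonality usually gives a hermitian form twisted by an involution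
  of a division ring, and the obstacle is to show this involution trivial. Here it never appears.
  Orthogonality detects two values of \<open>form a b\<close>: \<open>0\<close> (orthogonal
  directions) and \<open>-1\<close> (orthogonal points). Symmetry is known for these values alone,
  and linearity in the second argument alone, until rotations supply the missing identity. The
  \<open>-1\<close> anticipates the final model: \<open>a\<close> in \<open>A\<close> becomes
  \<open>(1, a)\<close>, and \<open>(1, a)\<close>, \<open>(1, b)\<close> are orthogonal iff
  \<open>1 + form a b = 0\<close>. Linearity comes from (DT2): transporting an orthogonal pair to
  one starting at \<open>e\<close> gives a point \<open>g\<close> such that the same group
  \<open>R\<close> moves \<open>e\<close> to \<open>f\<close> and \<open>e\<close> to
  \<open>g\<close>; whatever is orthogonal to \<open>e\<close> and one of them is then orthogonal to
  the other. Divisibility enters as a square root: were all distinct points orthogonal, some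
  transposition would be a square. Hence every line has a third point. To stay in the type of the
  points, \<open>K\<close> lives on one line through \<open>e\<close>, and pairs are coded by a
  bijection of \<open>A x A\<close> with \<open>A\<close>, available since an ordered field is
  infinite.\<close>

locale linear_orthoset = orthoset X perp for X :: "'a set" and perp +
  assumes orthogonal_partner: "\<lbrakk>e \<in> X; f \<in> X; e \<noteq> f\<rbrakk> \<Longrightarrow>
      \<exists>g\<in>X. perp e g \<and> (\<forall>x\<in>X. perp x e \<longrightarrow> (perp x f \<longleftrightarrow> perp x g))"
begin

text \<open>The biorthogonal closure. Intersecting \<open>S\<close> with \<open>X\<close> lets the
  closure laws hold for arbitrary \<open>S\<close>.\<close>

definition cl :: "'a set \<Rightarrow> 'a set" where
  "cl S = {x \<in> X. \<forall>y\<in>X. (\<forall>s\<in>S \<inter> X. perp y s) \<longrightarrow> perp y x}"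

lemma cl_closed: "x \<in> cl S \<Longrightarrow> x \<in> X"
  by (auto simp: cl_def)

lemma cl_incl: "\<lbrakk>x \<in> S; x \<in> X\<rbrakk> \<Longrightarrow> x \<in> cl S"
  by (auto simp: cl_def)

lemma cl_mono: "S \<subseteq> T \<Longrightarrow> cl S \<subseteq> cl T"
  by (auto simp: cl_def)

lemma cl_least: "T \<subseteq> cl S \<Longrightarrow> cl T \<subseteq> cl S"
  unfolding cl_def by blast

lemma cl_trans: "\<lbrakk>x \<in> cl T; T \<subseteq> cl S\<rbrakk> \<Longrightarrow> x \<in> cl S"
  using cl_least by blast

lemma perp_cl: "\<lbrakk>y \<in> X; \<And>s. \<lbrakk>s \<in> S; s \<in> X\<rbrakk> \<Longrightarrow> perp y s; x \<in> cl S\<rbrakk> \<Longrightarrow> perp y x"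
  by (auto simp: cl_def)

lemma perp_comm: "\<lbrakk>x \<in> X; y \<in> X\<rbrakk> \<Longrightarrow> perp x y \<longleftrightarrow> perp y x"
  using perp_sym by blast

lemma cl_perp: "\<lbrakk>y \<in> X; \<And>s. \<lbrakk>s \<in> S; s \<in> X\<rbrakk> \<Longrightarrow> perp s y; x \<in> cl S\<rbrakk> \<Longrightarrow> perp x y"
  using perp_cl perp_sym cl_closed by metis

lemma not_cl_witness:
  assumes "x \<in> X" "x \<notin> cl S"
  obtains y where "y \<in> X" "\<And>s. \<lbrakk>s \<in> S; s \<in> X\<rbrakk> \<Longrightarrow> perp y s" "\<not> perp y x"
  using assms by (auto simp: cl_def)

text \<open>A further point \<open>f\<close> of the closure has a partner \<open>g\<close>
  orthogonal to \<open>e\<close>; then \<open>g\<close> is orthogonal to \<open>f\<close>, hence to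
  itself.\<close>

lemma cl_single: assumes "e \<in> X" shows "cl {e} = {e}"
proof -
  have "f = e" if f: "f \<in> cl {e}" for f
  proof (rule ccontr)
    assume "f \<noteq> e"
    then obtain g where g: "g \<in> X" "perp e g"
      "\<And>x. x \<in> X \<Longrightarrow> perp x e \<Longrightarrow> perp x f \<longleftrightarrow> perp x g"
      using orthogonal_partner[of e f] assms cl_closed[OF f] by blast
    have "perp g e" using g assms perp_comm by blast
    then have "perp g f" using f g(1) by (auto simp: cl_def)
    then show False using g perp_irrefl \<open>perp g e\<close> by blast
  qed
  then show ?thesis using cl_incl assms by blast
qed

lemma partner_in_line:
  assumes "e \<in> X" "f \<in> X" "e \<noteq> f"
  obtains g where "g \<in> X" "perp e g" "perp g e" "cl {e, f} = cl {e, g}" "g \<in> cl {e, f}" "f \<in> cl {e, g}"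
    "\<And>x. \<lbrakk>x \<in> X; perp x e; perp x f\<rbrakk> \<Longrightarrow> perp x g"
    "\<And>x. \<lbrakk>x \<in> X; perp x e; perp x g\<rbrakk> \<Longrightarrow> perp x f"
proof -
  obtain g where g: "g \<in> X" "perp e g" "\<And>x. x \<in> X \<Longrightarrow> perp x e \<Longrightarrow> perp x f \<longleftrightarrow> perp x g"
    using orthogonal_partner[OF assms] by blast
  have "cl {e, f} = cl {e, g}" using g assms by (auto simp: cl_def)
  moreover have "perp g e" using g assms perp_comm by blast
  moreover have "g \<in> cl {e, f}" "f \<in> cl {e, g}" using g assms by (auto simp: cl_def)
  ultimately show ?thesis using that g by blast
qed

text \<open>An instance of the orthomodular law. A test point \<open>y\<close> orthogonal to
  \<open>e\<close> and \<open>f\<close> is exchanged for the point \<open>y'\<close> of the line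
  \<open>r y\<close> orthogonal to \<open>r\<close>. Then \<open>y'\<close> is orthogonal to all
  three generators, hence to \<open>t\<close>; and \<open>t\<close>, being orthogonal to
  \<open>r\<close> and \<open>y'\<close>, is orthogonal to \<open>y\<close>.\<close>

lemma cl_orthogonal_slice:
  assumes X: "e \<in> X" "f \<in> X" "r \<in> X" and ef: "perp e r" "perp f r"
    and t: "t \<in> cl {e, f, r}" "perp t r"
  shows "t \<in> cl {e, f}"
proof -
  have tX: "t \<in> X" using t cl_closed by blast
  have "perp y t" if y: "y \<in> X" "perp y e" "perp y f" for y
  proof (cases "y = r")
    case True then show ?thesis using t tX X perp_comm by blast
  next
    case False
    obtain y' where y': "y' \<in> X" "perp r y'" "perp y' r"
      "\<And>x. \<lbrakk>x \<in> X; perp x r; perp x y\<rbrakk> \<Longrightarrow> perp x y'"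
      "\<And>x. \<lbrakk>x \<in> X; perp x r; perp x y'\<rbrakk> \<Longrightarrow> perp x y"
      using partner_in_line[of r y] X y False by metis
    have "perp y' e" "perp y' f" using y' X y ef perp_comm by metis+
    then have "perp y' t" using t y' perp_cl[of y' "{e,f,r}" t] by blast
    then show ?thesis using y' t tX y perp_comm by metis
  qed
  then show ?thesis using tX X by (auto simp: cl_def)
qed

text \<open>Gram-Schmidt without coordinates: removing from \<open>x\<close> its components along
  \<open>e\<close> and \<open>f\<close> leaves \<open>x2\<close>, and \<open>t\<close> is the
  projection of \<open>x\<close> to the line \<open>e f\<close>. The point of this line orthogonal
  to \<open>t\<close> is also orthogonal to \<open>x2\<close>, hence to \<open>x\<close>.\<close>

lemma line_meets_polar_orthogonal:
  assumes X: "e \<in> X" "f \<in> X" "x \<in> X" and ef: "perp e f"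
  shows "\<exists>u\<in>cl {e, f}. perp u x"
proof (cases "x = e \<or> perp e x")
  case True
  then show ?thesis using X ef perp_comm cl_incl by blast
next
  case False
  obtain x1 where x1: "x1 \<in> X" "perp e x1" "perp x1 e" "cl {e, x} = cl {e, x1}" "x \<in> cl {e, x1}"
    using partner_in_line[of e x] X False by metis
  show ?thesis
  proof (cases "x1 = f")
    case True
    obtain g where g: "perp x g" "cl {x, e} = cl {x, g}" "g \<in> cl {x, e}"
      using partner_in_line[of x e] X False by metis
    have "g \<in> cl {e, f}" using g x1 True by (simp add: insert_commute)
    then show ?thesis using g X perp_comm cl_closed by blast
  next
    case x1f: False
    obtain x2 where x2: "x2 \<in> X" "perp f x2" "perp x2 f" "x1 \<in> cl {f, x2}"
      "\<And>z. \<lbrakk>z \<in> X; perp z f; perp z x1\<rbrakk> \<Longrightarrow> perp z x2"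
      using partner_in_line[of f x1] X x1 x1f by metis
    have e2: "perp e x2" using x2 x1 ef X by blast
    show ?thesis
    proof (cases "x = x2")
      case True
      then show ?thesis using e2 X cl_incl by blast
    next
      case False
      obtain t where t: "t \<in> X" "perp x2 t" "perp t x2" "t \<in> cl {x2, x}"
        "\<And>z. \<lbrakk>z \<in> X; perp z x2; perp z t\<rbrakk> \<Longrightarrow> perp z x"
        using partner_in_line[of x2 x] X x2 False by metis
      have "cl {f, x2} \<subseteq> cl {e, f, x2}" by (rule cl_mono) auto
      then have "{e, x1} \<subseteq> cl {e, f, x2}" using x2(4) X cl_incl by blast
      then have "x \<in> cl {e, f, x2}" using x1 cl_trans by blast
      then have "{x2, x} \<subseteq> cl {e, f, x2}" using x2(1) by (simp add: cl_incl)
      then have "t \<in> cl {e, f, x2}" using t cl_trans by blast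
      then have tl: "t \<in> cl {e, f}"
        using cl_orthogonal_slice[of e f x2 t] X x2 e2 t by blast
      have "\<exists>u\<in>cl {e, f}. perp u t"
      proof (cases "t = e")
        case True then show ?thesis using X ef perp_comm cl_incl by blast
      next
        case False
        obtain u where u: "perp t u" "u \<in> cl {t, e}" "perp u t"
          using partner_in_line[of t e] t X False by metis
        have "{t, e} \<subseteq> cl {e, f}" using tl X cl_incl by blast
        then show ?thesis using u cl_trans by blast
      qed
      then obtain u where u: "u \<in> cl {e, f}" "perp u t" by blast
      have uX: "u \<in> X" using u cl_closed by blast
      have "perp x2 u" using u x2 e2 perp_cl[of x2 "{e,f}" u] perp_comm by blast
      then show ?thesis using u t uX x2 perp_comm by blast
    qed
  qed
qed

lemma line_meets_polar:
  assumes "e \<in> X" "f \<in> X" "x \<in> X" "e \<noteq> f"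
  shows "\<exists>u\<in>cl {e, f}. perp u x"
proof -
  obtain g where "g \<in> X" "perp e g" "cl {e, f} = cl {e, g}"
    using partner_in_line[of e f] assms by metis
  then show ?thesis using line_meets_polar_orthogonal[of e g x] assms by simp
qed

text \<open>A line has only one point orthogonal to \<open>p\<close>: if the partners
  \<open>h\<close> and \<open>k\<close> of \<open>q\<close> and \<open>r\<close> differed, the point
  of the line \<open>h k\<close> orthogonal to \<open>h\<close> would also be orthogonal to
  \<open>p\<close>, hence to itself.\<close>

lemma cl_pair_exchange:
  assumes X: "p \<in> X" "q \<in> X" and r: "r \<in> cl {p, q}" "r \<noteq> p"
  shows "q \<in> cl {p, r}"
proof (cases "q = p")
  case True then show ?thesis using X cl_incl by blast
next
  case False
  have rX: "r \<in> X" using r cl_closed by blast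
  obtain h where h: "h \<in> X" "perp p h" "perp h p" "cl {p, q} = cl {p, h}" "q \<in> cl {p, h}"
    using partner_in_line[of p q] X False by metis
  obtain k where k: "k \<in> X" "perp p k" "perp k p" "cl {p, r} = cl {p, k}" "k \<in> cl {p, r}"
    using partner_in_line[of p r] X rX r(2) by metis
  have kl: "k \<in> cl {p, h}" using k r h X cl_incl cl_trans[of k "{p,r}" "{p,h}"] by blast
  have "k = h"
  proof (rule ccontr)
    assume "k \<noteq> h"
    then obtain l where l: "l \<in> X" "perp h l" "perp l h" "l \<in> cl {h, k}"
      using partner_in_line[of h k] k h by metis
    have "perp p l" using perp_cl[of p "{h,k}" l] l X k h by blast
    then have "perp l p" using l X perp_comm by blast
    have "l \<in> cl {p, h}" using l kl h cl_incl cl_trans[of l "{h,k}" "{p,h}"] by blast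
    then have "perp l l" using perp_cl[of l "{p,h}" l] l \<open>perp l p\<close> by blast
    then show False using perp_irrefl l by blast
  qed
  then show ?thesis using k h by simp
qed

text \<open>Let \<open>w\<close> separate \<open>x\<close> from \<open>S\<close>. For
  \<open>z\<close> orthogonal to \<open>S\<close> and \<open>x\<close>, the line \<open>z w\<close>
  meets the polar of \<open>y\<close> in some \<open>v\<close>, which is orthogonal to
  \<open>S\<close> and \<open>y\<close>, hence to \<open>x\<close>. But \<open>z\<close> is the only
  point of this line orthogonal to \<open>x\<close>, so \<open>v = z\<close>.\<close>

lemma exchange:
  assumes y: "y \<in> X" and x: "x \<in> cl (insert y S)" "x \<notin> cl S"
  shows "y \<in> cl (insert x S)"
proof -
  have xX: "x \<in> X" using x cl_closed by blast
  obtain w where w: "w \<in> X" "\<And>s. \<lbrakk>s \<in> S; s \<in> X\<rbrakk> \<Longrightarrow> perp w s" "\<not> perp w x"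
    using not_cl_witness[OF xX x(2)] by blast
  have "perp z y" if z: "z \<in> X" "\<And>s. \<lbrakk>s \<in> S; s \<in> X\<rbrakk> \<Longrightarrow> perp z s" "perp z x" for z
  proof -
    obtain v where v: "v \<in> cl {z, w}" "perp v y"
      using line_meets_polar[of z w y] z w y by blast
    have vX: "v \<in> X" using v cl_closed by blast
    have vS: "perp v s" if "s \<in> S" "s \<in> X" for s
      using perp_cl[of s "{z,w}" v] v that z w vX perp_comm by blast
    then have vx: "perp v x" using perp_cl[of v "insert y S" x] v vX x by blast
    have "v = z"
    proof (rule ccontr)
      assume "v \<noteq> z"
      then have "w \<in> cl {z, v}" using cl_pair_exchange[of z w v] z w v by blast
      then have "perp x w" using perp_cl[of x "{z,v}" w] xX z vx perp_comm by blast
      then show False using w xX perp_comm by blast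
    qed
    then show ?thesis using v by simp
  qed
  then show ?thesis using y xX by (auto simp: cl_def)
qed

text \<open>The modular law for a line and a flat; for a pair \<open>S\<close> it is the
  Veblen-Young axiom. Some polar contains \<open>S\<close> but not \<open>c\<close>; the line
  \<open>c d\<close> meets it, and exchange puts the intersection into \<open>cl S\<close>.\<close>

lemma meet:
  assumes c: "c \<in> X" "c \<notin> cl S" and d: "d \<in> cl (insert c S)" "c \<noteq> d"
  obtains q where "q \<in> cl {c, d}" "q \<in> cl S"
proof -
  have dX: "d \<in> X" using d cl_closed by blast
  obtain x where x: "x \<in> X" "\<And>s. \<lbrakk>s \<in> S; s \<in> X\<rbrakk> \<Longrightarrow> perp x s" "\<not> perp x c"
    using not_cl_witness[OF c] by blast
  obtain q where q: "q \<in> cl {c, d}" "perp q x"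
    using line_meets_polar[of c d x] c dX d x by blast
  have "{c, d} \<subseteq> cl (insert c S)" using d c cl_incl by blast
  then have q1: "q \<in> cl (insert c S)" using q cl_trans by blast
  have "q \<in> cl S"
  proof (rule ccontr)
    assume "q \<notin> cl S"
    then have "c \<in> cl (insert q S)" using exchange c q1 by blast
    then have "perp x c" using perp_cl[of x "insert q S" c] x q perp_comm by blast
    then show False using x by blast
  qed
  then show ?thesis using that q by blast
qed

text \<open>If \<open>b0 \<in> B\<close> is not orthogonal to \<open>s\<close>, the lines through \<open>b0\<close> and the other points of \<open>B\<close> meet the
  polar of \<open>s\<close> in an independent set with one element less; induction over \<open>S\<close> leaves a point.\<close>

lemma orthogonal_to_smaller_set:
  assumes "finite S" "S \<subseteq> X" "finite B" "B \<subseteq> X" "card S < card B"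
    and "\<And>b. b \<in> B \<Longrightarrow> b \<notin> cl (B - {b})"
  shows "\<exists>w\<in>cl B. \<forall>s\<in>S. perp w s"
  using assms
proof (induction S arbitrary: B rule: finite_induct)
  case empty
  then obtain b where "b \<in> B" by fastforce
  then show ?case using empty cl_incl by blast
next
  case (insert s S)
  have sX: "s \<in> X" using insert by simp
  show ?case
  proof (cases "\<forall>b\<in>B. perp b s")
    case True
    have "card S < card B" using insert by simp
    then obtain w where w: "w \<in> cl B" "\<forall>s\<in>S. perp w s"
      using insert.IH[of B] insert.prems by auto
    have "perp w s" using cl_perp[of s B w] True w sX by blast
    then show ?thesis using w by blast
  next
    case False
    then obtain b0 where b0: "b0 \<in> B" "\<not> perp b0 s" by blast
    have b0X: "b0 \<in> X" using b0 insert.prems by blast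
    have "\<exists>u\<in>cl {b, b0}. perp u s" if "b \<in> B - {b0}" for b
      using line_meets_polar[of b b0 s] that insert.prems b0X by blast
    then obtain u where u: "\<And>b. b \<in> B - {b0} \<Longrightarrow> u b \<in> cl {b, b0} \<and> perp (u b) s" by metis
    define B' where "B' = u ` (B - {b0})"
    have uX: "u b \<in> X" if "b \<in> B - {b0}" for b using u[OF that] cl_closed by blast
    have bu: "b \<in> cl {u b, b0}" if "b \<in> B - {b0}" for b
      using cl_pair_exchange[of b0 b "u b"] u[OF that] b0 that insert.prems
      by (metis DiffD1 insert_commute subset_iff)
    \<comment> \<open>Independence survives the projection from \<open>b0\<close>: since
      \<open>b\<close> lies on the line through \<open>u b\<close> and \<open>b0\<close>, a
      dependency among the new points would be one in \<open>B\<close>.\<close>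
    have key: "b \<in> cl (B - {b})" if "b \<in> B - {b0}" "u b \<in> cl (u ` (B - {b0} - {b}))" for b
    proof -
      have "u b' \<in> cl (B - {b})" if "b' \<in> B - {b0} - {b}" for b'
      proof -
        have "cl {b', b0} \<subseteq> cl (B - {b})"
          by (rule cl_mono) (use that \<open>b \<in> B - {b0}\<close> b0 in auto)
        then show ?thesis using u[of b'] that by blast
      qed
      then have "u b \<in> cl (B - {b})" using that cl_trans by blast
      then have "{u b, b0} \<subseteq> cl (B - {b})" using b0 b0X that cl_incl by auto
      then show ?thesis using bu[OF that(1)] cl_trans by blast
    qed
    have inj: "inj_on u (B - {b0})"
    proof (rule inj_onI, rule ccontr)
      fix x y assume xy: "x \<in> B - {b0}" "y \<in> B - {b0}" "u x = u y" "x \<noteq> y"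
      then have "u x \<in> cl (u ` (B - {b0} - {x}))" using uX by (intro cl_incl) auto
      then show False using key[of x] xy insert.prems(5)[of x] by blast
    qed
    have ind: "b' \<notin> cl (B' - {b'})" if "b' \<in> B'" for b'
    proof -
      obtain b where b: "b \<in> B - {b0}" "b' = u b" using \<open>b' \<in> B'\<close> B'_def by blast
      have "B' - {b'} = u ` (B - {b0} - {b})" using b inj by (auto simp: B'_def inj_on_def)
      then show ?thesis using key[of b] b insert.prems by auto
    qed
    have "card B' = card B - 1" using inj b0 by (simp add: B'_def card_image)
    moreover have "finite B'" "B' \<subseteq> X" using insert.prems uX by (auto simp: B'_def)
    moreover have "card S < card B - 1" using insert by simp
    ultimately obtain w where w: "w \<in> cl B'" "\<forall>s\<in>S. perp w s"
      using insert.IH[of B'] insert.prems ind by auto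
    have "perp w s"
      by (rule cl_perp[OF sX _ w(1)]) (use u in \<open>auto simp: B'_def\<close>)
    moreover have "w \<in> cl B"
    proof (rule cl_trans[OF w(1)])
      show "B' \<subseteq> cl B" unfolding B'_def
      proof (rule image_subsetI)
        fix b assume b: "b \<in> B - {b0}"
        then have "cl {b, b0} \<subseteq> cl B" using b0 by (intro cl_mono) auto
        then show "u b \<in> cl B" using u[OF b] by blast
      qed
    qed
    ultimately show ?thesis using w by blast
  qed
qed

end

section \<open>Central collineations\<close>

context linear_orthoset
begin

lemma cl_mono_in: "\<lbrakk>x \<in> cl S; S \<subseteq> T\<rbrakk> \<Longrightarrow> x \<in> cl T"
  using cl_mono by blast

lemma line_eq:
  assumes X: "p \<in> X" "q \<in> X" and xy: "x \<in> cl {p, q}" "y \<in> cl {p, q}" "x \<noteq> y"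
  shows "cl {x, y} = cl {p, q}"
proof
  show "cl {x, y} \<subseteq> cl {p, q}" using xy by (intro cl_least) auto
  have xX: "x \<in> X" and yX: "y \<in> X" using xy cl_closed by auto
  have "{p, q} \<subseteq> cl {x, y}"
  proof (cases "x = p")
    case True
    then show ?thesis using cl_pair_exchange[of p q y] X xy by (auto simp: cl_incl)
  next
    case False
    have q: "q \<in> cl {p, x}" using cl_pair_exchange[of p q x] X xy False by blast
    then have "{p, q} \<subseteq> cl {x, p}" using X by (simp add: cl_incl insert_commute)
    then have "y \<in> cl {x, p}" using xy cl_trans by blast
    then have p: "p \<in> cl {x, y}" using cl_pair_exchange[of x p y] xX X xy by blast
    have "{p, x} \<subseteq> cl {x, y}" using p xX by (simp add: cl_incl)
    then show ?thesis using q cl_trans by blast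
  qed
  then show "cl {p, q} \<subseteq> cl {x, y}" by (rule cl_least)
qed

lemma lines_meet_once:
  assumes "p \<in> X" "q \<in> X" "r \<in> X" "s \<in> X" "x \<in> cl {p, q}" "y \<in> cl {p, q}"
    "x \<in> cl {r, s}" "y \<in> cl {r, s}" "x \<noteq> y"
  shows "cl {p, q} = cl {r, s}"
  using line_eq[of p q x y] line_eq[of r s x y] assms by simp

lemma in_line_swap: "\<lbrakk>p \<in> X; q \<in> X; r \<in> cl {p, q}; r \<noteq> p\<rbrakk> \<Longrightarrow> q \<in> cl {r, p}"
  using cl_pair_exchange[of p q r] by (simp add: insert_commute)

end

text \<open>\<open>rank_ge_4\<close> is the working form of the rank condition; the common
  orthogonal point witnesses that three points never span \<open>X\<close>.\<close>

locale pointed_orthoset = linear_orthoset +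
  fixes e :: 'a
  assumes third_point: "\<lbrakk>p \<in> X; q \<in> X; p \<noteq> q\<rbrakk> \<Longrightarrow> \<exists>r\<in>cl {p, q}. r \<noteq> p \<and> r \<noteq> q"
    and rank_ge_4: "\<lbrakk>p \<in> X; q \<in> X; r \<in> X\<rbrakk> \<Longrightarrow> \<exists>w\<in>X. perp w p \<and> perp w q \<and> perp w r"
    and base: "e \<in> X"
begin

definition M :: "'a set" where "M = {x \<in> X. perp x e}"
definition A :: "'a set" where "A = X - M"

lemma M_X: "m \<in> M \<Longrightarrow> m \<in> X" and A_X: "p \<in> A \<Longrightarrow> p \<in> X" and A_M: "p \<in> A \<Longrightarrow> p \<notin> M"
  by (auto simp: M_def A_def)

lemma A_I: "p \<in> X \<Longrightarrow> p \<notin> M \<Longrightarrow> p \<in> A"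
  by (auto simp: A_def)

lemma base_A: "e \<in> A"
  using base perp_irrefl by (auto simp: A_def M_def)

lemma cl_M: "S \<subseteq> M \<Longrightarrow> x \<in> cl S \<Longrightarrow> x \<in> M"
  using cl_perp[of e S x] base cl_closed[of x S] by (auto simp: M_def)

lemma direction_exists:
  assumes "p \<in> X" "q \<in> X" "p \<noteq> q"
  obtains m where "m \<in> M" "m \<in> cl {p, q}"
  using line_meets_polar[of p q e] assms base cl_closed by (auto simp: M_def)

text \<open>Two points at infinity would span the line and put all of it, including
  \<open>a\<close>, into \<open>M\<close>.\<close>

lemma direction_unique:
  assumes "p \<in> X" "q \<in> X" "m \<in> M" "m \<in> cl {p, q}" "k \<in> M" "k \<in> cl {p, q}" "a \<in> A" "a \<in> cl {p, q}"
  shows "m = k"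
proof (rule ccontr)
  assume "m \<noteq> k"
  then have "a \<in> cl {m, k}" using line_eq[of p q m k] assms by simp
  then have "a \<in> M" using cl_M[of "{m,k}"] assms by simp
  then show False using assms A_M by blast
qed

text \<open>The point \<open>w\<close> orthogonal to the plane may lie at infinity; then either
  \<open>e\<close> is outside the plane or a third point of the line \<open>e w\<close> is.\<close>

lemma point_outside_plane:
  assumes "p \<in> X" "q \<in> X" "r \<in> X"
  obtains z where "z \<in> A" "z \<notin> cl {p, q, r}"
proof -
  obtain w where w: "w \<in> X" "perp w p" "perp w q" "perp w r"
    using rank_ge_4[OF assms] by blast
  have nw: "w \<notin> cl {p, q, r}"
    using perp_cl[of w "{p,q,r}" w] w perp_irrefl by blast
  show ?thesis
  proof (cases "w \<in> A")
    case True then show ?thesis using that nw by blast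
  next
    case wM: False
    show ?thesis
    proof (cases "e \<in> cl {p, q, r}")
      case False then show ?thesis using that base_A by blast
    next
      case True
      have ew: "e \<noteq> w" using True nw by blast
      then obtain z where z: "z \<in> cl {e, w}" "z \<noteq> e" "z \<noteq> w"
        using third_point[of e w] base w by blast
      have zX: "z \<in> X" using z cl_closed by blast
      have "z \<in> A"
      proof (rule ccontr)
        assume "z \<notin> A"
        then have "z = w"
          using direction_unique[of e w z w e] z zX w base_A wM by (auto simp: A_def cl_incl)
        then show False using z by blast
      qed
      moreover have "z \<notin> cl {p, q, r}"
      proof
        assume "z \<in> cl {p, q, r}"
        then have "{e, z} \<subseteq> cl {p, q, r}" using True by simp
        moreover have "w \<in> cl {e, z}" using cl_pair_exchange[of e w z] z base w by blast
        ultimately show False using cl_trans nw by blast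
      qed
      ultimately show ?thesis using that by blast
    qed
  qed
qed

text \<open>An arrow \<open>x \<rightarrow> x'\<close> is a point with its image under a central collineation with centre \<open>c\<close> and
  axis \<open>M\<close>; two arrows are aligned if they can belong to the same collineation.\<close>

definition arrow :: "'a \<Rightarrow> 'a \<Rightarrow> 'a \<Rightarrow> bool" where
  "arrow c x x' \<longleftrightarrow> x \<in> A \<and> x' \<in> A \<and> x \<noteq> c \<and> x' \<noteq> c \<and> x' \<in> cl {c, x}"

definition aligned :: "'a \<Rightarrow> 'a \<Rightarrow> 'a \<Rightarrow> 'a \<Rightarrow> 'a \<Rightarrow> bool" where
  "aligned c x x' y y' \<longleftrightarrow> y \<notin> cl {c, x} \<and> (\<exists>m\<in>M. m \<in> cl {x, y} \<and> m \<in> cl {x', y'})"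

context
  fixes c assumes cX: "c \<in> X"
begin

lemma arrow_line: "arrow c x x' \<Longrightarrow> cl {c, x'} = cl {c, x}"
  using line_eq[of c x c x'] cX A_X[of x] by (auto simp: arrow_def cl_incl)

lemma arrow_in: "arrow c x x' \<Longrightarrow> x \<in> A \<and> x' \<in> A \<and> x \<in> X \<and> x' \<in> X"
  using A_X by (auto simp: arrow_def)

lemma off_line_sym:
  assumes "x \<in> X" "y \<in> X" "x \<noteq> c" "y \<notin> cl {c, x}"
  shows "x \<notin> cl {c, y}"
  using cl_pair_exchange[of c y x] assms cX by blast

lemma aligned_sym:
  assumes "arrow c x x'" "arrow c y y'" "aligned c x x' y y'"
  shows "aligned c y y' x x'"
  using assms off_line_sym[of x y] A_X unfolding aligned_def arrow_def
  by (auto simp: insert_commute)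

text \<open>The image is forced: if \<open>m\<close> is the point at infinity of \<open>x y\<close>,
  then \<open>y'\<close> must be the intersection of \<open>x' m\<close> and \<open>c y\<close>.
  These lines meet because both lie in the plane of \<open>c\<close>, \<open>x\<close>,
  \<open>y\<close>.\<close>

lemma aligned_exists:
  assumes x: "arrow c x x'" and y: "y \<in> A" "y \<notin> cl {c, x}"
  obtains y' where "arrow c y y'" "aligned c x x' y y'"
proof -
  have X: "x \<in> X" "x' \<in> X" "y \<in> X" using arrow_in[OF x] y A_X by auto
  have yx: "x \<noteq> y" "y \<noteq> c" using y X by (auto simp: cl_incl)
  have xc: "x \<noteq> c" "x' \<noteq> c" using x by (auto simp: arrow_def)
  obtain m where m: "m \<in> M" "m \<in> cl {x, y}" using direction_exists[of x y] X yx by blast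
  have mX: "m \<in> X" using m M_X by blast
  have xcy: "x \<notin> cl {c, y}" using off_line_sym X xc y by blast
  have x'cy: "x' \<notin> cl {c, y}"
  proof
    assume a: "x' \<in> cl {c, y}"
    have "cl {c, x} = cl {c, y}"
      by (rule lines_meet_once[of _ _ _ _ c x']) (use a x X cX xc in \<open>auto simp: arrow_def cl_incl\<close>)
    then show False using xcy X by (metis cl_incl insert_iff)
  qed
  have "x \<in> cl {c, x'}" using arrow_line[OF x] X by (simp add: cl_incl)
  then have "x \<in> cl {x', c, y}" by (rule cl_mono_in) auto
  then have "{x, y} \<subseteq> cl {x', c, y}" using X by (simp add: cl_incl)
  then have "m \<in> cl {x', c, y}" using m cl_trans by blast
  moreover have mx': "x' \<noteq> m" using m x A_M by (auto simp: arrow_def)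
  ultimately obtain y' where y': "y' \<in> cl {x', m}" "y' \<in> cl {c, y}"
    using meet[of x' "{c,y}" m] X x'cy by blast
  have y'X: "y' \<in> X" using y' cl_closed by blast
  have mcy: "m \<notin> cl {c, y}"
  proof
    assume "m \<in> cl {c, y}"
    then have "{y, m} \<subseteq> cl {c, y}" using X by (simp add: cl_incl)
    moreover have "x \<in> cl {y, m}"
      using cl_pair_exchange[of y x m] m X y A_M by (auto simp: insert_commute)
    ultimately show False using cl_trans xcy by blast
  qed
  have "y' \<in> A"
  proof (rule ccontr)
    assume "y' \<notin> A"
    then have "y' = m"
      using direction_unique[of x' m y' m x'] y' y'X m mX x by (auto simp: A_def arrow_def cl_incl)
    then show False using mcy y' by blast
  qed
  moreover have "y' \<noteq> c"
  proof
    assume "y' = c"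
    then have "m \<in> cl {c, x'}" using in_line_swap[of x' m c] y' xc X mX by auto
    then have "m \<in> cl {c, x}" using arrow_line[OF x] by simp
    then have "{x, m} \<subseteq> cl {c, x}" using X by (simp add: cl_incl)
    moreover have "y \<in> cl {x, m}"
      using cl_pair_exchange[of x y m] m X x A_M by (auto simp: arrow_def)
    ultimately show False using cl_trans y by blast
  qed
  moreover have "m \<in> cl {x', y'}"
    using cl_pair_exchange[of x' m y'] y' X mX x'cy by blast
  ultimately show ?thesis using that[of y'] y' yx y m by (auto simp: arrow_def aligned_def)
qed

text \<open>Both candidates lie on \<open>x' m\<close> and on \<open>c y\<close>, and these lines
  coincide only if \<open>y\<close> is on the line \<open>c x\<close>.\<close>

lemma aligned_unique:
  assumes x: "arrow c x x'" and y1: "arrow c y y1" "aligned c x x' y y1"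
    and y2: "arrow c y y2" "aligned c x x' y y2"
  shows "y1 = y2"
proof (rule ccontr)
  assume ne: "y1 \<noteq> y2"
  have X: "x \<in> X" "x' \<in> X" "y \<in> X" "y1 \<in> X" "y2 \<in> X"
    and A: "x \<in> A" "x' \<in> A" "y \<in> A" "y1 \<in> A" "y2 \<in> A"
    using arrow_in[OF x] arrow_in[OF y1(1)] arrow_in[OF y2(1)] by auto
  obtain m where m: "m \<in> M" "m \<in> cl {x, y}" "m \<in> cl {x', y1}" using y1 by (auto simp: aligned_def)
  obtain k where k: "k \<in> M" "k \<in> cl {x, y}" "k \<in> cl {x', y2}" using y2 by (auto simp: aligned_def)
  have "m = k" using direction_unique[of x y m k x] m k X A by (auto simp: cl_incl)
  have mx: "m \<noteq> x'" "m \<in> X" using m A M_X A_M by auto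
  have "y1 \<in> cl {x', m}" "y2 \<in> cl {x', m}"
    using cl_pair_exchange[of x' _ m] X m k \<open>m = k\<close> mx by auto
  moreover have "y1 \<in> cl {c, y}" "y2 \<in> cl {c, y}" using y1 y2 by (auto simp: arrow_def)
  ultimately have "cl {x', m} = cl {c, y}"
    using lines_meet_once[of x' m c y y1 y2] X cX mx ne by blast
  then have "x' \<in> cl {c, y}" using X by (metis cl_incl insertI1)
  moreover have "x' \<in> cl {c, x}" "x' \<noteq> c" using x by (auto simp: arrow_def)
  ultimately have "cl {c, x} = cl {c, y}"
    using lines_meet_once[of c x c y c x'] X cX by (auto simp: cl_incl)
  then have "y \<in> cl {c, x}" using X by (simp add: cl_incl)
  then show False using y1 by (simp add: aligned_def)
qed

text \<open>The spatial theorem of Desargues for triangles \<open>a b d\<close> and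
  \<open>a' b' d'\<close> in perspective from \<open>c\<close>. The sides \<open>b d\<close> and
  \<open>b' d'\<close> are coplanar, so they meet in some \<open>p\<close>. It lies in both triangle
  planes, and these share the points \<open>m\<close>, \<open>n\<close> at infinity; were
  \<open>p\<close> not at infinity, the planes would coincide and contain \<open>c\<close>, making
  \<open>d\<close> coplanar with \<open>c\<close>, \<open>a\<close>, \<open>b\<close>.\<close>

lemma aligned_trans_spatial:
  assumes a: "arrow c a a'" and b: "arrow c b b'" and d: "arrow c d d'"
    and ab: "aligned c a a' b b'" and ad: "aligned c a a' d d'" and dn: "d \<notin> cl {c, a, b}"
  shows "aligned c b b' d d'"
proof -
  have X: "a \<in> X" "a' \<in> X" "b \<in> X" "b' \<in> X" "d \<in> X" "d' \<in> X"
    and A: "a \<in> A" "a' \<in> A" "b \<in> A" "b' \<in> A" "d \<in> A" "d' \<in> A"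
    using arrow_in a b d by blast+
  obtain m where m: "m \<in> M" "m \<in> cl {a, b}" "m \<in> cl {a', b'}" using ab by (auto simp: aligned_def)
  obtain n where n: "n \<in> M" "n \<in> cl {a, d}" "n \<in> cl {a', d'}" using ad by (auto simp: aligned_def)
  have mX: "m \<in> X" "n \<in> X" using m n M_X by auto
  have dcb: "d \<notin> cl {c, b}" using dn cl_mono_in[of d "{c,b}" "{c,a,b}"] by blast
  have bca: "b \<notin> cl {c, a}" and dca: "d \<notin> cl {c, a}" using ab ad by (auto simp: aligned_def)
  have bc: "b \<noteq> c" "b' \<noteq> c" "d \<noteq> c" "d' \<noteq> c" "a \<noteq> c" "a' \<noteq> c" using a b d by (auto simp: arrow_def)
  have bd: "b \<noteq> d" using dcb X by (auto simp: cl_incl)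
  have ne: "m \<noteq> a" "n \<noteq> a" "m \<noteq> a'" "n \<noteq> a'" using m n A A_M by auto
  have bm: "b \<in> cl {a, m}" "b' \<in> cl {a', m}" "d \<in> cl {a, n}" "d' \<in> cl {a', n}"
    using cl_pair_exchange[of a _ m] cl_pair_exchange[of a _ n]
      cl_pair_exchange[of a' _ m] cl_pair_exchange[of a' _ n] X m n ne by auto
  show ?thesis
  proof (cases "a = a'")
    case True
    \<comment> \<open>With \<open>a = a'\<close> the candidate collineation is the identity:
      \<open>x\<close> and \<open>x'\<close> both lie on \<open>c x\<close> and on a line through
      \<open>a\<close>, and these two lines are distinct.\<close>
    have "x' = x" if x: "arrow c x x'" "x \<notin> cl {c, a}" "x \<in> cl {a, l}" "x' \<in> cl {a, l}" "l \<in> X" for x x' l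
    proof (rule ccontr)
      assume "x' \<noteq> x"
      have xX: "x \<in> X" using x A_X by (auto simp: arrow_def)
      have "cl {c, x} = cl {a, l}"
        by (rule lines_meet_once[of _ _ _ _ x x'])
          (use x xX cX X \<open>x' \<noteq> x\<close> in \<open>auto simp: arrow_def cl_incl\<close>)
      then have "a \<in> cl {c, x}" using X by (metis cl_incl insertI1)
      then show False using off_line_sym[of a x] X xX x bc by blast
    qed
    then have "b' = b" "d' = d" using b d bca dca bm True mX by blast+
    moreover obtain l where "l \<in> M" "l \<in> cl {b, d}" using direction_exists[of b d] X bd by blast
    ultimately show ?thesis using dcb by (auto simp: aligned_def)
  next
    case False
    obtain l where l: "l \<in> M" "l \<in> cl {b, d}" using direction_exists[of b d] X bd by blast
    have d'b: "d' \<notin> cl {c, b}"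
    proof
      assume "d' \<in> cl {c, b}"
      then have "cl {c, d} = cl {c, b}"
        using lines_meet_once[of c d c b c d'] d X cX by (auto simp: arrow_def cl_incl)
      then show False using dcb X by (metis cl_incl insertI1 insert_commute)
    qed
    have b'd': "b' \<noteq> d'" using d'b b by (auto simp: arrow_def)
    have "\<exists>p. p \<in> cl {b, d} \<and> p \<in> cl {b', d'}"
    proof (cases "b' \<in> cl {b, d}")
      case True then show ?thesis using X by (auto simp: cl_incl)
    next
      case nb: False
      have "b' \<in> cl {c, b}" using b by (simp add: arrow_def)
      moreover have "b' \<noteq> b" using nb X by (auto simp: cl_incl)
      ultimately have "c \<in> cl {b', b}" using in_line_swap[of b c b'] X cX
        by (simp add: insert_commute)
      then have "c \<in> cl {b', b, d}" by (rule cl_mono_in) auto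
      then have "{c, d} \<subseteq> cl {b', b, d}" using X by (simp add: cl_incl)
      then have "d' \<in> cl {b', b, d}" using d cl_trans by (auto simp: arrow_def)
      then show ?thesis using meet[of b' "{b,d}" d'] X nb b'd' by blast
    qed
    then obtain p where p: "p \<in> cl {b, d}" "p \<in> cl {b', d'}" by blast
    have pM: "p \<in> M"
    proof (rule ccontr)
      assume "p \<notin> M"
      then have pmn: "p \<notin> cl {m, n}" using cl_M[of "{m,n}" p] m n by blast
      have "{b, d} \<subseteq> cl {a, m, n}"
        using bm cl_mono_in[of b "{a,m}" "{a,m,n}"] cl_mono_in[of d "{a,n}" "{a,m,n}"] by blast
      then have "p \<in> cl {a, m, n}" using p cl_trans by blast
      have "{b', d'} \<subseteq> cl {a', m, n}"
        using bm cl_mono_in[of b' "{a',m}" "{a',m,n}"] cl_mono_in[of d' "{a',n}" "{a',m,n}"]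
          by blast
      then have "p \<in> cl {a', m, n}" using p cl_trans by blast
      then have a'p: "a' \<in> cl {p, m, n}" using exchange[of a' p "{m,n}"] X pmn by blast
      have mn: "{m, n} \<subseteq> cl {a, b, d}"
        using m n cl_mono_in[of m "{a,b}" "{a,b,d}"] cl_mono_in[of n "{a,d}" "{a,b,d}"] by blast
      have "p \<in> cl {a, b, d}" using p cl_mono_in[of p "{b,d}" "{a,b,d}"] by blast
      then have "a' \<in> cl {a, b, d}" using a'p mn cl_trans[of a' "{p,m,n}" "{a,b,d}"] by blast
      then have "{a, a'} \<subseteq> cl {a, b, d}" using X by (simp add: cl_incl)
      moreover have "a' \<in> cl {a, c}" using a by (simp add: arrow_def insert_commute)
      then have "c \<in> cl {a, a'}" using cl_pair_exchange[of a c a'] X cX False by blast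
      ultimately have "c \<in> cl {a, b, d}" using cl_trans by blast
      then have cdab: "c \<in> cl (insert d {a, b})" by (simp add: insert_commute)
      have "b \<noteq> a" using bca X by (auto simp: cl_incl)
      then have "c \<notin> cl {a, b}"
        using in_line_swap[of a b c] bca X bc by auto
      then have "d \<in> cl {c, a, b}" using exchange[OF _ cdab] X by blast
      then show False using dn by blast
    qed
    then have "p = l" using direction_unique[of b d p l b] p l X A by (auto simp: cl_incl)
    then show ?thesis using p l dcb by (auto simp: aligned_def)
  qed
qed

text \<open>The planar case is reduced to the spatial one: an arrow at a point \<open>z\<close>
  outside the plane is aligned with all three given arrows, and then serves as base in place of
  \<open>a\<close>.\<close>

lemma aligned_trans:
  assumes a: "arrow c a a'" and b: "arrow c b b'" and d: "arrow c d d'"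
    and ab: "aligned c a a' b b'" and ad: "aligned c a a' d d'" and dn: "d \<notin> cl {c, b}"
  shows "aligned c b b' d d'"
proof (cases "d \<in> cl {c, a, b}")
  case False then show ?thesis using aligned_trans_spatial assms by blast
next
  case True
  have X: "a \<in> X" "a' \<in> X" "b \<in> X" "b' \<in> X" "d \<in> X" "d' \<in> X"
    using arrow_in a b d by blast+
  obtain z where z: "z \<in> A" "z \<notin> cl {c, a, b}" using point_outside_plane X cX by blast
  have zX: "z \<in> X" using z A_X by blast
  have zca: "z \<notin> cl {c, a}" using z cl_mono_in[of z "{c,a}" "{c,a,b}"] by blast
  obtain z' where z': "arrow c z z'" "aligned c a a' z z'"
    using aligned_exists[OF a z(1) zca] by blast
  have bz: "aligned c b b' z z'" using aligned_trans_spatial[OF a b z'(1) ab z'(2) z(2)] .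
  have "z \<notin> cl {c, a, d}"
  proof
    assume "z \<in> cl {c, a, d}"
    moreover have "{c, a, d} \<subseteq> cl {c, a, b}" using True X cX by (simp add: cl_incl)
    ultimately show False using cl_trans z by blast
  qed
  then have dz: "aligned c d d' z z'" using aligned_trans_spatial[OF a d z'(1) ad z'(2)] by blast
  have "d \<notin> cl {c, z, b}"
  proof
    assume "d \<in> cl {c, z, b}"
    then have "z \<in> cl (insert d {c, b})" using exchange[of z d "{c,b}"] dn zX
      by (simp add: insert_commute)
    moreover have "insert d {c, b} \<subseteq> cl {c, a, b}" using True X cX by (simp add: cl_incl)
    ultimately show False using cl_trans z by blast
  qed
  then show ?thesis
    using aligned_trans_spatial[OF z'(1) b d] aligned_sym bz dz b d z' by blast
qed

text \<open>Elations (\<open>c\<close> at infinity) and homologies (\<open>c\<close> affine) are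
  treated together. The arrow at \<open>a\<close> determines the images of points off the line
  \<open>c a\<close> only; on that line an auxiliary arrow at \<open>b\<close> is used, and the work
  lies in showing that the two halves fit.\<close>

lemma central_collineation:
  assumes a: "arrow c a a'"
  obtains \<phi> where "\<And>x. x \<in> A \<Longrightarrow> \<phi> x \<in> A" "\<phi> a = a'" "\<phi> c = c"
    "\<And>x. x \<in> A \<Longrightarrow> \<phi> x \<in> cl {c, x}"
    "\<And>m x y. \<lbrakk>m \<in> M; x \<in> A; y \<in> A; x \<in> cl {y, m}\<rbrakk> \<Longrightarrow> \<phi> x \<in> cl {\<phi> y, m}"
proof -
  have aX: "a \<in> X" "a \<noteq> c" using a A_X by (auto simp: arrow_def)
  \<comment> \<open>The degenerate plane \<open>{c, a, a}\<close> stands for the line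
    \<open>c a\<close>.\<close>
  obtain b where b: "b \<in> A" "b \<notin> cl {c, a, a}" using point_outside_plane cX aX by metis
  have bX: "b \<in> X" using b A_X by blast
  have bca: "b \<notin> cl {c, a}" using b by simp
  obtain b' where b': "arrow c b b'" "aligned c a a' b b'" using aligned_exists[OF a b(1) bca] .
  define \<phi> where "\<phi> x = (if x = c then c
    else if x \<in> cl {c, a} then SOME x'. arrow c x x' \<and> aligned c b b' x x'
    else SOME x'. arrow c x x' \<and> aligned c a a' x x')" for x
  have \<phi>1: "arrow c x (\<phi> x) \<and> aligned c b b' x (\<phi> x)" if x: "x \<in> A" "x \<noteq> c" "x \<in> cl {c, a}" for x
  proof -
    have "x \<notin> cl {c, b}"
    proof
      assume "x \<in> cl {c, b}"
      then have "cl {c, a} = cl {c, b}"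
        using lines_meet_once[of c a c b c x] x cX aX bX by (auto simp: cl_incl)
      then show False using bca bX by (simp add: cl_incl)
    qed
    then obtain x' where "arrow c x x' \<and> aligned c b b' x x'"
      using aligned_exists[OF b'(1) x(1)] by blast
    then show ?thesis
      using x someI[of "\<lambda>x'. arrow c x x' \<and> aligned c b b' x x'" x'] by (simp add: \<phi>_def)
  qed
  have \<phi>2: "arrow c x (\<phi> x) \<and> aligned c a a' x (\<phi> x)" if x: "x \<in> A" "x \<notin> cl {c, a}" for x
  proof -
    obtain x' where "arrow c x x' \<and> aligned c a a' x x'" using aligned_exists[OF a x] by blast
    moreover have "x \<noteq> c" using x cX by (auto simp: cl_incl)
    ultimately show ?thesis
      using x someI[of "\<lambda>x'. arrow c x x' \<and> aligned c a a' x x'" x'] by (simp add: \<phi>_def)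
  qed
  have arr: "arrow c x (\<phi> x)" if "x \<in> A" "x \<noteq> c" for x using \<phi>1 \<phi>2 that by blast
  have aA: "a \<in> A" using a by (simp add: arrow_def)
  have "a \<in> cl {c, a}" using aX by (simp add: cl_incl)
  then have \<phi>a: "\<phi> a = a'"
    using \<phi>1[of a] aX aA aligned_unique[OF b'(1), of a "\<phi> a" a'] a
      aligned_sym[OF a b'(1) b'(2)] by blast
  have mixed: "aligned c x (\<phi> x) y (\<phi> y)"
    if x: "x \<in> A" "x \<noteq> c" "x \<in> cl {c, a}" and y: "y \<in> A" "y \<notin> cl {c, a}" for x y
  proof -
    have xX: "x \<in> X" "y \<in> X" using x y A_X by auto
    have "cl {c, x} = cl {c, a}" using line_eq[of c a c x] x cX aX by (simp add: cl_incl)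
    then have ycx: "y \<notin> cl {c, x}" using y by simp
    show ?thesis
    proof (cases "y \<in> cl {c, b}")
      case False
      then have "aligned c b b' y (\<phi> y)"
        using aligned_trans[OF a b'(1)] \<phi>2[OF y] b' by blast
      then show ?thesis using aligned_trans[OF b'(1)] \<phi>1[OF x] \<phi>2[OF y] ycx by blast
    next
      \<comment> \<open>Points of the line \<open>c b\<close> cannot be compared with the arrow at
        \<open>b\<close> directly, so the comparison goes through a point \<open>z\<close> off both
        lines.\<close>
      case True
      obtain z where z: "z \<in> A" "z \<notin> cl {c, a, b}" using point_outside_plane cX aX bX by metis
      have zX: "z \<in> X" using z A_X by blast
      have zn: "z \<notin> cl {c, a}" "z \<notin> cl {c, b}"
        using z cl_mono_in[of z "{c,a}" "{c,a,b}"] cl_mono_in[of z "{c,b}" "{c,a,b}"] by blast+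
      have "y \<noteq> c" using y cX by (auto simp: cl_incl)
      have yz: "y \<notin> cl {c, z}"
      proof
        assume "y \<in> cl {c, z}"
        then have "z \<in> cl {c, y}" using cl_pair_exchange[of c z y] cX zX \<open>y \<noteq> c\<close> by blast
        moreover have "{c, y} \<subseteq> cl {c, b}" using True cX by (simp add: cl_incl)
        ultimately show False using zn cl_trans by blast
      qed
      have zx: "z \<notin> cl {c, x}" using zn \<open>cl {c, x} = cl {c, a}\<close> by simp
      have \<phi>z: "arrow c z (\<phi> z)" "aligned c a a' z (\<phi> z)" using \<phi>2[OF z(1)] zn by auto
      have "aligned c b b' z (\<phi> z)" using aligned_trans[OF a b'(1) \<phi>z(1) b'(2) \<phi>z(2)] zn by blast
      then have xz: "aligned c x (\<phi> x) z (\<phi> z)"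
        using aligned_trans[OF b'(1) _ \<phi>z(1)] \<phi>1[OF x] zx by blast
      have "aligned c z (\<phi> z) y (\<phi> y)" using aligned_trans[OF a \<phi>z(1)] \<phi>2[OF y] \<phi>z yz by blast
      then show ?thesis
        using aligned_trans[OF \<phi>z(1)] xz aligned_sym \<phi>z(1) \<phi>1[OF x] \<phi>2[OF y] ycx by blast
    qed
  qed
  have al: "aligned c x (\<phi> x) y (\<phi> y)"
    if x: "x \<in> A" "x \<noteq> c" and y: "y \<in> A" "y \<notin> cl {c, x}" for x y
  proof -
    have xX: "x \<in> X" "y \<in> X" using x y A_X by auto
    have yc: "y \<noteq> c" using y cX by (auto simp: cl_incl)
    consider "x \<in> cl {c, a}" "y \<in> cl {c, a}" | "x \<in> cl {c, a}" "y \<notin> cl {c, a}"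
      | "x \<notin> cl {c, a}" "y \<in> cl {c, a}" | "x \<notin> cl {c, a}" "y \<notin> cl {c, a}" by blast
    then show ?thesis
    proof cases
      case 1
      then have "cl {c, x} = cl {c, a}" using line_eq[of c a c x] x cX aX by (simp add: cl_incl)
      then show ?thesis using 1 y by blast
    next
      case 2 then show ?thesis using mixed x y by blast
    next
      case 3
      then show ?thesis using mixed[of y x] x y yc aligned_sym arr by blast
    next
      case 4
      then show ?thesis using aligned_trans[OF a] \<phi>2 x y by blast
    qed
  qed
  have \<phi>cl: "\<phi> x \<in> cl {c, x}" if "x \<in> A" for x
    using arr[of x] that cX by (cases "x = c") (auto simp: arrow_def cl_incl \<phi>_def)
  have \<phi>A: "\<phi> x \<in> A" if "x \<in> A" for x
    using arr[of x] that by (cases "x = c") (auto simp: arrow_def \<phi>_def)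
  have dil: "\<phi> x \<in> cl {\<phi> y, m}" if m: "m \<in> M" "x \<in> A" "y \<in> A" "x \<in> cl {y, m}" for m x y
  proof -
    have X: "x \<in> X" "y \<in> X" "m \<in> X" "\<phi> x \<in> X" "\<phi> y \<in> X" using m A_X M_X \<phi>A by auto
    have ne: "m \<noteq> y" "m \<noteq> x" "m \<noteq> \<phi> x" "m \<noteq> \<phi> y" using m \<phi>A A_M by auto
    \<comment> \<open>A line through the centre is mapped into itself, so it keeps its direction
      without any use of alignment.\<close>
    have on: "\<phi> x \<in> cl {\<phi> y, m}" if l: "l \<in> X" "x \<in> cl {c, l}" "y \<in> cl {c, l}" "x \<noteq> y" for l
    proof -
      have "cl {x, y} = cl {c, l}" using line_eq[of c l x y] l cX by blast
      moreover have "m \<in> cl {x, y}" using in_line_swap[of y m x] m l X by auto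
      ultimately have ml: "m \<in> cl {c, l}" by simp
      have "{c, x} \<subseteq> cl {c, l}" "{c, y} \<subseteq> cl {c, l}" using l cX by (auto simp: cl_incl)
      then have "\<phi> x \<in> cl {c, l}" "\<phi> y \<in> cl {c, l}" using \<phi>cl m cl_trans by blast+
      then show ?thesis using line_eq[of c l "\<phi> y" m] ml cX l ne by blast
    qed
    show ?thesis
    proof (cases "x = y")
      case True then show ?thesis using X by (simp add: cl_incl)
    next
      case xy: False
      show ?thesis
      proof (cases "x = c \<or> y \<in> cl {c, x}")
        case True
        then show ?thesis using on[of x] on[of y] xy X by (auto simp: cl_incl)
      next
        case False
        then have "aligned c x (\<phi> x) y (\<phi> y)" using al m by blast
        then obtain k where k: "k \<in> M" "k \<in> cl {x, y}" "k \<in> cl {\<phi> x, \<phi> y}"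
          by (auto simp: aligned_def)
        have "m \<in> cl {x, y}" using in_line_swap[of y m x] m xy X by auto
        then have "k = m" using direction_unique[of x y k m x] k m X by (simp add: cl_incl)
        then have "m \<in> cl {\<phi> y, \<phi> x}" using k by (simp add: insert_commute)
        then show ?thesis using cl_pair_exchange[of "\<phi> y" "\<phi> x" m] X ne by blast
      qed
    qed
  qed
  show ?thesis using that[of \<phi>] \<phi>A \<phi>a \<phi>cl dil by (simp add: \<phi>_def)
qed

end

end

section \<open>Translations and scalars\<close>

text \<open>Injectivity is not demanded, so the constant map to the origin is a dilation and can act
  as the scalar zero, and sums of dilations fixing the origin remain dilations.\<close>

definition dilation :: "'p set \<Rightarrow> 'd set \<Rightarrow> ('d \<Rightarrow> 'p \<Rightarrow> 'p \<Rightarrow> bool) \<Rightarrow> ('p \<Rightarrow> 'p) \<Rightarrow> bool" where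
  "dilation P D par \<sigma> \<longleftrightarrow> (\<forall>x\<in>P. \<sigma> x \<in> P) \<and>
     (\<forall>m\<in>D. \<forall>x\<in>P. \<forall>y\<in>P. par m x y \<longrightarrow> par m (\<sigma> x) (\<sigma> y))"

definition translation_along ::
    "'p set \<Rightarrow> 'd set \<Rightarrow> ('d \<Rightarrow> 'p \<Rightarrow> 'p \<Rightarrow> bool) \<Rightarrow> 'd \<Rightarrow> ('p \<Rightarrow> 'p) \<Rightarrow> bool" where
  "translation_along P D par m \<tau> \<longleftrightarrow> dilation P D par \<tau> \<and> (\<forall>x\<in>P. par m x (\<tau> x))"

text \<open>An affine space given by its points \<open>P\<close>, its parallel classes \<open>D\<close> of lines (the points at
  infinity) and the relation \<open>par m x y\<close>: the line through \<open>x\<close> in direction \<open>m\<close> contains \<open>y\<close>.\<close>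

locale translation_space =
  fixes P :: "'p set" and D :: "'d set" and par :: "'d \<Rightarrow> 'p \<Rightarrow> 'p \<Rightarrow> bool"
    and z0 :: 'p and i0 :: 'p
  assumes par_refl: "\<lbrakk>m \<in> D; x \<in> P\<rbrakk> \<Longrightarrow> par m x x"
    and par_sym: "\<lbrakk>m \<in> D; x \<in> P; y \<in> P; par m x y\<rbrakk> \<Longrightarrow> par m y x"
    and par_trans: "\<lbrakk>m \<in> D; x \<in> P; y \<in> P; z \<in> P; par m x y; par m y z\<rbrakk> \<Longrightarrow> par m x z"
    and par_exists: "\<lbrakk>x \<in> P; y \<in> P\<rbrakk> \<Longrightarrow> \<exists>m\<in>D. par m x y"
    and par_unique: "\<lbrakk>m \<in> D; k \<in> D; x \<in> P; y \<in> P; par m x y; par k x y; m \<noteq> k\<rbrakk> \<Longrightarrow> x = y"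
    and avoid: "\<lbrakk>x \<in> P; m \<in> D; k \<in> D\<rbrakk> \<Longrightarrow>
      \<exists>z\<in>P. \<forall>y\<in>P. par m x y \<or> par k x y \<longrightarrow> \<not> par m y z \<and> \<not> par k y z"
    and translation_exists: "\<lbrakk>x \<in> P; y \<in> P\<rbrakk> \<Longrightarrow> \<exists>m\<in>D. \<exists>\<tau>. translation_along P D par m \<tau> \<and> \<tau> x = y"
    and homothety_exists: "\<lbrakk>m \<in> D; x \<in> P; y \<in> P; par m z0 x; par m z0 y; x \<noteq> z0\<rbrakk> \<Longrightarrow>
      \<exists>\<sigma>. dilation P D par \<sigma> \<and> \<sigma> z0 = z0 \<and> \<sigma> x = y"
    and z0: "z0 \<in> P" and i0: "i0 \<in> P" "i0 \<noteq> z0"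
begin

section \<open>Rigidity of dilations, and composition of translations\<close>

abbreviation "dil \<equiv> dilation P D par"
abbreviation "trl \<equiv> translation_along P D par"

lemma dil_closed: "dil \<sigma> \<Longrightarrow> x \<in> P \<Longrightarrow> \<sigma> x \<in> P"
  and dil_par: "\<lbrakk>dil \<sigma>; m \<in> D; x \<in> P; y \<in> P; par m x y\<rbrakk> \<Longrightarrow> par m (\<sigma> x) (\<sigma> y)"
  by (auto simp: dilation_def)

lemma trl_dil: "trl m \<tau> \<Longrightarrow> dil \<tau>" and trl_par: "trl m \<tau> \<Longrightarrow> x \<in> P \<Longrightarrow> par m x (\<tau> x)"
  by (auto simp: translation_along_def)

lemma trl_closed: "trl m \<tau> \<Longrightarrow> x \<in> P \<Longrightarrow> \<tau> x \<in> P"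
  using trl_dil dil_closed by blast

lemma dil_id: "dil (\<lambda>x. x)"
  by (auto simp: dilation_def)

lemma dil_const: "p \<in> P \<Longrightarrow> dil (\<lambda>x. p)"
  using par_refl by (auto simp: dilation_def)

lemma dil_comp: "dil \<sigma> \<Longrightarrow> dil \<rho> \<Longrightarrow> dil (\<lambda>x. \<sigma> (\<rho> x))"
  by (auto simp: dilation_def)

lemma avoid_line: assumes "x \<in> P" "m \<in> D" obtains z where "z \<in> P" "\<not> par m x z" "z \<noteq> x"
  using avoid[OF assms assms(2)] par_refl[OF assms(2,1)] assms by blast

lemma join_two_directions:
  assumes "m \<in> D" "k \<in> D" "m \<noteq> k" "a \<in> P" "b \<in> P" "x \<in> P" "y \<in> P"
    "par m a x" "par m a y" "par k b x" "par k b y"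
  shows "x = y"
proof -
  have "par m x y" using par_trans[of m x a y] par_sym[of m a x] assms by blast
  moreover have "par k x y" using par_trans[of k x b y] par_sym[of k b x] assms by blast
  ultimately show ?thesis using par_unique assms by blast
qed

lemma dil_eq_off_line:
  assumes d: "dil \<sigma>" "dil \<rho>" and xy: "x \<in> P" "y \<in> P" "m \<in> D" "par m x y" "x \<noteq> y"
    and eq: "\<sigma> x = \<rho> x" "\<sigma> y = \<rho> y" and z: "z \<in> P" "\<not> par m x z"
  shows "\<sigma> z = \<rho> z"
proof -
  obtain k where k: "k \<in> D" "par k x z" using par_exists xy z by blast
  obtain l where l: "l \<in> D" "par l y z" using par_exists xy z by blast
  have "k \<noteq> l"
  proof
    assume "k = l"
    then have "par k x y" using par_trans[of k x z y] par_sym[of k y z] k l xy z by blast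
    then have "k = m" using par_unique[of k m x y] xy k by blast
    then show False using k z by blast
  qed
  moreover have "par k (\<sigma> x) (\<sigma> z)" "par k (\<sigma> x) (\<rho> z)" "par l (\<sigma> y) (\<sigma> z)" "par l (\<sigma> y) (\<rho> z)"
    using d dil_par[of \<sigma>] dil_par[of \<rho>] k l xy z eq by metis+
  ultimately show ?thesis
    using join_two_directions[of k l "\<sigma> x" "\<sigma> y" "\<sigma> z" "\<rho> z"] k l d dil_closed xy z by blast
qed

text \<open>Off the line \<open>x y\<close> an image is the intersection of two lines through known
  points with known directions. A point on that line is handled from \<open>x\<close> and an
  auxiliary point \<open>w\<close> off it.\<close>

lemma dil_eq:
  assumes d: "dil \<sigma>" "dil \<rho>" and xy: "x \<in> P" "y \<in> P" "x \<noteq> y"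
    and eq: "\<sigma> x = \<rho> x" "\<sigma> y = \<rho> y" and z: "z \<in> P"
  shows "\<sigma> z = \<rho> z"
proof -
  obtain m where m: "m \<in> D" "par m x y" using par_exists xy by blast
  show ?thesis
  proof (cases "par m x z \<and> z \<noteq> x")
    case False
    then show ?thesis using dil_eq_off_line[OF d xy(1,2) m xy(3) eq z] eq by blast
  next
    case True
    obtain w where w: "w \<in> P" "\<not> par m x w" "w \<noteq> x" using avoid_line xy m by blast
    have "\<sigma> w = \<rho> w" using dil_eq_off_line[OF d xy(1,2) m xy(3) eq] w by blast
    moreover obtain k where k: "k \<in> D" "par k x w" using par_exists xy w by blast
    moreover have "\<not> par k x z" using par_unique[of k m x z] k True m xy z w by blast
    ultimately show ?thesis
      using dil_eq_off_line[OF d xy(1) w(1), of k z] eq z w by blast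
  qed
qed

lemma trl_fixpoint:
  assumes t: "m \<in> D" "trl m \<tau>" and x: "x \<in> P" "\<tau> x = x" and z: "z \<in> P"
  shows "\<tau> z = z"
proof -
  obtain w where w: "w \<in> P" "\<not> par m x w" "w \<noteq> x" using avoid_line x t by blast
  obtain k where k: "k \<in> D" "par k x w" using par_exists x w by blast
  have "par k x (\<tau> w)" using dil_par[OF trl_dil[OF t(2)] k(1) x(1) w(1) k(2)] x by simp
  moreover have "par m w (\<tau> w)" "\<tau> w \<in> P" using t w trl_par trl_closed by blast+
  ultimately have "w = \<tau> w"
    using join_two_directions[of k m x w w "\<tau> w"] k w x t par_refl by blast
  then show ?thesis using dil_eq[OF trl_dil[OF t(2)] dil_id x(1) w(1)] x w z by simp
qed

lemma trl_eq:
  assumes t: "m \<in> D" "trl m \<tau>" and s: "k \<in> D" "trl k \<sigma>" and x: "x \<in> P" "\<tau> x = \<sigma> x" and z: "z \<in> P"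
  shows "\<tau> z = \<sigma> z"
proof (cases "\<tau> x = x")
  case True then show ?thesis using trl_fixpoint t s x z by metis
next
  case False
  have "m = k" using par_unique[of m k x "\<tau> x"] t s x trl_par[OF t(2)] trl_par[OF s(2)]
      trl_closed[OF t(2)] False by metis
  obtain w where w: "w \<in> P" "\<not> par m x w" "w \<noteq> x" using avoid_line x t by blast
  obtain l where l: "l \<in> D" "par l x w" using par_exists x w by blast
  have "par l (\<tau> x) (\<tau> w)" "par l (\<tau> x) (\<sigma> w)"
    using dil_par[OF trl_dil[OF t(2)] l(1) x(1) w(1)] dil_par[OF trl_dil[OF s(2)] l(1) x(1) w(1)] l
      x by auto
  then have "\<tau> w = \<sigma> w"
    using join_two_directions[of l m "\<tau> x" w "\<tau> w" "\<sigma> w"] l w x t s \<open>m = k\<close> trl_par trl_closed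
      by metis
  then show ?thesis using dil_eq[OF trl_dil[OF t(2)] trl_dil[OF s(2)] x(1) w(1)] x w z by metis
qed

text \<open>Both composites are the fourth vertex of the parallelogram on \<open>x\<close>,
  \<open>\<sigma> x\<close>, \<open>\<tau> x\<close>.\<close>

lemma trl_commute_distinct:
  assumes t: "m \<in> D" "trl m \<tau>" and s: "k \<in> D" "trl k \<sigma>" and mk: "m \<noteq> k" and x: "x \<in> P"
  shows "\<tau> (\<sigma> x) = \<sigma> (\<tau> x)"
proof -
  have c: "\<sigma> x \<in> P" "\<tau> x \<in> P" "\<tau> (\<sigma> x) \<in> P" "\<sigma> (\<tau> x) \<in> P" using trl_closed t s x by blast+
  have "par m (\<sigma> x) (\<tau> (\<sigma> x))" "par k (\<tau> x) (\<sigma> (\<tau> x))" using trl_par t s c by blast+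
  moreover have "par k (\<tau> x) (\<tau> (\<sigma> x))"
    using dil_par[OF trl_dil[OF t(2)]] s c x trl_par by blast
  moreover have "par m (\<sigma> x) (\<sigma> (\<tau> x))"
    using dil_par[OF trl_dil[OF s(2)]] t c x trl_par by blast
  ultimately show ?thesis
    using join_two_directions[of m k "\<sigma> x" "\<tau> x" "\<tau> (\<sigma> x)" "\<sigma> (\<tau> x)"] t s mk c by blast
qed

text \<open>For distinct directions the composite moves \<open>z0\<close> in some direction
  \<open>n\<close>. A translation \<rho> from \<open>x\<close> to \<open>y\<close> whose direction
  differs from \<open>m\<close> and \<open>k\<close> commutes with both factors, so it carries the
  displacement of \<open>x\<close> to that of \<open>y\<close> and preserves
  \<open>n\<close>.\<close>

lemma trl_comp:
  assumes t: "m \<in> D" "trl m \<tau>" and s: "k \<in> D" "trl k \<sigma>"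
  shows "\<exists>n\<in>D. trl n (\<lambda>x. \<tau> (\<sigma> x))"
proof (cases "m = k")
  case True
  have "par m x (\<tau> (\<sigma> x))" if "x \<in> P" for x
    using par_trans[of m x "\<sigma> x" "\<tau> (\<sigma> x)"] that t s True trl_par trl_closed by metis
  then show ?thesis using t s dil_comp[OF trl_dil trl_dil] by (auto simp: translation_along_def)
next
  case False
  let ?f = "\<lambda>x. \<tau> (\<sigma> x)"
  have d: "dil ?f" using dil_comp trl_dil t s by blast
  obtain n where n: "n \<in> D" "par n z0 (?f z0)"
    using par_exists[of z0 "?f z0"] z0 d dil_closed[of ?f] by blast
  have step: "par n y (?f y)" if xy: "x \<in> P" "y \<in> P" "par n x (?f x)" "\<not> par m x y" "\<not> par k x y" for x y
  proof -
    obtain l \<rho> where r: "l \<in> D" "trl l \<rho>" "\<rho> x = y" using translation_exists xy by blast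
    have "par l x y" using r trl_par xy by blast
    then have "l \<noteq> m" "l \<noteq> k" using xy by auto
    then have "?f y = \<rho> (?f x)"
      using trl_commute_distinct[OF t r(1,2)] trl_commute_distinct[OF s r(1,2)] xy r s trl_closed
        by metis
    then show ?thesis
      using dil_par[OF trl_dil[OF r(2)] n(1) xy(1) _ xy(3)] r xy dil_closed[OF d] by metis
  qed
  have "par n y (?f y)" if y: "y \<in> P" for y
  proof (cases "par m z0 y \<or> par k z0 y")
    case False then show ?thesis using step z0 n y by blast
  next
    case True
    \<comment> \<open>A point on one of the two exceptional lines through \<open>z0\<close> is
      reached in two steps, via a \<open>z\<close> that lies in neither direction from any such
      point.\<close>
    obtain z where z: "z \<in> P" "\<forall>y\<in>P. par m z0 y \<or> par k z0 y \<longrightarrow> \<not> par m y z \<and> \<not> par k y z"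
      using avoid z0 t s by blast
    have "par n z (?f z)" using step[of z0 z] z z0 n par_refl t by blast
    moreover have "\<not> par m z y" "\<not> par k z y" using z True y par_sym t s by blast+
    ultimately show ?thesis using step z y by blast
  qed
  then show ?thesis using d n by (auto simp: translation_along_def)
qed

lemma trl_inj:
  assumes t: "m \<in> D" "trl m \<tau>" and xy: "x \<in> P" "y \<in> P" "\<tau> x = \<tau> y"
  shows "x = y"
proof -
  obtain k \<sigma> where s: "k \<in> D" "trl k \<sigma>" "\<sigma> (\<tau> x) = x"
    using translation_exists xy trl_closed[OF t(2)] by metis
  obtain n where "n \<in> D" "trl n (\<lambda>x. \<sigma> (\<tau> x))" using trl_comp s t by blast
  then have "\<sigma> (\<tau> y) = y" using trl_fixpoint[of n _ x y] s xy by blast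
  then show ?thesis using s xy by simp
qed

text \<open>For a common direction, compose \<tau> with a translation \<rho> in another direction:
  both \<rho> and the composite commute with \<sigma> by the case of distinct directions, and \<rho>
  cancels.\<close>

lemma trl_commute:
  assumes t: "m \<in> D" "trl m \<tau>" and s: "k \<in> D" "trl k \<sigma>" and x: "x \<in> P"
  shows "\<tau> (\<sigma> x) = \<sigma> (\<tau> x)"
proof (cases "m = k")
  case False then show ?thesis using trl_commute_distinct assms by blast
next
  case True
  obtain z where z: "z \<in> P" "\<not> par m z0 z" "z \<noteq> z0" using avoid_line z0 t by blast
  obtain l \<rho> where r: "l \<in> D" "trl l \<rho>" "\<rho> z0 = z" using translation_exists z z0 by blast
  have "l \<noteq> m" using trl_par[OF r(2) z0] r z by auto
  obtain n where n: "n \<in> D" "trl n (\<lambda>x. \<rho> (\<tau> x))" using trl_comp r t by blast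
  have c: "\<tau> z0 \<in> P" "\<rho> (\<tau> z0) \<in> P" using t r trl_closed z0 by blast+
  have "n \<noteq> m"
  proof
    assume "n = m"
    then have "par m z0 (\<rho> (\<tau> z0))" using trl_par[OF n(2) z0] by simp
    moreover have "par m z0 (\<tau> z0)" using trl_par t z0 by blast
    moreover have "par l (\<tau> z0) (\<rho> (\<tau> z0))" using trl_par r c by blast
    ultimately have "\<rho> (\<tau> z0) = \<tau> z0"
      using join_two_directions[of m l z0 "\<tau> z0" "\<rho> (\<tau> z0)" "\<tau> z0"] c z0 t r \<open>l \<noteq> m\<close> par_refl
        by blast
    then have "\<rho> z0 = z0" using trl_fixpoint[OF r(1,2) c(1)] z0 by blast
    then show False using r z by simp
  qed
  then have "\<rho> (\<tau> (\<sigma> x)) = \<sigma> (\<rho> (\<tau> x))"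
    using trl_commute_distinct[OF n s _ x] True by simp
  also have "\<dots> = \<rho> (\<sigma> (\<tau> x))"
    using trl_commute_distinct[OF s r(1,2), of "\<tau> x"] \<open>l \<noteq> m\<close> True trl_closed[OF t(2) x] by simp
  finally show ?thesis using trl_inj[OF r(1,2)] t s x trl_closed by metis
qed

section \<open>The points as the abelian group of translations\<close>

definition tr :: "'p \<Rightarrow> 'p \<Rightarrow> 'p" where
  "tr p = (SOME \<tau>. (\<exists>m\<in>D. trl m \<tau>) \<and> \<tau> z0 = p)"

definition vadd :: "'p \<Rightarrow> 'p \<Rightarrow> 'p" (infixl "\<uplus>" 65) where
  "p \<uplus> q = tr p q"

lemma tr: assumes "p \<in> P" shows "\<exists>m\<in>D. trl m (tr p)" "tr p z0 = p"
proof -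
  have "\<exists>\<tau>. (\<exists>m\<in>D. trl m \<tau>) \<and> \<tau> z0 = p" using translation_exists[OF z0 assms] by blast
  from someI_ex[OF this] show "\<exists>m\<in>D. trl m (tr p)" "tr p z0 = p" by (auto simp: tr_def)
qed

lemma tr_eq: assumes "m \<in> D" "trl m \<tau>" "z \<in> P" shows "\<tau> z = \<tau> z0 \<uplus> z"
proof -
  have "\<tau> z0 \<in> P" using assms trl_closed z0 by blast
  from tr[OF this] show ?thesis
    using trl_eq[OF assms(1,2) _ _ z0] assms(3) unfolding vadd_def by metis
qed

lemma vadd_closed: "\<lbrakk>p \<in> P; q \<in> P\<rbrakk> \<Longrightarrow> p \<uplus> q \<in> P"
  using tr(1) trl_closed by (metis vadd_def)

lemma vadd_zero_right: "p \<in> P \<Longrightarrow> p \<uplus> z0 = p"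
  by (simp add: vadd_def tr(2))

lemma vadd_comm: assumes "p \<in> P" "q \<in> P" shows "p \<uplus> q = q \<uplus> p"
  using trl_commute[of _ "tr p" _ "tr q" z0] tr[OF assms(1)] tr[OF assms(2)] z0 by (metis vadd_def)

lemma vadd_zero_left: "p \<in> P \<Longrightarrow> z0 \<uplus> p = p"
  using vadd_comm vadd_zero_right z0 by simp

lemma vadd_assoc: assumes "p \<in> P" "q \<in> P" "r \<in> P" shows "p \<uplus> q \<uplus> r = p \<uplus> (q \<uplus> r)"
proof -
  obtain n where "n \<in> D" "trl n (\<lambda>x. tr p (tr q x))" using trl_comp tr assms by metis
  then show ?thesis using tr_eq[of n "\<lambda>x. tr p (tr q x)" r] assms tr by (simp add: vadd_def)
qed

lemma vadd_inverse: assumes "p \<in> P" shows "\<exists>q\<in>P. q \<uplus> p = z0"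
proof -
  obtain m \<tau> where t: "m \<in> D" "trl m \<tau>" "\<tau> p = z0" using translation_exists assms z0 by metis
  then show ?thesis using tr_eq[of m \<tau> p] assms trl_closed[OF t(2)] by metis
qed

text \<open>The ring fields \<open>mult\<close> and \<open>one\<close> of the record are dummies. A
  dilation fixing \<open>z0\<close> is determined by its value at \<open>i0\<close>, so for
  \<open>a\<close> on the line \<open>z0 i0\<close> the choice in \<open>smult\<close> is unique on
  \<open>P\<close>.\<close>

definition V :: "('p, 'p) module" where
  "V = \<lparr>carrier = P, monoid.mult = (\<lambda>x y. z0), one = z0, zero = z0, add = vadd,
        smult = (\<lambda>a x. (SOME \<sigma>. dil \<sigma> \<and> \<sigma> z0 = z0 \<and> \<sigma> i0 = a) x)\<rparr>"

lemma V_simps [simp]: "carrier V = P" "\<zero>\<^bsub>V\<^esub> = z0" "p \<oplus>\<^bsub>V\<^esub> q = p \<uplus> q"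
  by (simp_all add: V_def)

lemma abelian_group_V: "abelian_group V"
  by (rule abelian_groupI)
    (auto simp: vadd_closed z0 vadd_assoc vadd_zero_left vadd_inverse intro: vadd_comm)

sublocale V: abelian_group V by (rule abelian_group_V)

lemma vadd_lcomm: "\<lbrakk>p \<in> P; q \<in> P; r \<in> P\<rbrakk> \<Longrightarrow> p \<uplus> (q \<uplus> r) = q \<uplus> (p \<uplus> r)"
  using V.add.m_lcomm by simp

lemmas vadd_ac = vadd_assoc vadd_comm vadd_lcomm

lemma diff_add: "\<lbrakk>p \<in> P; q \<in> P\<rbrakk> \<Longrightarrow> (p \<ominus>\<^bsub>V\<^esub> q) \<uplus> q = p"
  using V.add.m_assoc[of p "\<ominus>\<^bsub>V\<^esub> q" q] V.l_neg[of q] V.a_inv_closed[of q]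
  by (simp add: a_minus_def vadd_zero_right)

lemma par_vadd:
  assumes "m \<in> D" "p \<in> P" "q \<in> P"
  shows "par m q (p \<uplus> q) \<longleftrightarrow> par m z0 p"
proof -
  obtain k where k: "k \<in> D" "trl k (tr p)" using tr assms by blast
  have "par k z0 p" "par k q (p \<uplus> q)"
    using trl_par[OF k(2) z0] trl_par[OF k(2) assms(3)] tr assms by (auto simp: vadd_def)
  moreover have "p = z0 \<longleftrightarrow> q = p \<uplus> q"
    using V.add.r_cancel_one'[of q p] assms by auto
  ultimately show ?thesis
    using par_unique[of m k z0 p] par_unique[of m k q "p \<uplus> q"] assms k z0 vadd_closed par_refl
      by metis
qed

lemma par_diff:
  assumes "m \<in> D" "p \<in> P" "q \<in> P"
  shows "par m q p \<longleftrightarrow> par m z0 (p \<ominus>\<^bsub>V\<^esub> q)"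
proof -
  have "p \<ominus>\<^bsub>V\<^esub> q \<in> P" using V.minus_closed assms by simp
  moreover have "(p \<ominus>\<^bsub>V\<^esub> q) \<uplus> q = p" using diff_add assms by blast
  ultimately show ?thesis using par_vadd[of m "p \<ominus>\<^bsub>V\<^esub> q" q] assms by simp
qed

lemma par_subgroup:
  assumes "m \<in> D" "p \<in> P" "q \<in> P" "par m z0 p" "par m z0 q"
  shows "par m z0 (p \<uplus> q)"
  using par_vadd[of m p q] par_trans[of m z0 q "p \<uplus> q"] assms z0 vadd_closed by blast

text \<open>Translating by \<open>p\<close> and then applying \<sigma>, or applying \<sigma> and
  then translating by \<open>\<sigma> p\<close>, are dilations that agree at \<open>z0\<close> and,
  by a parallelogram, at a point \<open>w\<close> off the line \<open>z0 p\<close>; rigidity does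
  the rest.\<close>

lemma dil_additive:
  assumes d: "dil \<sigma>" "\<sigma> z0 = z0" and pq: "p \<in> P" "q \<in> P"
  shows "\<sigma> (p \<uplus> q) = \<sigma> p \<uplus> \<sigma> q"
proof -
  have sp: "\<sigma> p \<in> P" using d pq dil_closed by blast
  have d1: "dil (\<lambda>x. \<sigma> (tr p x))" "dil (\<lambda>x. tr (\<sigma> p) (\<sigma> x))"
    using dil_comp d tr(1)[OF pq(1)] tr(1)[OF sp] trl_dil by blast+
  obtain m where m: "m \<in> D" "par m z0 p" using par_exists pq z0 by blast
  obtain w where w: "w \<in> P" "\<not> par m z0 w" "w \<noteq> z0" using avoid_line z0 m by blast
  obtain l where l: "l \<in> D" "par l z0 w" using par_exists w z0 by blast
  have lm: "m \<noteq> l" using l w by auto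
  have c: "\<sigma> w \<in> P" "p \<uplus> w \<in> P" "\<sigma> (p \<uplus> w) \<in> P" "\<sigma> p \<uplus> \<sigma> w \<in> P"
    using d w pq dil_closed vadd_closed by auto
  have "par m w (p \<uplus> w)" using par_vadd m pq w by blast
  then have "par m (\<sigma> w) (\<sigma> (p \<uplus> w))" using dil_par[OF d(1)] m w c by blast
  moreover have "par l p (p \<uplus> w)" using par_vadd[of l w p] l pq w vadd_comm by simp
  then have "par l (\<sigma> p) (\<sigma> (p \<uplus> w))" using dil_par[OF d(1)] l pq c by blast
  moreover have "par m z0 (\<sigma> p)" using dil_par[OF d(1) m(1) z0 pq(1) m(2)] d by simp
  then have "par m (\<sigma> w) (\<sigma> p \<uplus> \<sigma> w)" using par_vadd m c sp by blast
  moreover have "par l z0 (\<sigma> w)" using dil_par[OF d(1) l(1) z0 w(1) l(2)] d by simp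
  then have "par l (\<sigma> p) (\<sigma> p \<uplus> \<sigma> w)" using par_vadd[of l "\<sigma> w" "\<sigma> p"] l c sp vadd_comm by simp
  ultimately have "\<sigma> (p \<uplus> w) = \<sigma> p \<uplus> \<sigma> w"
    using join_two_directions[of m l "\<sigma> w" "\<sigma> p" "\<sigma> (p \<uplus> w)" "\<sigma> p \<uplus> \<sigma> w"] m l lm c sp by blast
  moreover have "\<sigma> (tr p z0) = tr (\<sigma> p) (\<sigma> z0)" using d tr pq sp by simp
  ultimately show ?thesis
    using dil_eq[OF d1 z0 w(1) w(3)[symmetric] _ _ pq(2)] by (simp add: vadd_def)
qed

text \<open>The images of \<open>v \<uplus> x\<close> and \<open>x\<close> differ by
  \<open>\<sigma> v \<uplus> \<rho> v\<close>, and both summands stay on the line through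
  \<open>z0\<close> and \<open>v\<close>.\<close>

lemma dil_add:
  assumes d: "dil \<sigma>" "\<sigma> z0 = z0" "dil \<rho>" "\<rho> z0 = z0"
  shows "dil (\<lambda>x. \<sigma> x \<uplus> \<rho> x)"
proof -
  have "par m (\<sigma> x \<uplus> \<rho> x) (\<sigma> y \<uplus> \<rho> y)" if m: "m \<in> D" "x \<in> P" "y \<in> P" "par m x y" for m x y
  proof -
    define v where "v = y \<ominus>\<^bsub>V\<^esub> x"
    have v: "v \<in> P" "par m z0 v" using par_diff[of m y x] V.minus_closed m by (auto simp: v_def)
    have y: "y = v \<uplus> x" using diff_add m by (simp add: v_def)
    have c: "\<sigma> x \<in> P" "\<rho> x \<in> P" "\<sigma> v \<in> P" "\<rho> v \<in> P" using d m v dil_closed by auto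
    have "par m z0 (\<sigma> v)" "par m z0 (\<rho> v)"
      using dil_par[OF d(1) m(1) z0 v] dil_par[OF d(3) m(1) z0 v] d by auto
    then have "par m z0 (\<sigma> v \<uplus> \<rho> v)" using par_subgroup c m by blast
    moreover have "\<sigma> y \<uplus> \<rho> y = (\<sigma> v \<uplus> \<rho> v) \<uplus> (\<sigma> x \<uplus> \<rho> x)"
      using dil_additive[OF d(1,2)] dil_additive[OF d(3,4)] v m c
        by (simp add: y vadd_ac vadd_closed)
    ultimately show ?thesis using par_vadd m c vadd_closed by simp
  qed
  then show ?thesis using d vadd_closed by (auto simp: dilation_def)
qed

section \<open>The division ring of homotheties\<close>

definition m0 :: 'd where "m0 = (SOME m. m \<in> D \<and> par m z0 i0)"

lemma m0: "m0 \<in> D" "par m0 z0 i0"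
  using someI_ex[of "\<lambda>m. m \<in> D \<and> par m z0 i0"] par_exists[OF z0 i0(1)] by (auto simp: m0_def)

text \<open>A homothety is recorded by the image of \<open>i0\<close>, so the scalars are the points
  of the line through \<open>z0\<close> and \<open>i0\<close>.\<close>

definition U :: "'p set" where "U = {a \<in> P. par m0 z0 a}"

abbreviation sc :: "'p \<Rightarrow> 'p \<Rightarrow> 'p" (infixr "\<cdot>" 70) where "sc \<equiv> smult V"

lemma U_P: "a \<in> U \<Longrightarrow> a \<in> P"
  by (simp add: U_def)

lemma sc: assumes "a \<in> U" shows "dil (sc a)" "a \<cdot> z0 = z0" "a \<cdot> i0 = a"
proof -
  have "\<exists>\<sigma>. dil \<sigma> \<and> \<sigma> z0 = z0 \<and> \<sigma> i0 = a"
    using homothety_exists[of m0 i0 a] m0 i0 assms by (simp add: U_def)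
  from someI_ex[OF this] show "dil (sc a)" "a \<cdot> z0 = z0" "a \<cdot> i0 = a" by (auto simp: V_def)
qed

lemma dil_eq_sc:
  assumes "dil \<sigma>" "\<sigma> z0 = z0" "x \<in> P"
  shows "\<sigma> i0 \<in> U" "\<sigma> x = \<sigma> i0 \<cdot> x"
proof -
  show 1: "\<sigma> i0 \<in> U"
    using dil_par[OF assms(1) m0(1) z0 i0(1) m0(2)] dil_closed i0 assms by (simp add: U_def)
  show "\<sigma> x = \<sigma> i0 \<cdot> x"
    using dil_eq[OF assms(1) sc(1)[OF 1] z0 i0(1) _ _ _ assms(3)] i0 sc(2,3)[OF 1] assms by simp
qed

lemma sc_closed: "a \<in> U \<Longrightarrow> x \<in> P \<Longrightarrow> a \<cdot> x \<in> P"
  using sc(1) dil_closed by blast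

lemma sc_par: "\<lbrakk>a \<in> U; m \<in> D; x \<in> P; par m z0 x\<rbrakk> \<Longrightarrow> par m z0 (a \<cdot> x)"
  using dil_par[OF sc(1), of a m z0 x] z0 sc(2) by simp

lemma sc_U: "a \<in> U \<Longrightarrow> b \<in> U \<Longrightarrow> a \<cdot> b \<in> U"
  using sc_par sc_closed m0 by (simp add: U_def)

lemma sc_add_right: "\<lbrakk>a \<in> U; x \<in> P; y \<in> P\<rbrakk> \<Longrightarrow> a \<cdot> (x \<uplus> y) = a \<cdot> x \<uplus> a \<cdot> y"
  using dil_additive sc by blast

lemma sc_assoc: assumes "a \<in> U" "b \<in> U" "x \<in> P" shows "(a \<cdot> b) \<cdot> x = a \<cdot> b \<cdot> x"
  using dil_eq_sc(2)[OF dil_comp[OF sc(1)[OF assms(1)] sc(1)[OF assms(2)]], of x] assms sc by simp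

lemma U_add: "a \<in> U \<Longrightarrow> b \<in> U \<Longrightarrow> a \<uplus> b \<in> U"
  using par_subgroup m0 vadd_closed by (simp add: U_def)

lemma sc_add_left: assumes "a \<in> U" "b \<in> U" "x \<in> P" shows "(a \<uplus> b) \<cdot> x = a \<cdot> x \<uplus> b \<cdot> x"
  using dil_eq_sc(2)[OF dil_add[OF sc(1,2)[OF assms(1)] sc(1,2)[OF assms(2)]], of x] assms sc
    vadd_zero_left z0 by simp

lemma z0_U: "z0 \<in> U" and i0_U: "i0 \<in> U"
  using par_refl m0 z0 i0 by (auto simp: U_def)

lemma sc_one: "x \<in> P \<Longrightarrow> i0 \<cdot> x = x"
  using dil_eq_sc(2)[OF dil_id, of x] by simp

lemma sc_zero: "x \<in> P \<Longrightarrow> z0 \<cdot> x = z0"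
  using dil_eq_sc(2)[OF dil_const[OF z0], of x] by simp

lemma sc_exists:
  assumes "m \<in> D" "x \<in> P" "y \<in> P" "par m z0 x" "par m z0 y" "x \<noteq> z0"
  obtains a where "a \<in> U" "a \<cdot> x = y"
proof -
  obtain \<sigma> where "dil \<sigma>" "\<sigma> z0 = z0" "\<sigma> x = y" using homothety_exists assms by blast
  then show ?thesis using that dil_eq_sc[of \<sigma> x] assms by metis
qed

definition K :: "'p ring" where
  "K = \<lparr>carrier = U, monoid.mult = sc, one = i0, zero = z0, add = vadd\<rparr>"

lemma K_simps [simp]: "carrier K = U" "\<zero>\<^bsub>K\<^esub> = z0" "\<one>\<^bsub>K\<^esub> = i0" "a \<oplus>\<^bsub>K\<^esub> b = a \<uplus> b" "a \<otimes>\<^bsub>K\<^esub> b = a \<cdot> b"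
  by (simp_all add: K_def)

lemma ring_K: "ring K"
proof (rule ringI)
  show "abelian_group K"
  proof (rule abelian_groupI)
    fix a assume a: "a \<in> carrier K"
    then obtain q where q: "q \<in> P" "q \<uplus> a = z0" using vadd_inverse U_P by auto
    have "par m0 a z0" using a par_sym[OF m0(1) z0] by (simp add: U_def)
    then have "par m0 z0 q" using par_vadd[of m0 q a] q m0 U_P a by simp
    then show "\<exists>b\<in>carrier K. b \<oplus>\<^bsub>K\<^esub> a = \<zero>\<^bsub>K\<^esub>" using q by (auto simp: U_def)
  qed (auto simp: U_add z0_U vadd_zero_left U_P vadd_assoc intro: vadd_comm)
  show "Group.monoid K"
    by (rule monoidI) (auto simp: sc_U i0_U U_P sc_assoc sc_one sc(3))
qed (auto simp: sc_add_left sc_add_right U_P)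

lemma K_inverse: assumes "a \<in> U" "a \<noteq> z0" obtains b where "b \<in> U" "b \<cdot> a = i0"
  using sc_exists[of m0 a i0] assms m0 i0 by (auto simp: U_def)

text \<open>Conjugation by a collineation fixing the origin sends translations to translations,
  which gives additivity, and homotheties to homotheties. If \<phi> fixes both \<open>x\<close> and
  \<open>a \<cdot> x\<close>, the conjugated homothety agrees with that of \<open>a\<close> at two
  points and therefore everywhere. \<open>g\<close> and \<open>h\<close> are the actions on
  directions.\<close>

lemma symmetry_additive:
  assumes \<phi>: "\<And>x. x \<in> P \<Longrightarrow> \<phi> x \<in> P" "\<And>x. x \<in> P \<Longrightarrow> \<psi> x \<in> P" "\<And>x. x \<in> P \<Longrightarrow> \<phi> (\<psi> x) = x" "\<And>x. x \<in> P \<Longrightarrow> \<psi> (\<phi> x) = x"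
    and g: "\<And>m. m \<in> D \<Longrightarrow> g m \<in> D" "\<And>m. m \<in> D \<Longrightarrow> h m \<in> D" "\<And>m. m \<in> D \<Longrightarrow> g (h m) = m"
    and par: "\<And>m x y. \<lbrakk>m \<in> D; x \<in> P; y \<in> P; par m x y\<rbrakk> \<Longrightarrow> par (g m) (\<phi> x) (\<phi> y)"
      "\<And>m x y. \<lbrakk>m \<in> D; x \<in> P; y \<in> P; par m x y\<rbrakk> \<Longrightarrow> par (h m) (\<psi> x) (\<psi> y)"
    and fix_origin: "\<phi> z0 = z0"
  shows "\<lbrakk>p \<in> P; q \<in> P\<rbrakk> \<Longrightarrow> \<phi> (p \<uplus> q) = \<phi> p \<uplus> \<phi> q"
    and "\<lbrakk>a \<in> U; x \<in> P; x \<noteq> z0; \<phi> x = x; \<phi> (a \<cdot> x) = a \<cdot> x; p \<in> P\<rbrakk> \<Longrightarrow> \<phi> (a \<cdot> p) = a \<cdot> \<phi> p"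
proof -
  have conj: "dil (\<lambda>x. \<phi> (\<sigma> (\<psi> x)))" if d: "dil \<sigma>" for \<sigma>
    unfolding dilation_def
  proof (intro conjI ballI impI)
    fix m x y assume m: "m \<in> D" "x \<in> P" "y \<in> P" "par m x y"
    then have "par (h m) (\<sigma> (\<psi> x)) (\<sigma> (\<psi> y))" using par(2) dil_par[OF d] g \<phi> by simp
    then show "par m (\<phi> (\<sigma> (\<psi> x))) (\<phi> (\<sigma> (\<psi> y)))"
      using par(1)[of "h m"] m g \<phi> dil_closed[OF d] by fastforce
  qed (simp add: \<phi> dil_closed d)
  have \<psi>0: "\<psi> z0 = z0" using fix_origin \<phi>(4) z0 by metis
  show "\<phi> (p \<uplus> q) = \<phi> p \<uplus> \<phi> q" if pq: "p \<in> P" "q \<in> P"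
  proof -
    obtain m where m: "m \<in> D" "trl m (tr p)" using tr pq by blast
    have "trl (g m) (\<lambda>x. \<phi> (tr p (\<psi> x)))"
      unfolding translation_along_def
    proof (intro conjI ballI)
      show "dil (\<lambda>x. \<phi> (tr p (\<psi> x)))" using conj trl_dil m by blast
      fix x assume x: "x \<in> P"
      then have "par m (\<psi> x) (tr p (\<psi> x))" using trl_par m \<phi> by blast
      then have "par (g m) (\<phi> (\<psi> x)) (\<phi> (tr p (\<psi> x)))"
        using par(1)[OF m(1) \<phi>(2)[OF x] trl_closed[OF m(2) \<phi>(2)[OF x]]] by blast
      then show "par (g m) x (\<phi> (tr p (\<psi> x)))" using x \<phi> by simp
    qed
    from tr_eq[OF _ this, of "\<phi> q"] show ?thesis
      using m g \<phi> pq tr \<psi>0 by (simp add: vadd_def)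
  qed
  show "\<phi> (a \<cdot> p) = a \<cdot> \<phi> p"
    if a: "a \<in> U" and x: "x \<in> P" "x \<noteq> z0" "\<phi> x = x" "\<phi> (a \<cdot> x) = a \<cdot> x" and p: "p \<in> P"
  proof -
    have "\<psi> x = x" using x \<phi>(4) by metis
    then have "\<phi> (a \<cdot> \<psi> (\<phi> p)) = a \<cdot> \<phi> p"
      using dil_eq[OF conj[OF sc(1)[OF a]] sc(1)[OF a] z0 x(1), of "\<phi> p"] x p \<phi> \<psi>0 fix_origin
        sc(2)[OF a] by simp
    then show ?thesis using \<phi> p by simp
  qed
qed

end

section \<open>Forms over division rings\<close>

text \<open>Left vector spaces over a division ring. The locale \<open>module\<close> presupposes
  commutative scalars, which are a conclusion here.\<close>

locale skew_space = K: ring K + V: abelian_group V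
  for K :: "('k, 'm) ring_scheme" (structure) and V :: "('k, 'v, 'n) module_scheme" (structure) +
  assumes one_not_zero: "\<one> \<noteq> \<zero>"
    and left_inverse: "\<lbrakk>a \<in> carrier K; a \<noteq> \<zero>\<rbrakk> \<Longrightarrow> \<exists>b\<in>carrier K. b \<otimes> a = \<one>"
    and smult_closed: "\<lbrakk>a \<in> carrier K; x \<in> carrier V\<rbrakk> \<Longrightarrow> a \<odot>\<^bsub>V\<^esub> x \<in> carrier V"
    and smult_l_distr: "\<lbrakk>a \<in> carrier K; b \<in> carrier K; x \<in> carrier V\<rbrakk> \<Longrightarrow>
      (a \<oplus> b) \<odot>\<^bsub>V\<^esub> x = a \<odot>\<^bsub>V\<^esub> x \<oplus>\<^bsub>V\<^esub> b \<odot>\<^bsub>V\<^esub> x"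
    and smult_r_distr: "\<lbrakk>a \<in> carrier K; x \<in> carrier V; y \<in> carrier V\<rbrakk> \<Longrightarrow>
      a \<odot>\<^bsub>V\<^esub> (x \<oplus>\<^bsub>V\<^esub> y) = a \<odot>\<^bsub>V\<^esub> x \<oplus>\<^bsub>V\<^esub> a \<odot>\<^bsub>V\<^esub> y"
    and smult_assoc1: "\<lbrakk>a \<in> carrier K; b \<in> carrier K; x \<in> carrier V\<rbrakk> \<Longrightarrow>
      (a \<otimes> b) \<odot>\<^bsub>V\<^esub> x = a \<odot>\<^bsub>V\<^esub> (b \<odot>\<^bsub>V\<^esub> x)"
    and smult_one: "x \<in> carrier V \<Longrightarrow> \<one> \<odot>\<^bsub>V\<^esub> x = x"
begin

abbreviation vplus (infixl "\<uplus>" 65) where "x \<uplus> y \<equiv> x \<oplus>\<^bsub>V\<^esub> y"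
abbreviation scale (infixr "\<cdot>" 70) where "a \<cdot> x \<equiv> a \<odot>\<^bsub>V\<^esub> x"
abbreviation vzero ("\<zero>\<^sub>V") where "\<zero>\<^sub>V \<equiv> \<zero>\<^bsub>V\<^esub>"

lemma K_diff_eq_zero:
  assumes "a \<in> carrier K" "b \<in> carrier K"
  shows "a \<ominus> b = \<zero> \<longleftrightarrow> a = b"
proof
  assume "a \<ominus> b = \<zero>"
  then have "a \<oplus> (\<ominus> b) \<oplus> b = b" using assms by (simp add: a_minus_def)
  then show "a = b" using assms K.a_assoc[of a "\<ominus> b" b] by (simp add: K.l_neg)
qed (simp add: assms a_minus_def K.r_neg)

lemma K_cancel_left:
  assumes "a \<in> carrier K" "b \<in> carrier K" "c \<in> carrier K" "a \<noteq> \<zero>" "a \<otimes> b = a \<otimes> c"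
  shows "b = c"
proof -
  obtain d where "d \<in> carrier K" "d \<otimes> a = \<one>" using left_inverse assms by blast
  then show ?thesis using assms K.m_assoc[of d a b] K.m_assoc[of d a c] by simp
qed

lemma K_no_zero_divisors:
  assumes "a \<in> carrier K" "b \<in> carrier K" "a \<otimes> b = \<zero>"
  shows "a = \<zero> \<or> b = \<zero>"
  using K_cancel_left[of a b \<zero>] assms by auto

lemma K_cancel_right:
  assumes "a \<in> carrier K" "b \<in> carrier K" "c \<in> carrier K" "a \<noteq> \<zero>" "b \<otimes> a = c \<otimes> a"
  shows "b = c"
proof -
  have "(b \<ominus> c) \<otimes> a = \<zero>"
    using assms by (simp add: a_minus_def K.l_distr K.l_minus K.r_neg)
  then have "b \<ominus> c = \<zero>" using K_no_zero_divisors[of "b \<ominus> c" a] assms by auto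
  then show ?thesis using K_diff_eq_zero[of b c] assms by simp
qed

lemma smult_zero: "x \<in> carrier V \<Longrightarrow> \<zero> \<cdot> x = \<zero>\<^sub>V"
  using smult_l_distr[of \<zero> \<zero> x] smult_closed[of \<zero> x]
  by simp

lemma smult_eq_zero:
  assumes "a \<in> carrier K" "x \<in> carrier V" "a \<cdot> x = \<zero>\<^sub>V" "a \<noteq> \<zero>"
  shows "x = \<zero>\<^sub>V"
proof -
  obtain b where b: "b \<in> carrier K" "b \<otimes> a = \<one>" using left_inverse assms by blast
  have "x = b \<cdot> (a \<cdot> x)" using b assms smult_assoc1[of b a x] smult_one by simp
  moreover have "b \<cdot> \<zero>\<^sub>V = \<zero>\<^sub>V"
    using smult_assoc1[of b \<zero> x] smult_zero b assms by (metis K.r_null K.zero_closed)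
  ultimately show ?thesis using assms by simp
qed

end

text \<open>The two symmetry conditions cover exactly the values of the form that express
  orthogonality of directions and of points; the first argument is otherwise unconstrained apart
  from anisotropy.\<close>

locale skew_form = skew_space K V
  for K :: "('k, 'm) ring_scheme" (structure) and V :: "('k, 'v, 'n) module_scheme" (structure) +
  fixes form :: "'v \<Rightarrow> 'v \<Rightarrow> 'k"
  assumes form_closed: "\<lbrakk>x \<in> carrier V; y \<in> carrier V\<rbrakk> \<Longrightarrow> form x y \<in> carrier K"
    and form_add: "\<lbrakk>x \<in> carrier V; y \<in> carrier V; z \<in> carrier V\<rbrakk> \<Longrightarrow>
      form x (y \<uplus> z) = form x y \<oplus> form x z"
    and form_smult: "\<lbrakk>a \<in> carrier K; x \<in> carrier V; y \<in> carrier V\<rbrakk> \<Longrightarrow>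
      form x (a \<cdot> y) = a \<otimes> form x y"
    and form_zero_sym: "\<lbrakk>x \<in> carrier V; y \<in> carrier V; form x y = \<zero>\<rbrakk> \<Longrightarrow> form y x = \<zero>"
    and form_minus_one_sym: "\<lbrakk>x \<in> carrier V; y \<in> carrier V; form x y = \<ominus> \<one>\<rbrakk> \<Longrightarrow> form y x = \<ominus> \<one>"
    and form_anisotropic: "\<lbrakk>x \<in> carrier V; form x x = \<zero>\<rbrakk> \<Longrightarrow> x = \<zero>\<^sub>V"
begin

text \<open>Scale \<open>z\<close> so that \<open>form x z\<close> becomes \<open>-1\<close>. For
  the values \<open>-1\<close> and \<open>0\<close> the arguments may be swapped, which moves the
  sum into the second argument, where additivity holds.\<close>

lemma form_add_orthogonal:
  assumes "x \<in> carrier V" "y \<in> carrier V" "z \<in> carrier V" "form y z = \<zero>"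
  shows "form (x \<uplus> y) z = form x z"
proof (cases "form x z = \<zero>")
  case True
  then have "form z (x \<uplus> y) = \<zero>"
    using assms form_zero_sym[of x z] form_zero_sym[of y z] form_add[of z x y] by simp
  then show ?thesis using form_zero_sym[of z "x \<uplus> y"] assms True by simp
next
  case False
  obtain b where b: "b \<in> carrier K" "b \<otimes> form x z = \<one>"
    using left_inverse[of "form x z"] False assms form_closed by blast
  let ?l = "\<ominus> b"
  have c: "?l \<in> carrier K" "?l \<cdot> z \<in> carrier V" "x \<uplus> y \<in> carrier V" "form x z \<in> carrier K"
    "form (x \<uplus> y) z \<in> carrier K"
    using b assms smult_closed form_closed by auto
  have "form x (?l \<cdot> z) = \<ominus> \<one>"
    using form_smult[of ?l x z] c assms b by (simp add: K.l_minus)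
  then have 1: "form (?l \<cdot> z) x = \<ominus> \<one>" using form_minus_one_sym c assms by blast
  have "form y (?l \<cdot> z) = \<zero>" using form_smult[of ?l y z] c assms by simp
  then have 2: "form (?l \<cdot> z) y = \<zero>" using form_zero_sym c assms by blast
  have "form (?l \<cdot> z) (x \<uplus> y) = \<ominus> \<one>" using form_add[of "?l \<cdot> z" x y] 1 2 c assms by simp
  then have "form (x \<uplus> y) (?l \<cdot> z) = \<ominus> \<one>" using form_minus_one_sym c by blast
  then have "?l \<otimes> form (x \<uplus> y) z = ?l \<otimes> form x z"
    using form_smult[of ?l "x \<uplus> y" z] c assms b by (simp add: K.l_minus)
  moreover have "?l \<noteq> \<zero>"
  proof
    assume "?l = \<zero>"
    then have "b = \<zero>" using b by force
    then show False using b one_not_zero c by simp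
  qed
  ultimately show ?thesis using K_cancel_left[of ?l] c by blast
qed

text \<open>In the application \<open>b = J a\<close> and \<open>J b = p a\<close> for a rotation
  \<open>J\<close>, so \<open>orth\<close> says that \<open>a + t b\<close> is orthogonal to its
  image. Expanding gives \<open>form (t b) b + t p form a a = 0\<close>; the case
  \<open>t = 1\<close> evaluates \<open>p form a a\<close> as \<open>- form b b\<close>.\<close>

lemma form_multiple_self_aux:
  assumes ab: "a \<in> carrier V" "b \<in> carrier V" "form a b = \<zero>" and p: "p \<in> carrier K"
    and orth: "\<And>t. t \<in> carrier K \<Longrightarrow>
      form (a \<uplus> t \<cdot> b) (b \<uplus> (t \<otimes> p) \<cdot> a) = \<zero>"
    and t: "t \<in> carrier K"
  shows "form (t \<cdot> b) b = t \<otimes> form b b"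
proof -
  have eq: "form (s \<cdot> b) b \<oplus> s \<otimes> (p \<otimes> form a a) = \<zero>" if s: "s \<in> carrier K" for s
  proof -
    have c: "s \<cdot> b \<in> carrier V" "a \<uplus> s \<cdot> b \<in> carrier V" "s \<otimes> p \<in> carrier K"
      "(s \<otimes> p) \<cdot> a \<in> carrier V"
      using s ab p smult_closed by auto
    have "form (a \<uplus> s \<cdot> b) b = form (s \<cdot> b) b"
      using form_add_orthogonal[of "s \<cdot> b" a b] ab c V.a_comm by simp
    moreover have "form a (s \<cdot> b) = \<zero>" using form_smult s ab by simp
    then have "form (s \<cdot> b) a = \<zero>" using form_zero_sym ab c by blast
    then have "form (a \<uplus> s \<cdot> b) a = form a a"
      using form_add_orthogonal[of a "s \<cdot> b" a] ab c by simp
    ultimately show ?thesis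
      using orth[OF s] form_add[of "a \<uplus> s \<cdot> b" b "(s \<otimes> p) \<cdot> a"]
        form_smult[of "s \<otimes> p" "a \<uplus> s \<cdot> b" a] c ab s p form_closed K.m_assoc by simp
  qed
  have c: "form a a \<in> carrier K" "form b b \<in> carrier K" "t \<cdot> b \<in> carrier V"
    "form (t \<cdot> b) b \<in> carrier K" using ab t form_closed smult_closed by auto
  have "form b b \<oplus> p \<otimes> form a a = \<zero>" using eq[of \<one>] ab smult_one c p by simp
  then have "p \<otimes> form a a = \<ominus> form b b" using c p K.minus_equality[of "p \<otimes> form a a" "form b b"]
      K.a_comm[of "form b b" "p \<otimes> form a a"] by simp
  then have "form (t \<cdot> b) b \<oplus> \<ominus> (t \<otimes> form b b) = \<zero>"
    using eq[OF t] t c by (simp add: K.r_minus)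
  then show ?thesis using c t K_diff_eq_zero[of "form (t \<cdot> b) b" "t \<otimes> form b b"]
    by (simp add: a_minus_def)
qed

end

locale self_linear_form = skew_form +
  assumes form_multiple_self: "\<lbrakk>x \<in> carrier V; t \<in> carrier K\<rbrakk> \<Longrightarrow> form (t \<cdot> x) x = t \<otimes> form x x"
    and nontrivial: "\<exists>x\<in>carrier V. x \<noteq> \<zero>\<^sub>V"
begin

text \<open>Evaluating \<open>form (t s x) (s x)\<close> in two ways gives \<open>s t s = t s s\<close>.\<close>

lemma K_commutative: assumes s: "s \<in> carrier K" and t: "t \<in> carrier K" shows "s \<otimes> t = t \<otimes> s"
proof (cases "s = \<zero>")
  case True then show ?thesis using t by simp
next
  case False
  obtain x where x: "x \<in> carrier V" "x \<noteq> \<zero>\<^sub>V" using nontrivial by blast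
  let ?n = "form x x"
  have n: "?n \<in> carrier K" "?n \<noteq> \<zero>" using form_closed form_anisotropic x by auto
  have c: "s \<cdot> x \<in> carrier V" "t \<cdot> (s \<cdot> x) \<in> carrier V" using s t x smult_closed by auto
  have "form (t \<cdot> (s \<cdot> x)) (s \<cdot> x) = s \<otimes> form ((t \<otimes> s) \<cdot> x) x"
    using form_smult[OF s c(2) x(1)] smult_assoc1[OF t s x(1)] by simp
  also have "\<dots> = s \<otimes> ((t \<otimes> s) \<otimes> ?n)" using form_multiple_self[of x "t \<otimes> s"] s t x by simp
  finally have 1: "form (t \<cdot> (s \<cdot> x)) (s \<cdot> x) = (s \<otimes> t) \<otimes> (s \<otimes> ?n)"
    using s t n K.m_assoc by simp
  have "form (t \<cdot> (s \<cdot> x)) (s \<cdot> x) = t \<otimes> form (s \<cdot> x) (s \<cdot> x)"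
    using form_multiple_self[of "s \<cdot> x" t] c t by simp
  also have "\<dots> = t \<otimes> (s \<otimes> (s \<otimes> ?n))"
    using form_smult[OF s c(1) x(1)] form_multiple_self[OF x(1) s] by simp
  finally have 2: "form (t \<cdot> (s \<cdot> x)) (s \<cdot> x) = (t \<otimes> s) \<otimes> (s \<otimes> ?n)"
    using s t n K.m_assoc by simp
  have "s \<otimes> ?n \<noteq> \<zero>" using K_no_zero_divisors[of s ?n] s n False by blast
  then show ?thesis using K_cancel_right[of "s \<otimes> ?n" "s \<otimes> t" "t \<otimes> s"] 1 2 s t n by simp
qed

text \<open>Split \<open>x\<close> into \<open>s \<cdot> y\<close> and a part orthogonal to
  \<open>y\<close>; the orthogonal part contributes zero in either order, and on multiples of
  \<open>y\<close> the form is linear in the first argument too.\<close>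

lemma form_symmetric: assumes x: "x \<in> carrier V" and y: "y \<in> carrier V" shows "form x y = form y x"
proof (cases "y = \<zero>\<^sub>V")
  case True
  have "form x \<zero>\<^sub>V = \<zero>" using form_smult[of \<zero> x x] smult_zero[OF x] x form_closed by simp
  then show ?thesis using form_zero_sym[of x "\<zero>\<^sub>V"] x True by simp
next
  case False
  have n: "form y y \<in> carrier K" "form y y \<noteq> \<zero>" using form_closed form_anisotropic y False by auto
  obtain b where b: "b \<in> carrier K" "b \<otimes> form y y = \<one>" using left_inverse n by blast
  define s where "s = form y x \<otimes> b"
  have s: "s \<in> carrier K" using b form_closed x y by (simp add: s_def)
  have sn: "s \<otimes> form y y = form y x" using b n form_closed[OF y x] K.m_assoc by (simp add: s_def)
  define z where "z = x \<ominus>\<^bsub>V\<^esub> s \<cdot> y"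
  have sy: "s \<cdot> y \<in> carrier V" using s y smult_closed by blast
  have z: "z \<in> carrier V" using sy x by (simp add: z_def)
  have xz: "x = s \<cdot> y \<uplus> z"
    using sy x V.a_lcomm[of "s \<cdot> y" x] by (simp add: z_def a_minus_def V.r_neg)
  have "form y x = form y x \<oplus> form y z"
    using form_add[OF y sy z] form_smult[OF s y y] sn xz by simp
  then have "form y z = \<zero>" using form_closed y x z by simp
  then have "form z y = \<zero>" using form_zero_sym y z by blast
  then have "form x y = form (s \<cdot> y) y" using form_add_orthogonal[OF sy z y] xz by simp
  then show ?thesis using form_multiple_self[OF y s] sn by simp
qed

lemma field_K: "field K"
proof -
  interpret cring K
    by (rule cringI[OF K.abelian_group_axioms])
      (auto intro!: comm_monoidI simp: K.m_assoc K.l_distr intro: K_commutative)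
  show ?thesis
  proof (rule cring_fieldI, rule equalityI)
    show "Units K \<subseteq> carrier K - {\<zero>}" using one_not_zero by (auto simp: Units_def)
    show "carrier K - {\<zero>} \<subseteq> Units K"
    proof
      fix a assume a: "a \<in> carrier K - {\<zero>}"
      then obtain b where "b \<in> carrier K" "b \<otimes> a = \<one>" using left_inverse by blast
      then show "a \<in> Units K" using a m_comm[of a b] by (auto simp: Units_def)
    qed
  qed
qed

lemma module_V: "module K V"
proof -
  interpret field K by (rule field_K)
  show ?thesis
    by (rule moduleI[OF is_cring V.abelian_group_axioms])
      (auto simp: smult_closed smult_l_distr smult_r_distr smult_assoc1 smult_one)
qed

end

section \<open>The affine space of points not orthogonal to a given one\<close>

context pointed_orthoset
begin

lemma parallel_line_eq:
  assumes "x \<in> A" "y \<in> A" "m \<in> M" "x \<in> cl {y, m}"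
  shows "cl {x, m} = cl {y, m}"
  by (rule line_eq) (use assms A_X M_X A_M in \<open>auto simp: cl_incl\<close>)

lemma M_nonempty: obtains m where "m \<in> M"
  using rank_ge_4[OF base base base] by (auto simp: M_def)

text \<open>Central collineations with centre in \<open>M\<close> serve as translations, those with
  centre \<open>e\<close> as homotheties. The point required by \<open>avoid\<close> is any affine
  point outside the plane of \<open>x\<close>, \<open>m\<close>, \<open>k\<close>.\<close>

lemma translation_space_A:
  assumes i: "i \<in> A" "i \<noteq> e"
  shows "translation_space A M (\<lambda>m x y. x \<in> cl {y, m}) e i"
proof
  fix m x assume "m \<in> M" "x \<in> A"
  then show "x \<in> cl {x, m}" using A_X by (simp add: cl_incl)
next
  fix m x y assume "m \<in> M" "x \<in> A" "y \<in> A" "x \<in> cl {y, m}"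
  then show "y \<in> cl {x, m}" using parallel_line_eq[of x y m] A_X by (simp add: cl_incl)
next
  fix m x y z assume "m \<in> M" "x \<in> A" "y \<in> A" "z \<in> A" "x \<in> cl {y, m}" "y \<in> cl {z, m}"
  then show "x \<in> cl {z, m}" using parallel_line_eq[of y z m] by simp
next
  fix x y assume xy: "x \<in> A" "y \<in> A"
  show "\<exists>m\<in>M. x \<in> cl {y, m}"
  proof (cases "x = y")
    case True
    then show ?thesis using M_nonempty A_X xy by (metis cl_incl insertI1)
  next
    case False
    then obtain m where m: "m \<in> M" "m \<in> cl {y, x}" using direction_exists[of y x] xy A_X by metis
    then have "x \<in> cl {y, m}" using cl_pair_exchange[of y x m] xy A_X A_M by blast
    then show ?thesis using m by blast
  qed
next
  fix m k x y assume *: "m \<in> M" "k \<in> M" "x \<in> A" "y \<in> A" "x \<in> cl {y, m}" "x \<in> cl {y, k}" "m \<noteq> k"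
  show "x = y"
  proof (rule ccontr)
    assume "x \<noteq> y"
    then have "m \<in> cl {y, x}" "k \<in> cl {y, x}" using * A_X M_X cl_pair_exchange[of y _ x] by auto
    then show False using direction_unique[of y x m k x] * A_X by (simp add: cl_incl)
  qed
next
  fix x m k assume *: "x \<in> A" "m \<in> M" "k \<in> M"
  then obtain z where z: "z \<in> A" "z \<notin> cl {x, m, k}" using point_outside_plane A_X M_X by metis
  have "y \<notin> cl {z, l}" if y: "y \<in> A" "x \<in> cl {y, m} \<or> x \<in> cl {y, k}" and l: "l = m \<or> l = k" for y l
  proof
    assume "y \<in> cl {z, l}"
    then have "z \<in> cl {y, l}" using parallel_line_eq[of y z l] y z l * A_X by (auto simp: cl_incl)
    moreover have "y \<in> cl {x, m} \<or> y \<in> cl {x, k}"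
      using parallel_line_eq[of x y m] parallel_line_eq[of x y k] y * A_X by (auto simp: cl_incl)
    then have "y \<in> cl {x, m, k}"
      using cl_mono_in[of y "{x, m}" "{x,m,k}"] cl_mono_in[of y "{x, k}" "{x,m,k}"] by blast
    then have "{y, l} \<subseteq> cl {x, m, k}" using l * M_X by (auto simp: cl_incl)
    ultimately show False using cl_trans z by blast
  qed
  then show "\<exists>z\<in>A. \<forall>y\<in>A. x \<in> cl {y, m} \<or> x \<in> cl {y, k} \<longrightarrow> y \<notin> cl {z, m} \<and> y \<notin> cl {z, k}"
    using z by blast
next
  fix x y assume xy: "x \<in> A" "y \<in> A"
  obtain m where m: "m \<in> M" "y \<in> cl {m, x}"
  proof (cases "x = y")
    case True
    obtain m where "m \<in> M" by (rule M_nonempty)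
    then show ?thesis using that[of m] True xy A_X by (simp add: cl_incl)
  next
    case False
    then obtain m where m: "m \<in> M" "m \<in> cl {x, y}" using direction_exists[of x y] xy A_X by metis
    then have "y \<in> cl {m, x}" using in_line_swap[of x y m] xy A_X A_M by blast
    then show ?thesis using that m by blast
  qed
  then have "arrow m x y" using xy A_M by (auto simp: arrow_def)
  then obtain \<phi> where \<phi>: "\<And>x. x \<in> A \<Longrightarrow> \<phi> x \<in> A" "\<phi> x = y" "\<And>x. x \<in> A \<Longrightarrow> \<phi> x \<in> cl {m, x}"
      "\<And>m x y. \<lbrakk>m \<in> M; x \<in> A; y \<in> A; x \<in> cl {y, m}\<rbrakk> \<Longrightarrow> \<phi> x \<in> cl {\<phi> y, m}"
    using central_collineation[OF M_X[OF m(1)]] by metis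
  have "z \<in> cl {\<phi> z, m}" if "z \<in> A" for z
    using parallel_line_eq[of "\<phi> z" z m] \<phi>(1,3)[OF that] that m A_X
      by (simp add: cl_incl insert_commute)
  then show "\<exists>m\<in>M. \<exists>\<tau>. translation_along A M (\<lambda>m x y. x \<in> cl {y, m}) m \<tau> \<and> \<tau> x = y"
    using \<phi> m by (auto simp: translation_along_def dilation_def intro!: bexI[of _ m] exI[of _ \<phi>])
next
  fix m x y assume *: "m \<in> M" "x \<in> A" "y \<in> A" "e \<in> cl {x, m}" "e \<in> cl {y, m}" "x \<noteq> e"
  let ?dil = "dilation A M (\<lambda>m x y. x \<in> cl {y, m})"
  show "\<exists>\<sigma>. ?dil \<sigma> \<and> \<sigma> e = e \<and> \<sigma> x = y"
  proof (cases "y = e")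
    case True
    have "?dil (\<lambda>_. e)" using base_A base by (auto simp: dilation_def cl_incl)
    then show ?thesis using True by blast
  next
    case False
    have "cl {e, m} = cl {x, m}" "cl {e, m} = cl {y, m}"
      using parallel_line_eq[of e x m] parallel_line_eq[of e y m] * base_A by auto
    then have "x \<in> cl {e, m}" "y \<in> cl {e, m}" using cl_incl[of _ "{_, m}"] * A_X by blast+
    then have "y \<in> cl {e, x}" using line_eq[of e m e x] base * M_X by (auto simp: cl_incl)
    then have "arrow e x y" using * False by (simp add: arrow_def)
    then obtain \<phi> where "\<And>x. x \<in> A \<Longrightarrow> \<phi> x \<in> A" "\<phi> x = y" "\<phi> e = e"
      "\<And>m x y. \<lbrakk>m \<in> M; x \<in> A; y \<in> A; x \<in> cl {y, m}\<rbrakk> \<Longrightarrow> \<phi> x \<in> cl {\<phi> y, m}"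
      using central_collineation[OF base] by metis
    then show ?thesis by (auto simp: dilation_def intro!: exI[of _ \<phi>])
  qed
qed (use base_A i in auto)

end

section \<open>The form on the affine space\<close>

locale unit_orthoset = pointed_orthoset +
  fixes i :: 'a
  assumes unit: "i \<in> A" "i \<noteq> e"

sublocale unit_orthoset \<subseteq> translation_space A M "\<lambda>m x y. x \<in> cl {y, m}" e i
  by (rule translation_space_A[OF unit])

context unit_orthoset
begin

notation vadd (infixl "\<uplus>" 65)

abbreviation smult_V :: "'a \<Rightarrow> 'a \<Rightarrow> 'a" (infixr "\<cdot>" 70) where "smult_V \<equiv> smult V"

sublocale S: skew_space K V
proof -
  interpret K: ring K by (rule ring_K)
  show "skew_space K V"
    by unfold_locales
      (auto simp: i0 sc_closed sc_add_left sc_add_right sc_assoc sc_one intro: K_inverse)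
qed

section \<open>Directions of vectors\<close>

text \<open>For the zero vector \<open>x = e\<close> no such point exists and the value is
  arbitrary.\<close>

definition dr :: "'a \<Rightarrow> 'a" where "dr x = (SOME m. m \<in> M \<and> m \<in> cl {e, x})"

lemma dr: assumes "x \<in> A" "x \<noteq> e" shows "dr x \<in> M" "dr x \<in> cl {e, x}"
proof -
  have "\<exists>m. m \<in> M \<and> m \<in> cl {e, x}" using direction_exists[of e x] assms base A_X by metis
  from someI_ex[OF this] show "dr x \<in> M" "dr x \<in> cl {e, x}" by (auto simp: dr_def)
qed

lemma dr_X: "\<lbrakk>x \<in> A; x \<noteq> e\<rbrakk> \<Longrightarrow> dr x \<in> X"
  using dr M_X by blast

lemma in_dr_line: assumes "x \<in> A" "x \<noteq> e" shows "x \<in> cl {e, dr x}"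
  using cl_pair_exchange[of e x "dr x"] dr[OF assms] assms A_X base_A A_M by metis

lemma dr_unique: assumes "x \<in> A" "x \<noteq> e" "m \<in> M" "m \<in> cl {e, x}" shows "dr x = m"
  using direction_unique[of e x "dr x" m e] dr[OF assms(1,2)] assms A_X base_A
    by (simp add: cl_incl)

lemma par_dr: assumes "x \<in> A" "x \<noteq> e" "m \<in> M" shows "e \<in> cl {x, m} \<longleftrightarrow> dr x = m"
proof
  assume "e \<in> cl {x, m}"
  then have "m \<in> cl {e, x}" using in_line_swap[of x m e] assms A_X M_X by auto
  then show "dr x = m" using dr_unique assms by blast
next
  assume "dr x = m"
  then show "e \<in> cl {x, m}" using dr[OF assms(1,2)] base A_M assms A_X
    cl_pair_exchange[of x e m] by (metis insert_commute)
qed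

lemma direction_vector: assumes "m \<in> M" obtains x where "x \<in> A" "x \<noteq> e" "dr x = m"
proof -
  have em: "e \<noteq> m" "m \<in> X" using assms base_A A_M M_X by auto
  obtain x where x: "x \<in> cl {e, m}" "x \<noteq> e" "x \<noteq> m" using third_point[of e m] base em by blast
  have xA: "x \<in> A"
  proof (rule A_I)
    show "x \<in> X" using x cl_closed by blast
    show "x \<notin> M" using direction_unique[of e m x m e] x assms em base base_A by (auto simp: cl_incl)
  qed
  have "m \<in> cl {e, x}" using cl_pair_exchange[of e m x] x em base by blast
  then show ?thesis using that x xA dr_unique assms by blast
qed

lemma dr_eq_multiple:
  assumes "x \<in> A" "x \<noteq> e" "y \<in> A" "y \<noteq> e" "dr y = dr x"
  obtains a where "a \<in> U" "a \<noteq> e" "y = a \<cdot> x"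
proof -
  obtain a where "a \<in> U" "a \<cdot> x = y"
    using sc_exists[of "dr x" x y] assms dr par_dr by metis
  then show ?thesis using that assms sc_zero by metis
qed

lemma sc_nonzero: "\<lbrakk>a \<in> U; a \<noteq> e; x \<in> A; x \<noteq> e\<rbrakk> \<Longrightarrow> a \<cdot> x \<noteq> e"
  using S.smult_eq_zero[of a x] by auto

lemma dr_smult: assumes "a \<in> U" "a \<noteq> e" "x \<in> A" "x \<noteq> e" shows "dr (a \<cdot> x) = dr x"
  using sc_par[of a "dr x" x] assms dr par_dr sc_closed sc_nonzero by metis

text \<open>The sum lies in the plane of \<open>e\<close>, \<open>m\<close>, \<open>k\<close>. If
  its direction were off the line \<open>m k\<close>, exchange would put \<open>e\<close> into a
  span of points at infinity.\<close>

lemma sum_direction: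
  assumes u: "u \<in> A" "m \<in> M" "e \<in> cl {u, m}" and v: "v \<in> A" "k \<in> M" "e \<in> cl {v, k}" and ne: "u \<uplus> v \<noteq> e"
  shows "dr (u \<uplus> v) \<in> cl {m, k}"
proof (rule ccontr)
  let ?x = "u \<uplus> v"
  assume n: "dr ?x \<notin> cl {m, k}"
  have xA: "?x \<in> A" using u v vadd_closed by blast
  have X: "u \<in> X" "v \<in> X" "m \<in> X" "k \<in> X" "?x \<in> X" using u v xA A_X M_X by auto
  have "u \<in> cl {?x, k}" using par_vadd[of k v u] u v vadd_comm by simp
  then have "?x \<in> cl {u, k}" using parallel_line_eq[of u ?x k] u v xA X by (simp add: cl_incl)
  moreover have "u \<in> cl {e, m}" using parallel_line_eq[of e u m] u base_A X by (simp add: cl_incl)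
  then have "{u, k} \<subseteq> cl {e, m, k}"
    using cl_mono_in[of u "{e,m}" "{e,m,k}"] X by (auto simp: cl_incl)
  ultimately have "?x \<in> cl {e, m, k}" using cl_trans by blast
  then have "{e, ?x} \<subseteq> cl {e, m, k}" using base by (simp add: cl_incl)
  then have "dr ?x \<in> cl {e, m, k}" using dr(2)[OF xA ne] cl_trans by blast
  then have "e \<in> cl {dr ?x, m, k}" using exchange[of e "dr ?x" "{m,k}"] n base by blast
  then show False using cl_M[of "{dr ?x, m, k}" e] dr(1)[OF xA ne] u v base_A A_M by blast
qed

text \<open>Project \<open>x\<close> from the direction of \<open>v\<close> to the line through
  \<open>e\<close> and \<open>u\<close>: the result \<open>q\<close> is a multiple of
  \<open>u\<close>, and the difference of \<open>x\<close> and \<open>q\<close> is a multiple of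
  \<open>v\<close>.\<close>

lemma direction_sum:
  assumes u: "u \<in> A" "u \<noteq> e" and v: "v \<in> A" "v \<noteq> e" and uv: "dr u \<noteq> dr v"
    and x: "x \<in> A" "x \<noteq> e" "dr x \<in> cl {dr u, dr v}"
  obtains a b where "a \<in> U" "b \<in> U" "x = a \<cdot> u \<uplus> b \<cdot> v"
proof -
  let ?m = "dr u" and ?k = "dr v"
  have M: "?m \<in> M" "?k \<in> M" using dr u v by auto
  have X: "?m \<in> X" "?k \<in> X" "x \<in> X" using M M_X x A_X by auto
  have kn: "?k \<notin> cl {e, ?m}"
  proof
    assume "?k \<in> cl {e, ?m}"
    then have "?k = ?m"
      using direction_unique[of e ?m ?k ?m e] X M base base_A by (simp add: cl_incl)
    then show False using uv by simp
  qed
  have "cl {?m, ?k} \<subseteq> cl {?k, e, ?m}" by (rule cl_mono) auto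
  then have "{e, dr x} \<subseteq> cl {?k, e, ?m}" using x base by (auto simp: cl_incl)
  then have xp: "x \<in> cl {?k, e, ?m}" using in_dr_line[OF x(1,2)] cl_trans by blast
  moreover have kx: "?k \<noteq> x" using M x A_M by blast
  ultimately obtain q where q: "q \<in> cl {?k, x}" "q \<in> cl {e, ?m}"
    using meet[of ?k "{e, ?m}" x] X kn by blast
  have qX: "q \<in> X" using q cl_closed by blast
  have qA: "q \<in> A"
  proof (rule A_I[OF qX])
    show "q \<notin> M"
    proof
      assume "q \<in> M"
      then have "q = ?m"
        using direction_unique[of e ?m q ?m e] q X M base base_A by (simp add: cl_incl)
      moreover have "q = ?k"
        using direction_unique[of ?k x q ?k x] q X M \<open>q \<in> M\<close> x by (simp add: cl_incl)
      ultimately show False using uv by simp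
    qed
  qed
  have pq: "q \<in> cl {x, ?k}" using q by (simp add: insert_commute)
  have "e \<in> cl {q, ?m}" using parallel_line_eq[of q e ?m] q qA M base_A base by (simp add: cl_incl)
  then obtain a where a: "a \<in> U" "a \<cdot> u = q"
    using sc_exists[of ?m u q] M u qA par_dr by metis
  define r where "r = x \<ominus>\<^bsub>V\<^esub> q"
  have rA: "r \<in> A" using V.minus_closed x qA by (simp add: r_def)
  have "e \<in> cl {r, ?k}" using par_diff[of ?k x q] pq M x qA by (simp add: r_def)
  then obtain b where b: "b \<in> U" "b \<cdot> v = r"
    using sc_exists[of ?k v r] M v rA par_dr by metis
  have "x = q \<uplus> r" using diff_add[of x q] x qA rA vadd_comm by (simp add: r_def)
  then show ?thesis using that a b by blast
qed

section \<open>Polars as affine hyperplanes, and the functional of a point\<close>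

text \<open>The foot of the polar of \<open>a\<close> on the line \<open>e a\<close>. The functional
  of \<open>a\<close> is normalised to \<open>-1\<close> at this point.\<close>

definition wp :: "'a \<Rightarrow> 'a" where "wp a = (SOME w. w \<in> cl {e, a} \<and> perp w a)"

lemma wp: assumes a: "a \<in> A" "a \<noteq> e"
  shows "wp a \<in> cl {e, a}" "perp (wp a) a" "wp a \<in> A" "wp a \<noteq> e" "dr (wp a) = dr a"
proof -
  have aX: "a \<in> X" using a A_X by blast
  have "\<exists>w. w \<in> cl {e, a} \<and> perp w a" using line_meets_polar[of e a a] a base aX by metis
  from someI_ex[OF this] show w: "wp a \<in> cl {e, a}" "perp (wp a) a" by (auto simp: wp_def)
  have wX: "wp a \<in> X" using w cl_closed by blast
  show wA: "wp a \<in> A"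
  proof (rule A_I[OF wX])
    show "wp a \<notin> M"
    proof
      assume "wp a \<in> M"
      then have "perp (wp a) (wp a)" using perp_cl[of "wp a" "{e,a}" "wp a"] w by (auto simp: M_def)
      then show False using perp_irrefl wX by blast
    qed
  qed
  show we: "wp a \<noteq> e"
  proof
    assume "wp a = e"
    then have "perp a e" using w aX base perp_comm by simp
    then show False using a aX A_M by (auto simp: M_def)
  qed
  have "{e, wp a} \<subseteq> cl {e, a}" using w base by (simp add: cl_incl)
  then have "dr (wp a) \<in> cl {e, a}" using dr(2)[OF wA we] cl_trans by blast
  then show "dr (wp a) = dr a" using dr_unique[OF a dr(1)[OF wA we]] by simp
qed

text \<open>The hyperplane through the origin parallel to the polar of \<open>a\<close>, which
  becomes the kernel of \<open>form a\<close>. The zero vector is listed separately because it has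
  no direction.\<close>

definition Vp :: "'a \<Rightarrow> 'a set" where "Vp a = {v \<in> A. v = e \<or> perp (dr v) a}"

lemma Vp_A: "v \<in> Vp a \<Longrightarrow> v \<in> A"
  by (simp add: Vp_def)

lemma Vp_zero: "e \<in> Vp a"
  using base_A by (simp add: Vp_def)

lemma minus_U: "l \<in> U \<Longrightarrow> \<ominus>\<^bsub>K\<^esub> l \<in> U"
  using S.K.a_inv_closed by simp

lemma smult_minus: assumes "l \<in> U" "x \<in> A" shows "(\<ominus>\<^bsub>K\<^esub> l) \<cdot> x = \<ominus>\<^bsub>V\<^esub> (l \<cdot> x)"
proof -
  have "(\<ominus>\<^bsub>K\<^esub> l) \<cdot> x \<uplus> l \<cdot> x = e"
    using sc_add_left[of "\<ominus>\<^bsub>K\<^esub> l" l x] minus_U assms S.K.l_neg[of l] sc_zero by simp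
  then show ?thesis
    using V.minus_equality[of "(\<ominus>\<^bsub>K\<^esub> l) \<cdot> x" "l \<cdot> x"] assms minus_U sc_closed by simp
qed

context
  fixes a assumes a: "a \<in> A" "a \<noteq> e"
begin

lemma aX: "a \<in> X" using a A_X by blast

lemma dr_self_not_perp: "\<not> perp (dr a) a"
proof
  assume "perp (dr a) a"
  moreover have "perp (dr a) e" using dr[OF a] by (simp add: M_def)
  ultimately have "perp (dr a) (dr a)"
    using perp_cl[of "dr a" "{e,a}" "dr a"] dr[OF a] dr_X[OF a] by blast
  then show False using perp_irrefl dr_X[OF a] by blast
qed

text \<open>Together with \<open>perp_diff_Vp\<close> this makes the affine part of the polar of
  \<open>a\<close> a coset of \<open>Vp a\<close>. The reason is that \<open>b \<uplus> v\<close>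
  lies on the line through \<open>b\<close> and \<open>dr v\<close>, both orthogonal to
  \<open>a\<close>.\<close>

lemma perp_add_Vp: assumes "b \<in> A" "perp b a" "v \<in> Vp a" shows "perp (b \<uplus> v) a"
proof (cases "v = e")
  case True then show ?thesis using assms vadd_zero_right by simp
next
  case False
  have v: "v \<in> A" "perp (dr v) a" using assms False by (auto simp: Vp_def)
  have sA: "b \<uplus> v \<in> A" using assms v vadd_closed by blast
  have "b \<in> cl {b \<uplus> v, dr v}"
    using par_vadd[of "dr v" v b] v assms False dr par_dr[of v "dr v"] vadd_comm by simp
  then have "b \<uplus> v \<in> cl {b, dr v}"
    using parallel_line_eq[of b "b \<uplus> v" "dr v"] assms sA A_X dr(1)[OF v(1) False]
      by (simp add: cl_incl)
  then show ?thesis using cl_perp[of a "{b, dr v}"] aX assms v by blast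
qed

lemma perp_diff_Vp: assumes "b \<in> A" "perp b a" "c \<in> A" "perp c a" shows "c \<ominus>\<^bsub>V\<^esub> b \<in> Vp a"
proof (cases "c \<ominus>\<^bsub>V\<^esub> b = e")
  case True then show ?thesis using base_A by (simp add: Vp_def)
next
  case False
  let ?v = "c \<ominus>\<^bsub>V\<^esub> b"
  have v: "?v \<in> A" using V.minus_closed assms by simp
  have "e \<in> cl {?v, dr ?v}" using par_dr v False dr by blast
  then have "b \<in> cl {c, dr ?v}" using par_diff[of "dr ?v" c b] dr v False assms by blast
  moreover have "b \<noteq> c"
  proof
    assume "b = c"
    then show False using False assms V.r_neg[of b] by (simp add: a_minus_def)
  qed
  ultimately have "dr ?v \<in> cl {c, b}"
    using cl_pair_exchange[of c "dr ?v" b] assms A_X dr_X[OF v False] by blast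
  then have "perp (dr ?v) a" using cl_perp[of a "{c,b}"] aX assms by blast
  then show ?thesis using v by (simp add: Vp_def)
qed

lemma Vp_smult: assumes "c \<in> U" "v \<in> Vp a" shows "c \<cdot> v \<in> Vp a"
proof (cases "v = e \<or> c = e")
  case True then show ?thesis using sc(2) sc_zero Vp_zero Vp_A assms by auto
next
  case False
  then show ?thesis using assms dr_smult[of c v] sc_closed by (auto simp: Vp_def)
qed

text \<open>Starting from \<open>wp a\<close>, translate twice within the polar and subtract
  \<open>wp a\<close> again.\<close>

lemma Vp_add: assumes "u \<in> Vp a" "v \<in> Vp a" shows "u \<uplus> v \<in> Vp a"
proof -
  let ?w = "wp a"
  have A: "u \<in> A" "v \<in> A" "?w \<in> A" using assms Vp_A wp[OF a] by auto
  have "perp (?w \<uplus> u) a" using perp_add_Vp wp[OF a] assms by blast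
  then have "perp (?w \<uplus> u \<uplus> v) a" using perp_add_Vp assms A vadd_closed by blast
  then have "(?w \<uplus> u \<uplus> v) \<ominus>\<^bsub>V\<^esub> ?w \<in> Vp a" using perp_diff_Vp[of ?w] wp[OF a] A vadd_closed by blast
  moreover have "(?w \<uplus> u \<uplus> v) \<ominus>\<^bsub>V\<^esub> ?w = u \<uplus> v"
    using A vadd_closed V.a_inv_closed[of ?w] V.r_neg[of ?w] vadd_comm[of ?w "u \<uplus> v"]
    by (simp add: a_minus_def vadd_assoc vadd_zero_right)
  ultimately show ?thesis by simp
qed

lemma multiple_wp_Vp: assumes "l \<in> U" "l \<cdot> wp a \<in> Vp a" shows "l = e"
proof (rule ccontr)
  assume l: "l \<noteq> e"
  have "dr (l \<cdot> wp a) = dr a" using dr_smult[OF assms(1) l] wp[OF a] by simp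
  moreover have "l \<cdot> wp a \<noteq> e" using sc_nonzero[OF assms(1) l] wp[OF a] by simp
  ultimately have "perp (dr a) a" using assms by (simp add: Vp_def)
  then show False using dr_self_not_perp by blast
qed

lemma coeff_exists: assumes b: "b \<in> A" shows "\<exists>l\<in>U. b \<uplus> l \<cdot> wp a \<in> Vp a"
proof -
  let ?m = "dr a" and ?w = "wp a"
  have m: "?m \<in> M" "?m \<in> X" using dr[OF a] M_X by auto
  have bm: "b \<noteq> ?m" using m b A_M by blast
  obtain q where q: "q \<in> cl {b, ?m}" "perp q a"
    using line_meets_polar[of b ?m a] b A_X m aX bm by blast
  have qX: "q \<in> X" using q cl_closed by blast
  have qA: "q \<in> A"
  proof (rule A_I[OF qX])
    show "q \<notin> M"
    proof
      assume "q \<in> M"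
      then have "q = ?m" using direction_unique[of b ?m q ?m b] q m b A_X by (simp add: cl_incl)
      then show False using dr_self_not_perp q by simp
    qed
  qed
  define r where "r = b \<ominus>\<^bsub>V\<^esub> q"
  have rA: "r \<in> A" using V.minus_closed b qA by (simp add: r_def)
  have "e \<in> cl {r, ?m}" using par_diff[of ?m b q] q m b qA by (simp add: r_def)
  moreover have "e \<in> cl {?w, ?m}" using par_dr wp[OF a] m by simp
  ultimately obtain l where l: "l \<in> U" "l \<cdot> ?w = r"
    using sc_exists[of ?m ?w r] m wp[OF a] rA by blast
  have br: "b = q \<uplus> r" using diff_add[of b q] b qA rA vadd_comm by (simp add: r_def)
  \<comment> \<open>\<open>q\<close> lies on the polar itself, not on its parallel through
    \<open>e\<close>; the extra \<open>i\<close> accounts for subtracting \<open>wp a\<close> once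
    more.\<close>
  let ?l = "\<ominus>\<^bsub>K\<^esub> (l \<uplus> i)"
  have lU: "l \<uplus> i \<in> U" using l i0_U U_add by blast
  have W: "?w \<in> A" "\<ominus>\<^bsub>V\<^esub> ?w \<in> A" "\<ominus>\<^bsub>V\<^esub> r \<in> A" using wp[OF a] rA V.a_inv_closed by auto
  have "?l \<cdot> ?w = \<ominus>\<^bsub>V\<^esub> (r \<uplus> ?w)"
    using smult_minus[OF lU W(1)] sc_add_left[OF l(1) i0_U W(1)] sc_one[OF W(1)] l by simp
  also have "\<dots> = \<ominus>\<^bsub>V\<^esub> r \<uplus> \<ominus>\<^bsub>V\<^esub> ?w" using V.minus_add[of r ?w] rA W by simp
  finally have "b \<uplus> ?l \<cdot> ?w = q \<uplus> (r \<uplus> \<ominus>\<^bsub>V\<^esub> r) \<uplus> \<ominus>\<^bsub>V\<^esub> ?w"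
    using br qA rA W vadd_closed by (simp add: vadd_assoc)
  also have "\<dots> = q \<ominus>\<^bsub>V\<^esub> ?w" using V.r_neg[of r] rA qA vadd_zero_right by (simp add: a_minus_def)
  finally have "b \<uplus> ?l \<cdot> ?w \<in> Vp a" using perp_diff_Vp[of ?w q] wp[OF a] q qA by simp
  then show ?thesis using minus_U lU by blast
qed

end

text \<open>Since the functional of \<open>a\<close> is to be \<open>-1\<close> at
  \<open>wp a\<close>, its value at \<open>b\<close> is the multiple of \<open>wp a\<close> that
  moves \<open>b\<close> into the kernel.\<close>

definition form :: "'a \<Rightarrow> 'a \<Rightarrow> 'a" where
  "form a b = (if a = e then e else SOME l. l \<in> U \<and> b \<uplus> l \<cdot> wp a \<in> Vp a)"

lemma form_zero_left: "form e b = e"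
  by (simp add: form_def)

lemma form_closed: assumes "a \<in> A" "b \<in> A" shows "form a b \<in> U"
  using someI_ex[OF coeff_exists[of a b, unfolded Bex_def]] assms z0_U by (auto simp: form_def)

text \<open>Two solutions differ by a scalar whose multiple of \<open>wp a\<close> lies in
  \<open>Vp a\<close>, and such a scalar is zero.\<close>

lemma form_eq:
  assumes a: "a \<in> A" "a \<noteq> e" and b: "b \<in> A" and l: "l \<in> U"
  shows "form a b = l \<longleftrightarrow> b \<uplus> l \<cdot> wp a \<in> Vp a"
proof -
  let ?w = "wp a" and ?k = "form a b"
  have k: "?k \<in> U" "b \<uplus> ?k \<cdot> ?w \<in> Vp a"
    using someI_ex[OF coeff_exists[OF a b, unfolded Bex_def]] a by (auto simp: form_def)
  have W: "?w \<in> A" using wp[OF a] by blast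
  have "l = ?k" if v: "b \<uplus> l \<cdot> ?w \<in> Vp a"
  proof -
    let ?u = "b \<uplus> l \<cdot> ?w"
    have i': "\<ominus>\<^bsub>K\<^esub> i \<in> U" using minus_U i0_U by blast
    have c: "?k \<cdot> ?w \<in> A" "l \<cdot> ?w \<in> A" "\<ominus>\<^bsub>V\<^esub> b \<in> A" "\<ominus>\<^bsub>V\<^esub> (l \<cdot> ?w) \<in> A" "?u \<in> A"
      using k l W b sc_closed V.a_inv_closed vadd_closed by auto
    have "(\<ominus>\<^bsub>K\<^esub> i) \<cdot> ?u = \<ominus>\<^bsub>V\<^esub> ?u" using smult_minus[OF i0_U c(5)] sc_one[OF c(5)] by simp
    then have "\<ominus>\<^bsub>V\<^esub> ?u \<in> Vp a" using Vp_smult[OF a i' v] by simp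
    then have *: "(b \<uplus> ?k \<cdot> ?w) \<uplus> \<ominus>\<^bsub>V\<^esub> ?u \<in> Vp a" using Vp_add[OF a k(2)] by blast
    have "(b \<uplus> ?k \<cdot> ?w) \<uplus> \<ominus>\<^bsub>V\<^esub> ?u = (b \<uplus> ?k \<cdot> ?w) \<uplus> (\<ominus>\<^bsub>V\<^esub> b \<uplus> \<ominus>\<^bsub>V\<^esub> (l \<cdot> ?w))"
      using V.minus_add[of b "l \<cdot> ?w"] b c by simp
    also have "\<dots> = (b \<uplus> \<ominus>\<^bsub>V\<^esub> b) \<uplus> (?k \<cdot> ?w \<uplus> \<ominus>\<^bsub>V\<^esub> (l \<cdot> ?w))"
      using b c vadd_closed by (simp add: vadd_ac)
    also have "\<dots> = ?k \<cdot> ?w \<uplus> (\<ominus>\<^bsub>K\<^esub> l) \<cdot> ?w"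
      using V.r_neg[of b] b c vadd_closed smult_minus[OF l W] vadd_zero_left by simp
    also have "\<dots> = (?k \<uplus> \<ominus>\<^bsub>K\<^esub> l) \<cdot> ?w" using sc_add_left[OF k(1) minus_U[OF l] W] by simp
    finally have "(?k \<uplus> \<ominus>\<^bsub>K\<^esub> l) \<cdot> ?w \<in> Vp a" using * by simp
    then have "?k \<uplus> \<ominus>\<^bsub>K\<^esub> l = e"
      using multiple_wp_Vp[OF a, of "?k \<uplus> \<ominus>\<^bsub>K\<^esub> l"] U_add[OF k(1) minus_U[OF l]] by blast
    then show "l = ?k" using S.K_diff_eq_zero[of ?k l] k l by (simp add: a_minus_def)
  qed
  then show ?thesis using k by blast
qed

text \<open>As \<open>dr b\<close> is orthogonal to \<open>e\<close> anyway, being orthogonal to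
  \<open>a\<close> and to \<open>dr a\<close> amounts to the same: each of these points spans the
  line \<open>e a\<close> together with \<open>e\<close>.\<close>

lemma form_zero_iff:
  assumes "a \<in> A" "b \<in> A" "a \<noteq> e" "b \<noteq> e"
  shows "form a b = e \<longleftrightarrow> perp (dr b) (dr a)"
proof -
  have "form a b = e \<longleftrightarrow> b \<in> Vp a"
    using form_eq[of a b e] assms z0_U sc_zero wp[of a] vadd_zero_right by simp
  moreover have "b \<in> Vp a \<longleftrightarrow> perp (dr b) a" using assms by (simp add: Vp_def)
  moreover have be: "perp (dr b) e" using dr assms by (auto simp: M_def)
  have "perp (dr b) a \<longleftrightarrow> perp (dr b) (dr a)"
    using perp_cl[of "dr b" "{e,a}" "dr a"] perp_cl[of "dr b" "{e, dr a}" a] dr_X[of b] be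
      dr[of a] in_dr_line[of a] assms by blast
  ultimately show ?thesis by blast
qed

lemma form_minus_one_iff:
  assumes "a \<in> A" "b \<in> A" "a \<noteq> e"
  shows "form a b = \<ominus>\<^bsub>K\<^esub> i \<longleftrightarrow> perp b a"
proof -
  let ?w = "wp a"
  have a: "a \<in> A" "a \<noteq> e" using assms by auto
  have W: "?w \<in> A" using wp[OF a] by blast
  have "form a b = \<ominus>\<^bsub>K\<^esub> i \<longleftrightarrow> b \<uplus> (\<ominus>\<^bsub>K\<^esub> i) \<cdot> ?w \<in> Vp a"
    using form_eq[OF a assms(2) minus_U[OF i0_U]] .
  also have "b \<uplus> (\<ominus>\<^bsub>K\<^esub> i) \<cdot> ?w = b \<ominus>\<^bsub>V\<^esub> ?w"
    using smult_minus[OF i0_U W] sc_one[OF W] by (simp add: a_minus_def)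
  also have "\<dots> \<in> Vp a \<longleftrightarrow> perp b a"
  proof
    assume v: "b \<ominus>\<^bsub>V\<^esub> ?w \<in> Vp a"
    then have "perp (?w \<uplus> (b \<ominus>\<^bsub>V\<^esub> ?w)) a" using perp_add_Vp[OF a W] wp[OF a] by blast
    then show "perp b a"
      using diff_add[OF assms(2) W] vadd_comm[OF W, of "b \<ominus>\<^bsub>V\<^esub> ?w"] Vp_A[OF v] by simp
  next
    assume "perp b a"
    then show "b \<ominus>\<^bsub>V\<^esub> ?w \<in> Vp a" using perp_diff_Vp[OF a W] wp[OF a] assms by blast
  qed
  finally show ?thesis .
qed

lemma form_zero_right: assumes "a \<in> A" shows "form a e = e"
proof (cases "a = e")
  case True then show ?thesis by (simp add: form_def)
next
  case False
  then show ?thesis using form_eq[OF assms False base_A z0_U] sc_zero[of "wp a"] wp[of a] assms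
      vadd_zero_right[OF base_A] Vp_zero by simp
qed

lemma minus_i: "\<ominus>\<^bsub>K\<^esub> i \<noteq> e"
proof
  assume "\<ominus>\<^bsub>K\<^esub> i = e"
  then have "i = e" using S.K.minus_minus[of i] i0_U S.K.minus_zero by simp
  then show False using unit by simp
qed

sublocale S: skew_form K V form
proof
  fix a b assume ab: "a \<in> carrier V" "b \<in> carrier V"
  then show "form a b \<in> carrier K" using form_closed by simp
next
  fix a x y assume "a \<in> carrier V" "x \<in> carrier V" "y \<in> carrier V"
  then have A: "a \<in> A" "x \<in> A" "y \<in> A" by auto
  show "form a (x \<oplus>\<^bsub>V\<^esub> y) = form a x \<oplus>\<^bsub>K\<^esub> form a y"
  proof (cases "a = e")
    case True then show ?thesis using vadd_zero_left base_A by (simp add: form_def)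
  next
    case False
    note a = A(1) False
    have U: "form a x \<in> U" "form a y \<in> U" using form_closed A by auto
    have W: "wp a \<in> A" using wp[OF a] by blast
    have c: "form a x \<cdot> wp a \<in> A" "form a y \<cdot> wp a \<in> A" using sc_closed U W by auto
    have "x \<uplus> form a x \<cdot> wp a \<in> Vp a" "y \<uplus> form a y \<cdot> wp a \<in> Vp a"
      using form_eq[OF a A(2) U(1)] form_eq[OF a A(3) U(2)] by auto
    then have "(x \<uplus> form a x \<cdot> wp a) \<uplus> (y \<uplus> form a y \<cdot> wp a) \<in> Vp a" using Vp_add[OF a] by blast
    moreover have "(x \<uplus> form a x \<cdot> wp a) \<uplus> (y \<uplus> form a y \<cdot> wp a) = (x \<uplus> y) \<uplus> (form a x \<uplus> form a y) \<cdot> wp a"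
      using A c vadd_closed sc_add_left[OF U W] by (simp add: vadd_ac)
    ultimately show ?thesis
      using form_eq[OF a, of "x \<uplus> y" "form a x \<uplus> form a y"] A U vadd_closed U_add by simp
  qed
next
  fix t a x assume "t \<in> carrier K" "a \<in> carrier V" "x \<in> carrier V"
  then have A: "t \<in> U" "a \<in> A" "x \<in> A" by auto
  show "form a (t \<cdot> x) = t \<otimes>\<^bsub>K\<^esub> form a x"
  proof (cases "a = e")
    case True then show ?thesis using sc(2) A by (simp add: form_def)
  next
    case False
    note a = A(2) False
    have U: "form a x \<in> U" using form_closed A by auto
    have W: "wp a \<in> A" using wp[OF a] by blast
    have "t \<cdot> (x \<uplus> form a x \<cdot> wp a) \<in> Vp a" using form_eq[OF a A(3) U] Vp_smult[OF a A(1)] by blast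
    then have "t \<cdot> x \<uplus> (t \<cdot> form a x) \<cdot> wp a \<in> Vp a"
      using sc_add_right A U W sc_closed sc_assoc by simp
    then show ?thesis using form_eq[OF a, of "t \<cdot> x" "t \<cdot> form a x"] A U sc_closed sc_U by simp
  qed
next
  fix x y assume "x \<in> carrier V" "y \<in> carrier V" and z: "form x y = \<zero>\<^bsub>K\<^esub>"
  then have A: "x \<in> A" "y \<in> A" by auto
  show "form y x = \<zero>\<^bsub>K\<^esub>"
  proof (cases "x = e \<or> y = e")
    case True then show ?thesis using form_zero_right A form_zero_left by auto
  next
    case False
    then have "perp (dr y) (dr x)" using form_zero_iff[of x y] A z by simp
    then have "perp (dr x) (dr y)" using perp_sym dr_X A False by blast
    then show ?thesis using form_zero_iff[of y x] A False by simp
  qed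
next
  fix x y assume "x \<in> carrier V" "y \<in> carrier V" and z: "form x y = \<ominus>\<^bsub>K\<^esub> \<one>\<^bsub>K\<^esub>"
  then have A: "x \<in> A" "y \<in> A" by auto
  have ne: "x \<noteq> e" "y \<noteq> e" using z minus_i form_zero_right A by (auto simp: form_def)
  have "perp y x" using form_minus_one_iff[of x y] z A ne by simp
  then have "perp x y" using perp_sym A A_X by blast
  then show "form y x = \<ominus>\<^bsub>K\<^esub> \<one>\<^bsub>K\<^esub>" using form_minus_one_iff[of y x] A ne by simp
next
  fix x assume "x \<in> carrier V" "form x x = \<zero>\<^bsub>K\<^esub>"
  then show "x = \<zero>\<^bsub>V\<^esub>" using form_zero_iff[of x x] perp_irrefl dr_X by auto
qed

end

section \<open>Rotations\<close>

text \<open>Unlike the carrier of \<open>orthoset_aut_group\<close>, this imposes no extensionality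
  outside \<open>X\<close>, so \<open>inv_into\<close> can be used unrestricted.\<close>

definition orthoset_aut :: "'a set \<Rightarrow> ('a \<Rightarrow> 'a \<Rightarrow> bool) \<Rightarrow> ('a \<Rightarrow> 'a) \<Rightarrow> bool" where
  "orthoset_aut X perp \<phi> \<longleftrightarrow> bij_betw \<phi> X X \<and> (\<forall>x\<in>X. \<forall>y\<in>X. perp x y \<longleftrightarrow> perp (\<phi> x) (\<phi> y))"

lemma orthoset_aut_inverse:
  assumes "orthoset_aut X perp \<phi>"
  shows "orthoset_aut X perp (inv_into X \<phi>)"
    "\<And>x. x \<in> X \<Longrightarrow> \<phi> (inv_into X \<phi> x) = x" "\<And>x. x \<in> X \<Longrightarrow> inv_into X \<phi> (\<phi> x) = x"
    "\<And>x. x \<in> X \<Longrightarrow> inv_into X \<phi> x \<in> X"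
proof -
  have b: "bij_betw \<phi> X X" and p: "\<And>x y. x \<in> X \<Longrightarrow> y \<in> X \<Longrightarrow> perp x y \<longleftrightarrow> perp (\<phi> x) (\<phi> y)"
    using assms by (auto simp: orthoset_aut_def)
  show r: "\<And>x. x \<in> X \<Longrightarrow> \<phi> (inv_into X \<phi> x) = x" and "\<And>x. x \<in> X \<Longrightarrow> inv_into X \<phi> (\<phi> x) = x"
    using bij_betw_inv_into_right[OF b] bij_betw_inv_into_left[OF b] by auto
  have bi: "bij_betw (inv_into X \<phi>) X X" using bij_betw_inv_into[OF b] .
  then show c: "\<And>x. x \<in> X \<Longrightarrow> inv_into X \<phi> x \<in> X" using bij_betwE by blast
  show "orthoset_aut X perp (inv_into X \<phi>)" using bi p r c by (auto simp: orthoset_aut_def)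
qed

lemma (in linear_orthoset) aut_closed: "orthoset_aut X perp \<phi> \<Longrightarrow> x \<in> X \<Longrightarrow> \<phi> x \<in> X"
  using bij_betwE by (auto simp: orthoset_aut_def)

lemma (in linear_orthoset) aut_inj: "\<lbrakk>orthoset_aut X perp \<phi>; x \<in> X; y \<in> X; \<phi> x = \<phi> y\<rbrakk> \<Longrightarrow> x = y"
  by (auto simp: orthoset_aut_def bij_betw_def inj_on_def)

lemma (in linear_orthoset) aut_perp:
  "\<lbrakk>orthoset_aut X perp \<phi>; x \<in> X; y \<in> X\<rbrakk> \<Longrightarrow> perp (\<phi> x) (\<phi> y) \<longleftrightarrow> perp x y"
  by (auto simp: orthoset_aut_def)

lemma (in linear_orthoset) aut_line:
  assumes \<phi>: "orthoset_aut X perp \<phi>" and pq: "p \<in> X" "q \<in> X" and x: "x \<in> cl {p, q}"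
  shows "\<phi> x \<in> cl {\<phi> p, \<phi> q}"
proof -
  have xX: "x \<in> X" using x cl_closed by blast
  have "perp y (\<phi> x)" if y: "y \<in> X" "perp y (\<phi> p)" "perp y (\<phi> q)" for y
  proof -
    obtain z where z: "z \<in> X" "y = \<phi> z" using orthoset_aut_inverse[OF \<phi>] y by metis
    then have "perp z p" "perp z q" using y aut_perp[OF \<phi>] pq by auto
    then have "perp z x" using perp_cl[of z "{p,q}" x] z x by blast
    then show ?thesis using z aut_perp[OF \<phi>] xX by blast
  qed
  then show ?thesis using aut_closed[OF \<phi>] xX pq by (auto simp: cl_def)
qed

text \<open>\<open>R\<close> will be \<open>divisible_part X perp\<close>. Its group at
  \<open>p\<close>, \<open>q\<close> depends only on the line through them, which is why (DT1) can
  be stated as transitivity from \<open>p\<close> to every other point of the line.\<close>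

locale rotation_orthoset = unit_orthoset +
  fixes R :: "'a \<Rightarrow> 'a \<Rightarrow> ('a \<Rightarrow> 'a) set"
  assumes R_aut: "\<lbrakk>p \<in> X; q \<in> X; p \<noteq> q; \<phi> \<in> R p q\<rbrakk> \<Longrightarrow> orthoset_aut X perp \<phi>"
    and R_fix: "\<lbrakk>p \<in> X; q \<in> X; p \<noteq> q; \<phi> \<in> R p q; x \<in> X; perp x p; perp x q\<rbrakk> \<Longrightarrow> \<phi> x = x"
    and R_commute: "\<lbrakk>p \<in> X; q \<in> X; p \<noteq> q; \<phi> \<in> R p q; \<psi> \<in> R p q; x \<in> X\<rbrakk> \<Longrightarrow> \<phi> (\<psi> x) = \<psi> (\<phi> x)"
    and R_transitive: "\<lbrakk>p \<in> X; q \<in> X; p \<noteq> q; r \<in> cl {p, q}; r \<noteq> p\<rbrakk> \<Longrightarrow> \<exists>\<phi>\<in>R p q. \<phi> p = r"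
begin

lemma aut_M: assumes "orthoset_aut X perp \<phi>" "\<phi> e = e" "x \<in> X" shows "\<phi> x \<in> M \<longleftrightarrow> x \<in> M"
  using aut_perp[OF assms(1) assms(3) base] aut_closed[OF assms(1,3)] assms by (simp add: M_def)

lemma aut_A: assumes "orthoset_aut X perp \<phi>" "\<phi> e = e" "x \<in> X" shows "\<phi> x \<in> A \<longleftrightarrow> x \<in> A"
  using aut_M[OF assms] aut_closed[OF assms(1,3)] assms by (simp add: A_def)

lemma aut_nonzero: assumes "orthoset_aut X perp \<phi>" "\<phi> e = e" "x \<in> A" "x \<noteq> e" shows "\<phi> x \<noteq> e"
  using aut_inj[OF assms(1), of x e] assms base A_X by auto

lemma aut_dr:
  assumes "orthoset_aut X perp \<phi>" "\<phi> e = e" "x \<in> A" "x \<noteq> e"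
  shows "dr (\<phi> x) = \<phi> (dr x)"
proof (rule dr_unique)
  show "\<phi> x \<in> A" using aut_A assms A_X by blast
  show "\<phi> x \<noteq> e" using aut_nonzero assms by blast
  show "\<phi> (dr x) \<in> M" using aut_M assms dr dr_X by blast
  show "\<phi> (dr x) \<in> cl {e, \<phi> x}" using aut_line[OF assms(1) base A_X, of x "dr x"] dr assms by simp
qed

text \<open>Since \<open>X\<close> has rank at least 4, a rotation in \<open>R p q\<close> fixes pointwise a line through \<open>e\<close>
  orthogonal to \<open>p\<close> and \<open>q\<close>, so it commutes with all scalars.\<close>

lemma rotation_linear:
  assumes pq: "p \<in> M" "q \<in> M" "p \<noteq> q" and J: "J \<in> R p q"
  shows "orthoset_aut X perp J" "J e = e"
    and "\<And>x y. \<lbrakk>x \<in> A; y \<in> A\<rbrakk> \<Longrightarrow> J (x \<uplus> y) = J x \<uplus> J y"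
    and "\<And>a x. \<lbrakk>a \<in> U; x \<in> A\<rbrakk> \<Longrightarrow> J (a \<cdot> x) = a \<cdot> J x"
proof -
  have X: "p \<in> X" "q \<in> X" using pq M_X by auto
  show aut: "orthoset_aut X perp J" using R_aut X pq J by blast
  have "perp e p" "perp e q" using pq perp_sym base by (auto simp: M_def)
  then show Je: "J e = e" using R_fix[OF X pq(3) J base] by blast
  let ?J' = "inv_into X J"
  note inv = orthoset_aut_inverse[OF aut]
  have J'e: "?J' e = e" using inv(3)[OF base] Je by simp
  obtain g where g: "g \<in> X" "perp g e" "perp g p" "perp g q" using rank_ge_4[OF base X] by blast
  have gM: "g \<in> M" using g by (simp add: M_def)
  then obtain y where y: "y \<in> A" "y \<noteq> e" "dr y = g" by (rule direction_vector)
  have Jfix: "J z = z" if z: "z \<in> cl {e, g}" for z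
    using R_fix[OF X pq(3) J, of z] cl_perp[of p "{e,g}" z] cl_perp[of q "{e,g}" z] z X g
      \<open>perp e p\<close> \<open>perp e q\<close> cl_closed[OF z] by blast
  have par1: "J x \<in> cl {J w, J m}" if "m \<in> M" "x \<in> A" "w \<in> A" "x \<in> cl {w, m}" for m x w
    using aut_line[OF aut] that A_X M_X by blast
  have par2: "?J' x \<in> cl {?J' w, ?J' m}" if "m \<in> M" "x \<in> A" "w \<in> A" "x \<in> cl {w, m}" for m x w
    using aut_line[OF inv(1)] that A_X M_X by blast
  have clos: "\<And>x. x \<in> A \<Longrightarrow> J x \<in> A" "\<And>x. x \<in> A \<Longrightarrow> ?J' x \<in> A" "\<And>x. x \<in> M \<Longrightarrow> J x \<in> M"
    "\<And>x. x \<in> M \<Longrightarrow> ?J' x \<in> M"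
    using aut_A[OF aut Je A_X] aut_A[OF inv(1) J'e A_X] aut_M[OF aut Je M_X]
      aut_M[OF inv(1) J'e M_X]
    by simp_all
  have invs: "\<And>x. x \<in> A \<Longrightarrow> J (?J' x) = x" "\<And>x. x \<in> A \<Longrightarrow> ?J' (J x) = x" "\<And>m. m \<in> M \<Longrightarrow> J (?J' m) = m"
    using inv(2,3) A_X M_X by auto
  show "J (x \<uplus> y) = J x \<uplus> J y" if "x \<in> A" "y \<in> A" for x y
    by (rule symmetry_additive(1)[of J ?J' J ?J']) (fact clos invs par1 par2 Je that)+
  show "J (a \<cdot> x) = a \<cdot> J x" if "a \<in> U" "x \<in> A" for a x
  proof -
    have Jy: "J y = y" using Jfix in_dr_line y by auto
    have Jay: "J (a \<cdot> y) = a \<cdot> y"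
    proof (cases "a = e")
      case True then show ?thesis using sc_zero y Je by simp
    next
      case False
      then have "dr (a \<cdot> y) = g" "a \<cdot> y \<in> A" "a \<cdot> y \<noteq> e"
        using dr_smult sc_closed sc_nonzero that y by auto
      then show ?thesis using Jfix in_dr_line by metis
    qed
    show ?thesis
      by (rule symmetry_additive(2)[of J ?J' J ?J' _ y]) (fact clos invs par1 par2 Je that y Jy Jay)+
  qed
qed

text \<open>For \<open>x = a \<uplus> r \<cdot> b\<close> with \<open>r\<close> nonzero, let the
  rotation \<open>B\<close> take the direction of \<open>a\<close> to that of \<open>x\<close>. Then
  \<open>B b = B (J a) = J (B a)\<close>, so orthogonality of \<open>a\<close> and \<open>b\<close>
  becomes orthogonality of \<open>x\<close> and \<open>J x\<close>. With
  \<open>J b = s \<cdot> a\<close> this is the hypothesis of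
  \<open>form_multiple_self_aux\<close>.\<close>

lemma form_multiple_self: assumes b: "b \<in> A" and t: "t \<in> U" shows "form (t \<cdot> b) b = t \<cdot> form b b"
proof (cases "b = e")
  case True
  then show ?thesis using sc(2)[OF t] form_zero_left by simp
next
  case bne: False
  let ?q = "dr b"
  have q: "?q \<in> M" "?q \<in> X" using dr bne b M_X by auto
  obtain p where p: "p \<in> X" "perp p e" "perp p ?q" using rank_ge_4[OF base q(2) q(2)] by blast
  have pM: "p \<in> M" using p by (simp add: M_def)
  have pq: "p \<noteq> ?q" using p perp_irrefl by auto
  obtain J where J: "J \<in> R p ?q" "J p = ?q"
    using R_transitive[OF p(1) q(2) pq, of ?q] q pq by (auto simp: cl_incl)
  note Jl = rotation_linear[OF pM q(1) pq J(1)]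
  \<comment> \<open>\<open>J q\<close> is a point of the line \<open>p q\<close> orthogonal to
    \<open>J p = q\<close>; if it were not \<open>p\<close>, then \<open>q\<close> would lie on the
    line through \<open>p\<close> and \<open>J q\<close>, both orthogonal to
    \<open>q\<close>.\<close>
  have Jq: "J ?q = p"
  proof (rule ccontr)
    assume n: "J ?q \<noteq> p"
    have "?q \<in> cl {p, ?q}" "p \<in> cl {p, ?q}" using p q by (auto simp: cl_incl)
    have "J ?q \<in> cl {p, ?q}"
    proof -
      have "perp y (J ?q)" if y: "y \<in> X" "perp y p" "perp y ?q" for y
        using aut_perp[OF Jl(1) y(1) q(2)] R_fix[OF p(1) q(2) pq J(1) y] y by simp
      then show ?thesis using aut_closed[OF Jl(1) q(2)] p q by (auto simp: cl_def)
    qed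
    then have "?q \<in> cl {p, J ?q}" using cl_pair_exchange[of p ?q "J ?q"] p q n by blast
    moreover have "perp p ?q" using p by simp
    moreover have "perp (J ?q) ?q" using aut_perp[OF Jl(1) q(2) p(1)] J p q perp_sym by simp
    ultimately have "perp ?q ?q" using cl_perp[of ?q "{p, J ?q}" ?q] q by blast
    then show False using perp_irrefl q by blast
  qed
  obtain a0 where a0: "a0 \<in> A" "a0 \<noteq> e" "dr a0 = p" using direction_vector[OF pM] .
  have Ja0: "J a0 \<in> A" "J a0 \<noteq> e" "dr (J a0) = ?q"
    using aut_A[OF Jl(1,2)] aut_nonzero[OF Jl(1,2)] aut_dr[OF Jl(1,2)] a0 A_X J by auto
  then obtain \<mu> where \<mu>: "\<mu> \<in> U" "\<mu> \<noteq> e" "b = \<mu> \<cdot> J a0" using dr_eq_multiple b bne by metis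
  define a where "a = \<mu> \<cdot> a0"
  have a: "a \<in> A" "a \<noteq> e" "dr a = p" "J a = b"
    using \<mu> a0 sc_closed sc_nonzero dr_smult Jl(4) by (auto simp: a_def)
  have Jb: "J b \<in> A" "J b \<noteq> e" "dr (J b) = dr a"
    using aut_A[OF Jl(1,2)] aut_nonzero[OF Jl(1,2)] aut_dr[OF Jl(1,2)] bne A_X Jq a by auto
  then obtain s where s: "s \<in> U" "J b = s \<cdot> a" using dr_eq_multiple a by metis
  have fab: "form a b = e" using form_zero_iff[of a b] a b bne p q perp_sym by simp
  have fba: "form b a = e" using S.form_zero_sym[of a b] fab a b by simp
  have faa: "form a a \<noteq> e" "form b b \<noteq> e" using S.form_anisotropic a b bne by auto
  have orth: "form (a \<uplus> r \<cdot> b) (b \<uplus> (r \<cdot> s) \<cdot> a) = e" if r: "r \<in> U" for r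
  proof (cases "r = e")
    case True
    then show ?thesis using fab sc_zero a b s U_P vadd_zero_right by simp
  next
    case False
    let ?x = "a \<uplus> r \<cdot> b" and ?y = "b \<uplus> (r \<cdot> s) \<cdot> a"
    have c: "r \<cdot> b \<in> A" "?x \<in> A" "?y \<in> A" using r a b s sc_closed sc_U vadd_closed by auto
    have "form a ?x = form a a"
      using S.form_add[of a a "r \<cdot> b"] S.form_smult[of r a b] fab sc(2)[OF r] vadd_zero_right
        U_P[OF form_closed] a b c r by simp
    then have xne: "?x \<noteq> e" using faa form_zero_right a by auto
    have "form b ?x = r \<cdot> form b b"
      using S.form_add[of b a "r \<cdot> b"] S.form_smult[of r b b] fba vadd_zero_left form_closed a b r
        sc_closed U_P by simp
    then have "form b ?x \<noteq> e" using sc_nonzero[OF r False] faa form_closed b U_P by simp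
    \<comment> \<open>Transitivity excludes the starting point \<open>p\<close>. Here
      \<open>form b ?x\<close> is nonzero, whereas \<open>p\<close> is orthogonal to the direction
      of \<open>b\<close>.\<close>
    then have drx: "dr ?x \<noteq> p" using form_zero_iff[of b ?x] b bne c xne p by auto
    have "dr (r \<cdot> b) = ?q" "r \<cdot> b \<noteq> e" using dr_smult sc_nonzero r False b bne by auto
    then have "dr ?x \<in> cl {p, ?q}"
      using sum_direction[of a p "r \<cdot> b" ?q] a pM q c xne par_dr[of a p] par_dr[of "r \<cdot> b" ?q]
        by simp
    then obtain B where B: "B \<in> R p ?q" "B p = dr ?x"
      using R_transitive[OF p(1) q(2) pq _ drx] by blast
    note Bl = rotation_linear[OF pM q(1) pq B(1)]
    have Ba: "B a \<in> A" "B a \<noteq> e" "dr (B a) = dr ?x"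
      using aut_A[OF Bl(1,2)] aut_nonzero[OF Bl(1,2)] aut_dr[OF Bl(1,2)] a A_X B by auto
    then obtain \<alpha> where \<alpha>: "\<alpha> \<in> U" "\<alpha> \<noteq> e" "B a = \<alpha> \<cdot> ?x" using dr_eq_multiple c xne by metis
    have "J ?x = J a \<uplus> r \<cdot> J b" using Jl(3)[of a "r \<cdot> b"] Jl(4)[of r b] a b c r by simp
    also have "\<dots> = ?y" using a s r sc_assoc by simp
    finally have Jx: "J ?x = ?y" .
    have "B b = J (B a)" using R_commute[OF p(1) q(2) pq B(1) J(1), of a] a A_X by simp
    then have Bb: "B b = \<alpha> \<cdot> ?y" using \<alpha> Jl(4) c Jx by simp
    have Bb': "B b \<in> A" "B b \<noteq> e" "dr (B b) = B ?q"
      using aut_A[OF Bl(1,2)] aut_nonzero[OF Bl(1,2)] aut_dr[OF Bl(1,2)] b bne A_X by auto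
    have "perp (B ?q) (B p)" using aut_perp[OF Bl(1) q(2) p(1)] p q perp_sym by blast
    then have "form (B a) (B b) = e" using form_zero_iff[of "B a" "B b"] Ba Bb' B by simp
    then have "\<alpha> \<cdot> form (\<alpha> \<cdot> ?x) ?y = e"
      using S.form_smult[of \<alpha> "\<alpha> \<cdot> ?x" ?y] \<alpha> Bb c sc_closed by simp
    then have "form (\<alpha> \<cdot> ?x) ?y = e"
      using S.K_no_zero_divisors[of \<alpha> "form (\<alpha> \<cdot> ?x) ?y"] \<alpha> c sc_closed form_closed by simp
    \<comment> \<open>The remaining \<alpha> stands in the first argument, where linearity is not
      yet available; swapping at the value zero makes it removable.\<close>
    then have "form ?y (\<alpha> \<cdot> ?x) = e" using S.form_zero_sym[of "\<alpha> \<cdot> ?x" ?y] \<alpha> c sc_closed by simp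
    then have "\<alpha> \<cdot> form ?y ?x = e" using S.form_smult[of \<alpha> ?y ?x] \<alpha> c by simp
    then have "form ?y ?x = e" using S.K_no_zero_divisors[of \<alpha> "form ?y ?x"] \<alpha> c form_closed by simp
    then show ?thesis using S.form_zero_sym[of ?y ?x] c by simp
  qed
  show ?thesis using S.form_multiple_self_aux[of a b s t] a b fab s orth t by simp
qed

sublocale S: self_linear_form K V form
  by unfold_locales (use form_multiple_self unit in auto)

sublocale K: field K by (rule S.field_K)

sublocale Vm: module K V by (rule S.module_V)

lemma form_add_left: "\<lbrakk>x \<in> A; y \<in> A; z \<in> A\<rbrakk> \<Longrightarrow> form (x \<uplus> y) z = form x z \<uplus> form y z"
  using S.form_symmetric[of _ z] S.form_add[of z x y] vadd_closed by simp

lemma form_smult_left: "\<lbrakk>a \<in> U; x \<in> A; y \<in> A\<rbrakk> \<Longrightarrow> form (a \<cdot> x) y = a \<cdot> form x y"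
  using S.form_symmetric[of _ y] S.form_smult[of a y x] sc_closed by simp

end

section \<open>Ordering a Pythagorean field\<close>

locale formally_real_pythagorean = field K for K (structure) +
  assumes sum_of_squares: "\<lbrakk>a \<in> carrier K; b \<in> carrier K\<rbrakk> \<Longrightarrow> \<exists>c\<in>carrier K. a \<otimes> a \<oplus> b \<otimes> b = c \<otimes> c"
    and minus_one_no_square: "a \<in> carrier K \<Longrightarrow> a \<otimes> a \<noteq> \<ominus> \<one>"
begin

text \<open>A proper preordering in the sense of Artin and Schreier.\<close>

definition precone :: "'a set \<Rightarrow> bool" where
  "precone C \<longleftrightarrow> C \<subseteq> carrier K \<and> (\<forall>a\<in>carrier K. a \<otimes> a \<in> C) \<and> (\<forall>a\<in>C. \<forall>b\<in>C. a \<oplus> b \<in> C \<and> a \<otimes> b \<in> C)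
     \<and> \<ominus> \<one> \<notin> C"

text \<open>The Pythagorean property makes the squares themselves closed under addition; they are
  the starting point for Zorn's lemma.\<close>

lemma precone_squares: "precone {a \<otimes> a | a. a \<in> carrier K}"
  unfolding precone_def
proof (intro conjI ballI)
  fix a b assume "a \<in> {a \<otimes> a | a. a \<in> carrier K}" "b \<in> {a \<otimes> a | a. a \<in> carrier K}"
  then obtain c d where c: "c \<in> carrier K" "d \<in> carrier K" "a = c \<otimes> c" "b = d \<otimes> d" by blast
  then show "a \<oplus> b \<in> {a \<otimes> a | a. a \<in> carrier K}" using sum_of_squares[of c d] by blast
  have "a \<otimes> b = (c \<otimes> d) \<otimes> (c \<otimes> d)" using c by algebra
  then show "a \<otimes> b \<in> {a \<otimes> a | a. a \<in> carrier K}" using c by blast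
qed (use minus_one_no_square in force)+

lemma precone_maximal:
  obtains C where "precone C" "\<And>D. precone D \<Longrightarrow> C \<subseteq> D \<Longrightarrow> D = C"
proof -
  have "\<exists>C\<in>Collect precone. \<forall>D\<in>Collect precone. C \<subseteq> D \<longrightarrow> D = C"
  proof (rule subset_Zorn_nonempty)
    show "Collect precone \<noteq> {}" using precone_squares by blast
    fix \<C> assume ne: "\<C> \<noteq> {}" and ch: "subset.chain (Collect precone) \<C>"
    have pc: "precone C" if "C \<in> \<C>" for C using ch that by (auto simp: subset.chain_def)
    show "\<Union>\<C> \<in> Collect precone"
      unfolding mem_Collect_eq precone_def
    proof (intro conjI ballI)
      show "\<Union>\<C> \<subseteq> carrier K" "\<ominus> \<one> \<notin> \<Union>\<C>" using pc unfolding precone_def by blast+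
      show "a \<otimes> a \<in> \<Union>\<C>" if "a \<in> carrier K" for a using ne pc that by (auto simp: precone_def)
      fix a b assume "a \<in> \<Union>\<C>" "b \<in> \<Union>\<C>"
      then obtain C D where CD: "C \<in> \<C>" "D \<in> \<C>" "a \<in> C" "b \<in> D" by blast
      then have "C \<subseteq> D \<or> D \<subseteq> C" using ch by (auto simp: subset.chain_def)
      then obtain E where "E \<in> \<C>" "a \<in> E" "b \<in> E" using CD by blast
      then show "a \<oplus> b \<in> \<Union>\<C>" "a \<otimes> b \<in> \<Union>\<C>" using pc[of E] unfolding precone_def by blast+
    qed
  qed
  then show ?thesis using that by blast
qed

lemma nonzero_inverse: assumes "a \<in> carrier K" "a \<noteq> \<zero>" shows "inv a \<in> carrier K" "a \<otimes> inv a = \<one>"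
  using assms field_Units by auto

text \<open>If \<open>a\<close> is not in \<open>C\<close>, the set of all \<open>x - a y\<close>
  with \<open>x\<close>, \<open>y\<close> in \<open>C\<close> is again proper:
  \<open>-1 = x - a y\<close> would give \<open>a = (1 + x) y (1/y)^2\<close>, an element of
  \<open>C\<close>. By maximality this set is \<open>C\<close>, and it contains
  \<open>-a\<close>.\<close>

lemma precone_total:
  assumes C: "precone C" and max: "\<And>D. precone D \<Longrightarrow> C \<subseteq> D \<Longrightarrow> D = C" and a: "a \<in> carrier K"
  shows "a \<in> C \<or> \<ominus> a \<in> C"
proof (cases "a \<in> C")
  case False
  have CK: "C \<subseteq> carrier K" and sq: "\<And>x. x \<in> carrier K \<Longrightarrow> x \<otimes> x \<in> C" and m1: "\<ominus> \<one> \<notin> C"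
    and cls: "\<And>x y. x \<in> C \<Longrightarrow> y \<in> C \<Longrightarrow> x \<oplus> y \<in> C" "\<And>x y. x \<in> C \<Longrightarrow> y \<in> C \<Longrightarrow> x \<otimes> y \<in> C"
    using C by (auto simp: precone_def)
  have z1: "\<zero> \<in> C" "\<one> \<in> C" using sq[of \<zero>] sq[of \<one>] by auto
  let ?D = "{x \<ominus> a \<otimes> y | x y. x \<in> C \<and> y \<in> C}"
  have "precone ?D"
    unfolding precone_def
  proof (intro conjI ballI)
    show "?D \<subseteq> carrier K" using CK a by auto
    show "c \<otimes> c \<in> ?D" if c: "c \<in> carrier K" for c
    proof -
      have "c \<otimes> c = c \<otimes> c \<ominus> a \<otimes> \<zero>" using c a by algebra
      then show ?thesis using sq[OF c] z1 by blast
    qed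
    fix u v assume "u \<in> ?D" "v \<in> ?D"
    then obtain x y x' y' where *: "x \<in> C" "y \<in> C" "x' \<in> C" "y' \<in> C" "u = x \<ominus> a \<otimes> y" "v = x' \<ominus> a \<otimes> y'" by blast
    then have K: "x \<in> carrier K" "y \<in> carrier K" "x' \<in> carrier K" "y' \<in> carrier K" using CK by auto
    have "u \<oplus> v = (x \<oplus> x') \<ominus> a \<otimes> (y \<oplus> y')" using * K a by algebra
    then show "u \<oplus> v \<in> ?D" using cls(1)[OF *(1,3)] cls(1)[OF *(2,4)] by blast
    have "u \<otimes> v = (x \<otimes> x' \<oplus> (a \<otimes> a) \<otimes> (y \<otimes> y')) \<ominus> a \<otimes> (x \<otimes> y' \<oplus> x' \<otimes> y)" using * K a by algebra
    moreover have "x \<otimes> x' \<oplus> (a \<otimes> a) \<otimes> (y \<otimes> y') \<in> C" "x \<otimes> y' \<oplus> x' \<otimes> y \<in> C"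
      using *(1-4) by (simp_all add: cls sq[OF a])
    ultimately show "u \<otimes> v \<in> ?D" by blast
  next
    show "\<ominus> \<one> \<notin> ?D"
    proof
      assume "\<ominus> \<one> \<in> ?D"
      then obtain x y where xy: "x \<in> C" "y \<in> C" "\<ominus> \<one> = x \<ominus> a \<otimes> y" by blast
      have K: "x \<in> carrier K" "y \<in> carrier K" using xy CK by auto
      have "a \<otimes> y = a \<otimes> y \<oplus> \<one> \<oplus> (\<ominus> \<one>)" using a K by algebra
      also have "\<dots> = a \<otimes> y \<oplus> \<one> \<oplus> (x \<ominus> a \<otimes> y)" using xy by simp
      also have "\<dots> = \<one> \<oplus> x" using a K by algebra
      finally have ay: "a \<otimes> y = \<one> \<oplus> x" .
      have yn: "y \<noteq> \<zero>"
      proof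
        assume "y = \<zero>"
        then have "\<ominus> \<one> = x" using xy a K by (simp add: a_minus_def)
        then show False using m1 xy by simp
      qed
      note iy = nonzero_inverse[OF K(2) yn]
      have "a = a \<otimes> y \<otimes> (y \<otimes> (inv y \<otimes> inv y))"
      proof -
        have "a \<otimes> y \<otimes> (y \<otimes> (inv y \<otimes> inv y)) = a \<otimes> (y \<otimes> inv y) \<otimes> (y \<otimes> inv y)"
          using a K iy(1) by algebra
        then show ?thesis using iy a by simp
      qed
      then have "a = (\<one> \<oplus> x) \<otimes> (y \<otimes> (inv y \<otimes> inv y))" using ay by simp
      then show False using False cls sq[OF iy(1)] xy z1 by metis
    qed
  qed
  moreover have "C \<subseteq> ?D"
  proof
    fix x assume "x \<in> C"
    moreover have "x = x \<ominus> a \<otimes> \<zero>" using \<open>x \<in> C\<close> CK a by (auto simp: a_minus_def)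
    ultimately show "x \<in> ?D" using z1 by blast
  qed
  ultimately have "?D = C" using max by blast
  moreover have "\<ominus> a = \<zero> \<ominus> a \<otimes> \<one>" using a by algebra
  then have "\<ominus> a \<in> ?D" using z1 by blast
  ultimately show ?thesis by blast
qed simp

lemma ordering_exists:
  "\<exists>le. ordered_field K le \<and> (\<forall>a\<in>carrier K. le \<zero> (a \<otimes> a))"
proof -
  obtain C where C: "precone C" and max: "\<And>D. precone D \<Longrightarrow> C \<subseteq> D \<Longrightarrow> D = C"
    using precone_maximal by blast
  have sq: "\<And>x. x \<in> carrier K \<Longrightarrow> x \<otimes> x \<in> C" and m1: "\<ominus> \<one> \<notin> C"
    and cls: "\<And>x y. x \<in> C \<Longrightarrow> y \<in> C \<Longrightarrow> x \<oplus> y \<in> C" "\<And>x y. x \<in> C \<Longrightarrow> y \<in> C \<Longrightarrow> x \<otimes> y \<in> C"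
    using C by (auto simp: precone_def)
  define le where "le a b \<longleftrightarrow> b \<ominus> a \<in> C" for a b
  have "ordered_field K le"
  proof
    fix a assume "a \<in> carrier K"
    then show "le a a" using sq[of \<zero>] by (simp add: le_def a_minus_def r_neg)
  next
    fix a b assume ab: "a \<in> carrier K" "b \<in> carrier K" "le a b" "le b a"
    show "a = b"
    proof (rule ccontr)
      assume ne: "a \<noteq> b"
      let ?c = "a \<ominus> b"
      have c: "?c \<in> carrier K" using ab by simp
      have cn: "?c \<noteq> \<zero>"
      proof
        assume "?c = \<zero>"
        then have "?c \<oplus> b = b" using ab by simp
        moreover have "?c \<oplus> b = a" using ab by algebra
        ultimately show False using ne by simp
      qed
      note ic = nonzero_inverse[OF c cn]
      \<comment> \<open>If \<open>c = a - b\<close> and \<open>-c\<close> were both in the cone with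
        \<open>c\<close> nonzero, then multiplying their product by the square of \<open>1/c\<close>
        would produce \<open>-1\<close>.\<close>
      have "(a \<ominus> b) \<otimes> (b \<ominus> a) \<otimes> (inv ?c \<otimes> inv ?c) = \<ominus> ((?c \<otimes> inv ?c) \<otimes> (?c \<otimes> inv ?c))"
        using ab ic(1) by algebra
      also have "\<dots> = \<ominus> \<one>" using ic(2) by simp
      finally have "\<ominus> \<one> = (a \<ominus> b) \<otimes> (b \<ominus> a) \<otimes> (inv ?c \<otimes> inv ?c)" by simp
      then show False using cls(2) ab sq[OF ic(1)] m1 by (metis le_def)
    qed
  next
    fix a b c assume *: "a \<in> carrier K" "b \<in> carrier K" "c \<in> carrier K" "le a b" "le b c"
    have "c \<ominus> a = (c \<ominus> b) \<oplus> (b \<ominus> a)" using * by algebra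
    then show "le a c" using * cls by (simp add: le_def)
  next
    fix a b assume *: "a \<in> carrier K" "b \<in> carrier K"
    have "a \<ominus> b = \<ominus> (b \<ominus> a)" using * by algebra
    then show "le a b \<or> le b a" using precone_total[OF C max, of "b \<ominus> a"] * by (auto simp: le_def)
  next
    fix a b c assume *: "a \<in> carrier K" "b \<in> carrier K" "c \<in> carrier K" "le a b"
    have "(b \<oplus> c) \<ominus> (a \<oplus> c) = b \<ominus> a" using * by algebra
    then show "le (a \<oplus> c) (b \<oplus> c)" using * by (simp add: le_def)
  next
    fix a b assume *: "a \<in> carrier K" "b \<in> carrier K" "le \<zero> a" "le \<zero> b"
    then show "le \<zero> (a \<otimes> b)" using cls by (simp add: le_def a_minus_def)
  qed
  moreover have "\<forall>a\<in>carrier K. le \<zero> (a \<otimes> a)" using sq by (simp add: le_def a_minus_def)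
  ultimately show ?thesis by blast
qed

end

text \<open>A greatest element \<open>m\<close> of a finite ordered field would satisfy
  \<open>m + 1 = m\<close>. Infinity is what later allows pairs of points to be coded by
  points.\<close>

lemma (in ordered_field) infinite_carrier: "infinite (carrier K)"
proof
  assume fin: "finite (carrier K)"
  have one: "le \<zero> \<one>"
  proof (rule ccontr)
    assume n: "\<not> le \<zero> \<one>"
    then have "le (\<one> \<oplus> \<ominus> \<one>) (\<zero> \<oplus> \<ominus> \<one>)" using le_total[of \<zero> \<one>] le_add[of \<one> \<zero> "\<ominus> \<one>"] by simp
    then have "le \<zero> (\<ominus> \<one>)" by (simp add: r_neg)
    then have "le \<zero> ((\<ominus> \<one>) \<otimes> (\<ominus> \<one>))" using le_mult by simp
    then show False using n by (simp add: l_minus)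
  qed
  have "\<exists>m\<in>S. \<forall>x\<in>S. le x m" if "finite S" "S \<noteq> {}" "S \<subseteq> carrier K" for S
    using that
  proof (induction S rule: finite_ne_induct)
    case (singleton x) then show ?case using le_refl by simp
  next
    case (insert x F)
    then obtain m where m: "m \<in> F" "\<forall>y\<in>F. le y m" by auto
    have K: "m \<in> carrier K" "x \<in> carrier K" using m insert by auto
    show ?case
    proof (cases "le x m")
      case True then show ?thesis using m by auto
    next
      case False
      then have "le m x" using le_total K by blast
      then have "\<forall>y\<in>F. le y x" using m le_trans[of _ m x] insert.prems by blast
      then show ?thesis using le_refl K by auto
    qed
  qed
  then obtain m where m: "m \<in> carrier K" "\<And>x. x \<in> carrier K \<Longrightarrow> le x m"
    using fin by (metis order_refl zero_closed empty_iff)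
  have "le (\<zero> \<oplus> m) (\<one> \<oplus> m)" using le_add[OF _ _ m(1) one] by simp
  then have "m = \<one> \<oplus> m" using le_antisym[of m "\<one> \<oplus> m"] m by simp
  then have "\<one> = \<zero>" using m by (metis add.r_cancel_one' one_closed)
  then show False by simp
qed

section \<open>The orthogonal sum of the field and a form space\<close>

text \<open>\<open>\<iota>\<close> moves the pairs \<open>(a, x)\<close> into the type in which the vectors are to live.\<close>

locale extended_form_space = R?: formally_real_pythagorean K + module K V
  for K :: "('k, 'm) ring_scheme" (structure) and V :: "('k, 'v, 'n) module_scheme" (structure) +
  fixes form :: "'v \<Rightarrow> 'v \<Rightarrow> 'k" and \<iota> :: "'k \<times> 'v \<Rightarrow> 'h"
  assumes form_closed: "\<lbrakk>x \<in> carrier V; y \<in> carrier V\<rbrakk> \<Longrightarrow> form x y \<in> carrier K"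
    and form_sym: "\<lbrakk>x \<in> carrier V; y \<in> carrier V\<rbrakk> \<Longrightarrow> form x y = form y x"
    and form_add: "\<lbrakk>x \<in> carrier V; y \<in> carrier V; z \<in> carrier V\<rbrakk> \<Longrightarrow>
      form x (y \<oplus>\<^bsub>V\<^esub> z) = form x y \<oplus> form x z"
    and form_smult: "\<lbrakk>a \<in> carrier K; x \<in> carrier V; y \<in> carrier V\<rbrakk> \<Longrightarrow>
      form x (a \<odot>\<^bsub>V\<^esub> y) = a \<otimes> form x y"
    and form_anisotropic: "\<lbrakk>x \<in> carrier V; form x x = \<zero>\<rbrakk> \<Longrightarrow> x = \<zero>\<^bsub>V\<^esub>"
    and form_square: "x \<in> carrier V \<Longrightarrow> \<exists>s\<in>carrier K. form x x = s \<otimes> s"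
    and \<iota>: "inj_on \<iota> (carrier K \<times> carrier V)"
begin

definition \<pi> :: "'h \<Rightarrow> 'k \<times> 'v" where "\<pi> = inv_into (carrier K \<times> carrier V) \<iota>"

lemma \<pi>_\<iota> [simp]: "\<lbrakk>a \<in> carrier K; x \<in> carrier V\<rbrakk> \<Longrightarrow> \<pi> (\<iota> (a, x)) = (a, x)"
  using inv_into_f_f[OF \<iota>] by (simp add: \<pi>_def)

definition H :: "('k, 'h) module" where
  "H = \<lparr>carrier = \<iota> ` (carrier K \<times> carrier V), monoid.mult = undefined, one = undefined,
        zero = \<iota> (\<zero>, \<zero>\<^bsub>V\<^esub>),
        add = (\<lambda>u v. \<iota> (fst (\<pi> u) \<oplus> fst (\<pi> v), snd (\<pi> u) \<oplus>\<^bsub>V\<^esub> snd (\<pi> v))),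
        smult = (\<lambda>a u. \<iota> (a \<otimes> fst (\<pi> u), a \<odot>\<^bsub>V\<^esub> snd (\<pi> u)))\<rparr>"

definition formH :: "'h \<Rightarrow> 'h \<Rightarrow> 'k" where
  "formH u v = fst (\<pi> u) \<otimes> fst (\<pi> v) \<oplus> form (snd (\<pi> u)) (snd (\<pi> v))"

abbreviation Hplus (infixl "\<uplus>" 65) where "u \<uplus> v \<equiv> u \<oplus>\<^bsub>H\<^esub> v"
abbreviation Hscale (infixr "\<cdot>" 70) where "a \<cdot> u \<equiv> a \<odot>\<^bsub>H\<^esub> u"

lemma H_carrierE:
  assumes "u \<in> carrier H" obtains a x where "a \<in> carrier K" "x \<in> carrier V" "u = \<iota> (a, x)"
  using assms by (auto simp: H_def)

lemma H_carrier: "\<lbrakk>a \<in> carrier K; x \<in> carrier V\<rbrakk> \<Longrightarrow> \<iota> (a, x) \<in> carrier H"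
  by (auto simp: H_def)

lemma H_zero: "\<zero>\<^bsub>H\<^esub> = \<iota> (\<zero>, \<zero>\<^bsub>V\<^esub>)"
  by (simp add: H_def)

lemma H_add: "\<lbrakk>a \<in> carrier K; x \<in> carrier V; b \<in> carrier K; y \<in> carrier V\<rbrakk> \<Longrightarrow>
    \<iota> (a, x) \<uplus> \<iota> (b, y) = \<iota> (a \<oplus> b, x \<oplus>\<^bsub>V\<^esub> y)"
  by (simp add: H_def)

lemma H_smult: "\<lbrakk>a \<in> carrier K; b \<in> carrier K; y \<in> carrier V\<rbrakk> \<Longrightarrow>
    a \<cdot> \<iota> (b, y) = \<iota> (a \<otimes> b, a \<odot>\<^bsub>V\<^esub> y)"
  by (simp add: H_def)

lemma formH: "\<lbrakk>a \<in> carrier K; x \<in> carrier V; b \<in> carrier K; y \<in> carrier V\<rbrakk> \<Longrightarrow>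
    formH (\<iota> (a, x)) (\<iota> (b, y)) = a \<otimes> b \<oplus> form x y"
  by (simp add: formH_def)

lemma \<iota>_eq: "\<lbrakk>a \<in> carrier K; x \<in> carrier V; b \<in> carrier K; y \<in> carrier V\<rbrakk> \<Longrightarrow>
    \<iota> (a, x) = \<iota> (b, y) \<longleftrightarrow> a = b \<and> x = y"
  using inj_on_eq_iff[OF \<iota>, of "(a, x)" "(b, y)"] by auto

lemma abelian_group_H: "abelian_group H"
proof (rule abelian_groupI)
  fix u v assume "u \<in> carrier H" "v \<in> carrier H"
  then show "u \<uplus> v \<in> carrier H" "u \<uplus> v = v \<uplus> u"
    by (auto elim!: H_carrierE simp: H_add H_carrier R.a_comm M.a_comm)
next
  show "\<zero>\<^bsub>H\<^esub> \<in> carrier H" by (simp add: H_zero H_carrier)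
next
  fix u v w assume "u \<in> carrier H" "v \<in> carrier H" "w \<in> carrier H"
  then show "u \<uplus> v \<uplus> w = u \<uplus> (v \<uplus> w)"
    by (auto elim!: H_carrierE simp: H_add R.a_assoc M.a_assoc)
next
  fix u assume "u \<in> carrier H"
  then show "\<zero>\<^bsub>H\<^esub> \<uplus> u = u" by (auto elim!: H_carrierE simp: H_add H_zero)
next
  fix u assume "u \<in> carrier H"
  then obtain a x where *: "a \<in> carrier K" "x \<in> carrier V" "u = \<iota> (a, x)" by (rule H_carrierE)
  then show "\<exists>v\<in>carrier H. v \<uplus> u = \<zero>\<^bsub>H\<^esub>"
    by (intro bexI[of _ "\<iota> (\<ominus> a, \<ominus>\<^bsub>V\<^esub> x)"]) (simp_all add: H_add H_zero H_carrier R.l_neg M.l_neg)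
qed

lemma module_H: "module K H"
proof (rule moduleI[OF is_cring abelian_group_H])
  fix a b u v assume "a \<in> carrier K" "u \<in> carrier H"
  then show "a \<cdot> u \<in> carrier H" by (auto elim!: H_carrierE simp: H_smult H_carrier)
next
  fix a b u assume "a \<in> carrier K" "b \<in> carrier K" "u \<in> carrier H"
  then show "(a \<oplus> b) \<cdot> u = a \<cdot> u \<uplus> b \<cdot> u" "(a \<otimes> b) \<cdot> u = a \<cdot> (b \<cdot> u)"
    by (auto elim!: H_carrierE simp: H_smult H_add l_distr smult_l_distr m_assoc smult_assoc1)
next
  fix a u v assume "a \<in> carrier K" "u \<in> carrier H" "v \<in> carrier H"
  then show "a \<cdot> (u \<uplus> v) = a \<cdot> u \<uplus> a \<cdot> v"
    by (auto elim!: H_carrierE simp: H_smult H_add r_distr smult_r_distr)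
next
  fix u assume "u \<in> carrier H"
  then show "\<one> \<cdot> u = u" by (auto elim!: H_carrierE simp: H_smult)
qed

sublocale HM: module K H by (rule module_H)

text \<open>Positivity in the ordering and the rescaling to unit vectors both rest on norms being
  squares; for the added coordinate this is the Pythagorean property.\<close>

lemma formH_square: assumes "u \<in> carrier H" shows "\<exists>s\<in>carrier K. formH u u = s \<otimes> s"
proof -
  obtain a x where *: "a \<in> carrier K" "x \<in> carrier V" "u = \<iota> (a, x)"
    using assms by (rule H_carrierE)
  moreover obtain t where "t \<in> carrier K" "form x x = t \<otimes> t" using form_square * by blast
  ultimately show ?thesis using sum_of_squares[of a t] by (simp add: formH)
qed

text \<open>Otherwise \<open>a / b\<close> would be a square root of \<open>-1\<close>.\<close>

lemma sum_of_squares_zero: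
  assumes ab: "a \<in> carrier K" "b \<in> carrier K" and z: "a \<otimes> a \<oplus> b \<otimes> b = \<zero>"
  shows "b = \<zero>"
proof (rule ccontr)
  assume "b \<noteq> \<zero>"
  note ib = nonzero_inverse[OF ab(2) this]
  have "\<ominus> \<one> = (a \<otimes> inv b) \<otimes> (a \<otimes> inv b)"
  proof -
    have "(a \<otimes> inv b) \<otimes> (a \<otimes> inv b) \<oplus> (b \<otimes> inv b) \<otimes> (b \<otimes> inv b)
      = (a \<otimes> a \<oplus> b \<otimes> b) \<otimes> (inv b \<otimes> inv b)" using ab ib(1) by algebra
    then have "(a \<otimes> inv b) \<otimes> (a \<otimes> inv b) \<oplus> \<one> = \<zero>" using ib z by simp
    then show ?thesis using R.minus_equality[of "(a \<otimes> inv b) \<otimes> (a \<otimes> inv b)" \<one>] ab ib by simp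
  qed
  then show False using minus_one_no_square[of "a \<otimes> inv b"] ab ib by simp
qed

lemma formH_anisotropic: assumes u: "u \<in> carrier H" and z: "formH u u = \<zero>" shows "u = \<zero>\<^bsub>H\<^esub>"
proof -
  obtain a x where *: "a \<in> carrier K" "x \<in> carrier V" "u = \<iota> (a, x)" using u by (rule H_carrierE)
  obtain t where t: "t \<in> carrier K" "form x x = t \<otimes> t" using form_square * by blast
  have e: "a \<otimes> a \<oplus> t \<otimes> t = \<zero>" using z * t by (simp add: formH)
  then have "t = \<zero>" using sum_of_squares_zero * t by blast
  moreover have "a = \<zero>" using sum_of_squares_zero[of t a] e * t R.a_comm[of "a \<otimes> a" "t \<otimes> t"] by simp
  ultimately show ?thesis using form_anisotropic * t by (simp add: H_zero)
qed

lemma one_plus_one: "\<one> \<oplus> \<one> \<noteq> \<zero>"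
  using sum_of_squares_zero[of \<one> \<one>] by auto

lemma formH_sym: "\<lbrakk>u \<in> carrier H; v \<in> carrier H\<rbrakk> \<Longrightarrow> formH u v = formH v u"
  by (auto elim!: H_carrierE simp: formH form_closed m_comm form_sym)

lemma formH_add: "\<lbrakk>u \<in> carrier H; v \<in> carrier H; w \<in> carrier H\<rbrakk> \<Longrightarrow>
    formH u (v \<uplus> w) = formH u v \<oplus> formH u w"
  by (auto elim!: H_carrierE simp: formH H_add form_closed form_add r_distr R.a_ac)

lemma formH_smult: "\<lbrakk>a \<in> carrier K; u \<in> carrier H; v \<in> carrier H\<rbrakk> \<Longrightarrow>
    formH u (a \<cdot> v) = a \<otimes> formH u v"
  by (auto elim!: H_carrierE simp: formH H_smult form_closed form_smult r_distr m_ac)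

lemma quadratic_space_H: "quadratic_space K H formH"
proof
  fix u v assume "u \<in> carrier H" "v \<in> carrier H"
  then show "formH u v \<in> carrier K" by (auto elim!: H_carrierE simp: formH form_closed)
next
  fix u v w assume "u \<in> carrier H" "v \<in> carrier H" "w \<in> carrier H"
  then show "formH (u \<uplus> v) w = formH u w \<oplus> formH v w"
    using formH_add[of w u v] formH_sym[of w] by simp
next
  fix a u v assume "a \<in> carrier K" "u \<in> carrier H" "v \<in> carrier H"
  then show "formH (a \<cdot> u) v = a \<otimes> formH u v"
    using formH_smult[of a v u] formH_sym[of v] by simp
qed (auto simp: one_plus_one formH_add formH_smult formH_anisotropic intro: formH_sym)

sublocale Q: quadratic_space K H formH by (rule quadratic_space_H)

lemma positive_definite_H:
  fixes le :: "'k \<Rightarrow> 'k \<Rightarrow> bool"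
  assumes "ordered_field K le" and sq: "\<And>a. a \<in> carrier K \<Longrightarrow> le \<zero> (a \<otimes> a)"
  shows "positive_definite_quadratic_space K le H formH"
proof -
  interpret ordered_field K le by fact
  show ?thesis
  proof
    fix u assume "u \<in> carrier H" "u \<noteq> \<zero>\<^bsub>H\<^esub>"
    then show "le \<zero> (formH u u) \<and> formH u u \<noteq> \<zero>"
      using formH_square[of u] formH_anisotropic[of u] sq by metis
  qed
qed

lemma unit_vector_H: "unit_vector_in_each_line K H formH"
  unfolding unit_vector_in_each_line_def proj_points_def
proof
  fix S assume "S \<in> line_span K H ` (carrier H - {\<zero>\<^bsub>H\<^esub>})"
  then obtain u where u: "u \<in> carrier H" "u \<noteq> \<zero>\<^bsub>H\<^esub>" "S = line_span K H u" by blast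
  obtain s where s: "s \<in> carrier K" "formH u u = s \<otimes> s" using formH_square u by blast
  have "s \<noteq> \<zero>" using formH_anisotropic u s by auto
  note inv_s = nonzero_inverse[OF s(1) this]
  have "formH (inv s \<cdot> u) (inv s \<cdot> u) = inv s \<otimes> (inv s \<otimes> (s \<otimes> s))"
    using Q.form_smult_left[of "inv s" u "inv s \<cdot> u"] Q.form_smult_right[of "inv s" u u] inv_s u s
      by simp
  also have "\<dots> = (s \<otimes> inv s) \<otimes> (s \<otimes> inv s)" using s inv_s(1) by algebra
  finally have "formH (inv s \<cdot> u) (inv s \<cdot> u) = \<one>" using inv_s by simp
  then show "\<exists>v\<in>S. formH v v = \<one>" using u inv_s by (auto simp: line_span_def)
qed

lemma line_span_self: "u \<in> carrier H \<Longrightarrow> u \<in> line_span K H u"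
  by (force simp: line_span_def)

lemma line_span_eqD:
  assumes "u \<in> carrier H" "v \<in> carrier H" "line_span K H u = line_span K H v"
  obtains a where "a \<in> carrier K" "u = a \<cdot> v"
  using line_span_self[OF assms(1)] assms(3) by (auto simp: line_span_def)

lemma line_span_smult:
  assumes a: "a \<in> carrier K" "a \<noteq> \<zero>" and u: "u \<in> carrier H"
  shows "line_span K H (a \<cdot> u) = line_span K H u"
proof
  show "line_span K H (a \<cdot> u) \<subseteq> line_span K H u"
  proof
    fix v assume "v \<in> line_span K H (a \<cdot> u)"
    then obtain b where b: "b \<in> carrier K" "v = b \<cdot> (a \<cdot> u)" by (auto simp: line_span_def)
    then have "v = (b \<otimes> a) \<cdot> u" using HM.smult_assoc1[of b a u] a u by simp
    moreover have "b \<otimes> a \<in> carrier K" using a b by simp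
    ultimately show "v \<in> line_span K H u" unfolding line_span_def by blast
  qed
  note ia = nonzero_inverse[OF a]
  show "line_span K H u \<subseteq> line_span K H (a \<cdot> u)"
  proof
    fix v assume "v \<in> line_span K H u"
    then obtain b where b: "b \<in> carrier K" "v = b \<cdot> u" by (auto simp: line_span_def)
    have "(b \<otimes> inv a) \<cdot> (a \<cdot> u) = (b \<otimes> (a \<otimes> inv a)) \<cdot> u"
      using HM.smult_assoc1[of "b \<otimes> inv a" a u] a b u ia m_assoc m_comm[of a "inv a"] by simp
    then have "v = (b \<otimes> inv a) \<cdot> (a \<cdot> u)" using b ia by simp
    moreover have "b \<otimes> inv a \<in> carrier K" using b ia by simp
    ultimately show "v \<in> line_span K H (a \<cdot> u)" unfolding line_span_def by blast
  qed
qed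

lemma proj_perp_iff:
  assumes u: "u \<in> carrier H" "u \<noteq> \<zero>\<^bsub>H\<^esub>" and v: "v \<in> carrier H" "v \<noteq> \<zero>\<^bsub>H\<^esub>"
  shows "proj_perp K H formH (line_span K H u) (line_span K H v) \<longleftrightarrow> formH u v = \<zero>"
proof
  assume "formH u v = \<zero>"
  then show "proj_perp K H formH (line_span K H u) (line_span K H v)"
    using u v unfolding proj_perp_def by blast
next
  assume "proj_perp K H formH (line_span K H u) (line_span K H v)"
  then obtain u' v' where *: "u' \<in> carrier H" "v' \<in> carrier H" "line_span K H u = line_span K H u'"
    "line_span K H v = line_span K H v'" "formH u' v' = \<zero>"
    unfolding proj_perp_def by blast
  obtain a where a: "a \<in> carrier K" "u = a \<cdot> u'" using line_span_eqD[OF u(1) *(1,3)] .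
  obtain b where b: "b \<in> carrier K" "v = b \<cdot> v'" using line_span_eqD[OF v(1) *(2,4)] .
  show "formH u v = \<zero>"
    using Q.form_smult_left[of a u' v] Q.form_smult_right[of b u' v'] a b * by simp
qed

end

section \<open>Unit vectors\<close>

context rotation_orthoset
begin

lemma form_addR: "\<lbrakk>x \<in> A; y \<in> A; z \<in> A\<rbrakk> \<Longrightarrow> form x (y \<uplus> z) = form x y \<uplus> form x z"
  using S.form_add[of x y z] by simp

lemma form_smultR: "\<lbrakk>a \<in> U; x \<in> A; y \<in> A\<rbrakk> \<Longrightarrow> form x (a \<cdot> y) = a \<cdot> form x y"
  using S.form_smult[of a x y] by simp

text \<open>Since \<open>d\<close> differs from \<open>dr u\<close>, the coefficient of
  \<open>v\<close> in a decomposition is nonzero and can be scaled to one.\<close>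

lemma direction_combination:
  assumes u: "u \<in> A" "u \<noteq> e" and v: "v \<in> A" "v \<noteq> e" and uv: "dr u \<noteq> dr v"
    and d: "d \<in> cl {dr u, dr v}" "d \<noteq> dr u"
  obtains a where "a \<in> U" "a \<cdot> u \<uplus> v \<in> A" "a \<cdot> u \<uplus> v \<noteq> e" "dr (a \<cdot> u \<uplus> v) = d"
proof -
  have "d \<in> M" using cl_M[of "{dr u, dr v}" d] dr u v d by blast
  then obtain x where x: "x \<in> A" "x \<noteq> e" "dr x = d" by (rule direction_vector)
  then obtain \<alpha> \<beta> where ab: "\<alpha> \<in> U" "\<beta> \<in> U" "x = \<alpha> \<cdot> u \<uplus> \<beta> \<cdot> v"
    using direction_sum[OF u v uv, of x] d by metis
  have au: "\<alpha> \<cdot> u \<in> A" "\<beta> \<cdot> v \<in> A" using ab u v sc_closed by auto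
  have "\<beta> \<noteq> e"
  proof
    assume "\<beta> = e"
    then have xu: "x = \<alpha> \<cdot> u" using ab v sc_zero vadd_zero_right au by simp
    moreover have "\<alpha> \<noteq> e" using xu x u sc_zero by auto
    ultimately have "dr x = dr u" using dr_smult ab u by simp
    then show False using x d by simp
  qed
  then obtain \<gamma> where g: "\<gamma> \<in> U" "\<gamma> \<cdot> \<beta> = i" using K_inverse ab by blast
  have gn: "\<gamma> \<noteq> e" using g sc_zero U_P ab unit by auto
  have "\<gamma> \<cdot> x = \<gamma> \<cdot> (\<alpha> \<cdot> u) \<uplus> \<gamma> \<cdot> (\<beta> \<cdot> v)" using sc_add_right[OF g(1) au] ab by simp
  also have "\<dots> = (\<gamma> \<cdot> \<alpha>) \<cdot> u \<uplus> v"
    using sc_assoc[OF g(1) ab(1) u(1)] sc_assoc[OF g(1) ab(2) v(1)] g sc_one v by simp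
  finally have "\<gamma> \<cdot> x = (\<gamma> \<cdot> \<alpha>) \<cdot> u \<uplus> v" .
  then show ?thesis
    using that[of "\<gamma> \<cdot> \<alpha>"] sc_U g ab dr_smult[OF g(1) gn x(1,2)] sc_nonzero[OF g(1) gn x(1,2)]
      sc_closed[OF g(1) x(1)] x by simp
qed

lemma form_zeroI: "\<lbrakk>a \<in> A; b \<in> A; perp (dr a) (dr b)\<rbrakk> \<Longrightarrow> form a b = e"
  using form_zero_iff[of a b] form_zero_left form_zero_right perp_sym[of "dr a" "dr b"] dr_X
    by metis

lemma form_zeroD: "\<lbrakk>a \<in> A; b \<in> A; a \<noteq> e; b \<noteq> e; form a b = e\<rbrakk> \<Longrightarrow> perp (dr a) (dr b)"
  using form_zero_iff[of a b] perp_sym[of "dr b" "dr a"] dr_X by blast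

lemma K_cancelR: "\<lbrakk>a \<in> U; b \<in> U; n \<in> U; n \<noteq> e; a \<cdot> n = b \<cdot> n\<rbrakk> \<Longrightarrow> a = b"
  using S.K_cancel_right[of n a b] by simp

text \<open>A rotation \<open>J\<close> in \<open>R e m\<close> with \<open>J e = m\<close> acts on the points \<open>v\<close> of \<open>A\<close> whose direction is
  orthogonal to \<open>m\<close>
    by \<open>J v = dr (c b \<uplus> v)\<close>, where \<open>dr b = m\<close> and the scalar \<open>c\<close> does not depend on \<open>v\<close>.
  Applied to an orthogonal pair of points this gives \<open>form (c b) (c b) = 1\<close>.\<close>

lemma unit_vector_in_direction:
  assumes m: "m \<in> M"
  obtains b where "b \<in> A" "b \<noteq> e" "dr b = m" "form b b = i"
proof -
  have mX: "m \<in> X" "perp m e" using m by (auto simp: M_def)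
  have em: "e \<noteq> m" using mX perp_irrefl by auto
  obtain b where b: "b \<in> A" "b \<noteq> e" "dr b = m" using direction_vector[OF m] .
  obtain J where J: "J \<in> R e m" "J e = m"
    using R_transitive[OF base mX(1) em, of m] em mX by (auto simp: cl_incl)
  have aut: "orthoset_aut X perp J" using R_aut[OF base mX(1) em J(1)] .
  have Jfix: "J x = x" if "x \<in> M" "perp x m" for x
    using R_fix[OF base mX(1) em J(1)] that by (auto simp: M_def)
  \<comment> \<open>\<open>J\<close> fixes \<open>dr v\<close> and sends \<open>e\<close> to
    \<open>m\<close>, so it takes the line \<open>e v\<close> to the line through
    \<open>m = dr b\<close> and \<open>dr v\<close>; hence \<open>J v\<close> is the direction of a
    combination of \<open>b\<close> and \<open>v\<close>.\<close>
  have coeff: "\<exists>c\<in>U. c \<cdot> b \<uplus> v \<in> A \<and> c \<cdot> b \<uplus> v \<noteq> e \<and> dr (c \<cdot> b \<uplus> v) = J v"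
    if v: "v \<in> A" "v \<noteq> e" "perp (dr v) m" for v
  proof -
    have "J v \<in> cl {m, dr v}"
      using aut_line[OF aut base dr_X[OF v(1,2)] in_dr_line[OF v(1,2)]] Jfix[of "dr v"] J v dr
        by simp
    moreover have "J v \<noteq> m" using aut_inj[OF aut, of v e] v J base A_X by auto
    moreover have "dr b \<noteq> dr v" using v b perp_irrefl mX by auto
    ultimately show ?thesis using direction_combination[OF b(1,2) v(1,2), of "J v"] b by metis
  qed
  have nb: "form b b \<in> U" "form b b \<noteq> e" using form_closed b S.form_anisotropic[of b] by auto
  \<comment> \<open>The point \<open>y \<uplus> z\<close> is on the line \<open>y (dr z)\<close>,
    whose image is the line through \<open>J y\<close> and \<open>dr z\<close>. So
    \<open>c' b + y + z\<close> is a combination of \<open>c b + y\<close> and \<open>z\<close>;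
    pairing with \<open>y\<close> shows that the first coefficient is one, and pairing with
    \<open>b\<close> gives \<open>c' = c\<close>.\<close>
  have const: "c = c'"
    if y: "y \<in> A" "y \<noteq> e" "perp (dr y) m" and z: "z \<in> A" "z \<noteq> e" "perp (dr z) m" and yz: "perp (dr y) (dr z)"
      and c: "c \<in> U" "c \<cdot> b \<uplus> y \<in> A" "c \<cdot> b \<uplus> y \<noteq> e" "dr (c \<cdot> b \<uplus> y) = J y"
      and c': "c' \<in> U" "c' \<cdot> b \<uplus> (y \<uplus> z) \<in> A" "c' \<cdot> b \<uplus> (y \<uplus> z) \<noteq> e" "dr (c' \<cdot> b \<uplus> (y \<uplus> z)) = J (y \<uplus> z)"
    for y z c c'
  proof -
    let ?u = "c \<cdot> b \<uplus> y" and ?x = "c' \<cdot> b \<uplus> (y \<uplus> z)"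
    have sA: "y \<uplus> z \<in> A" "c \<cdot> b \<in> A" "c' \<cdot> b \<in> A" using y z c c' b vadd_closed sc_closed by auto
    have zM: "dr z \<in> M" "dr z \<in> X" using dr z dr_X by auto
    have "y \<in> cl {z \<uplus> y, dr z}" using par_vadd[of "dr z" z y] par_dr z y zM by simp
    then have "y \<uplus> z \<in> cl {y, dr z}"
      using parallel_line_eq[of y "y \<uplus> z" "dr z"] sA zM y z A_X vadd_comm[of y z]
        by (simp add: cl_incl)
    then have "J (y \<uplus> z) \<in> cl {J y, J (dr z)}" using aut_line[OF aut] y zM A_X by blast
    then have dx: "dr ?x \<in> cl {dr ?u, dr z}" using Jfix[of "dr z"] z zM c c' by simp
    have f: "form b y = e" "form b z = e" "form y b = e" "form y z = e" "form z b = e" "form z y = e"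
      using form_zeroI b y z yz perp_sym dr_X by auto
    have "form z ?u = c \<cdot> e \<uplus> e" using form_addR form_smultR sA b y z c f by simp
    then have "form z ?u = e" using sc(2)[OF c(1)] vadd_zero_right base_A by simp
    then have "perp (dr z) (dr ?u)" using form_zeroD z c by blast
    then have ne: "dr ?u \<noteq> dr z" using perp_irrefl zM by auto
    obtain \<alpha> \<beta> where ab: "\<alpha> \<in> U" "\<beta> \<in> U" "?x = \<alpha> \<cdot> ?u \<uplus> \<beta> \<cdot> z"
      using direction_sum[OF c(2,3) z(1,2) ne c'(2,3) dx] .
    have ny: "form y y \<in> U" "form y y \<noteq> e" "form y y \<in> A" "form b b \<in> A"
      using form_closed y S.form_anisotropic[of y] U_P nb by auto
    have fx: "form w ?x = \<alpha> \<cdot> form w ?u \<uplus> \<beta> \<cdot> form w z" if "w \<in> A" for w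
      using ab form_addR[OF that, of "\<alpha> \<cdot> ?u" "\<beta> \<cdot> z"] form_smultR that c z sc_closed by simp
    have z': "\<And>a. a \<in> U \<Longrightarrow> a \<cdot> e = e" using sc(2) by blast
    have "form y ?x = form y y" "form y ?u = form y y"
      using form_addR form_smultR sA b y z c c' f z' ny vadd_zero_right vadd_zero_left by simp_all
    then have "form y y = \<alpha> \<cdot> form y y"
      using fx[OF y(1)] f z' ab ny vadd_zero_right sc_closed by simp
    then have "i \<cdot> form y y = \<alpha> \<cdot> form y y" using sc_one ny by simp
    then have a1: "\<alpha> = i" using K_cancelR[of i \<alpha> "form y y"] ny ab i0_U by simp
    have "form b ?x = c' \<cdot> form b b" "form b ?u = c \<cdot> form b b"
      using form_addR form_smultR sA b y z c c' f ny vadd_zero_right sc_closed base_A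
      by simp_all
    then have "c' \<cdot> form b b = c \<cdot> form b b"
      using fx[OF b(1)] f z' ab ny vadd_zero_right sc_closed c a1 sc_one by simp
    then show ?thesis using K_cancelR[of c' c "form b b"] nb c c' by simp
  qed
  obtain g where g: "g \<in> X" "perp g e" "perp g m" using rank_ge_4[OF base mX(1) mX(1)] by blast
  obtain h where h: "h \<in> X" "perp h e" "perp h m" "perp h g"
    using rank_ge_4[OF base mX(1) g(1)] by blast
  have gh: "g \<in> M" "h \<in> M" using g h by (auto simp: M_def)
  obtain y where y: "y \<in> A" "y \<noteq> e" "dr y = g" using direction_vector[OF gh(1)] .
  obtain z where z: "z \<in> A" "z \<noteq> e" "dr z = h" using direction_vector[OF gh(2)] .
  \<comment> \<open>As points \<open>z\<close> and \<open>wp z\<close> are orthogonal, although they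
    have the same direction as vectors, so one scalar \<open>c\<close> serves for both.
    Orthogonality of their images reads \<open>form (c b) (c b) + form z (wp z) = 0\<close>, where
    the last value is \<open>-1\<close>.\<close>
  let ?w = "wp z"
  have w: "?w \<in> A" "?w \<noteq> e" "dr ?w = h" "perp ?w z" using wp[OF z(1,2)] z by auto
  obtain c where c: "c \<in> U" "c \<cdot> b \<uplus> y \<in> A" "c \<cdot> b \<uplus> y \<noteq> e" "dr (c \<cdot> b \<uplus> y) = J y"
    using coeff[of y] y g by blast
  \<comment> \<open>The scalars of \<open>y\<close> and of \<open>v\<close> both agree with that of
    \<open>y \<uplus> v\<close>, so one \<open>c\<close> works for every \<open>v\<close> in
    direction \<open>h\<close>.\<close>
  have same: "c \<cdot> b \<uplus> v \<in> A \<and> c \<cdot> b \<uplus> v \<noteq> e \<and> dr (c \<cdot> b \<uplus> v) = J v"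
    if v: "v \<in> A" "v \<noteq> e" "dr v = h" for v
  proof -
    have sA: "y \<uplus> v \<in> A" using y v vadd_closed by blast
    have f: "form b y = e" "form b v = e" "form y v = e"
      using form_zeroI b y v g h perp_sym mX by auto
    have "form y (y \<uplus> v) = form y y"
      using form_addR[of y y v] f y v vadd_zero_right U_P[OF form_closed[of y y]] by simp
    then have sn: "y \<uplus> v \<noteq> e" using S.form_anisotropic[of y] y form_zero_right[of y] by auto
    have "form b (y \<uplus> v) = e" using form_addR[of b y v] f b y v vadd_zero_right base_A by simp
    then have "perp (dr b) (dr (y \<uplus> v))" using form_zeroD b sA sn by blast
    then have sm: "perp (dr (y \<uplus> v)) m" using b perp_sym dr_X sA sn by blast
    obtain c' where c': "c' \<in> U" "c' \<cdot> b \<uplus> (y \<uplus> v) \<in> A" "c' \<cdot> b \<uplus> (y \<uplus> v) \<noteq> e"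
      "dr (c' \<cdot> b \<uplus> (y \<uplus> v)) = J (y \<uplus> v)" using coeff[OF sA sn sm] by blast
    obtain d where d: "d \<in> U" "d \<cdot> b \<uplus> v \<in> A" "d \<cdot> b \<uplus> v \<noteq> e" "dr (d \<cdot> b \<uplus> v) = J v"
      using coeff[of v] v h by blast
    have pg: "perp g h" using h g perp_sym by blast
    have "c = c'" by (rule const[of y v]) (use y v g h c c' pg in auto)
    moreover have "d = c'"
      by (rule const[of v y]) (use y v g h d c' pg vadd_comm[of y v] in auto)
    ultimately show ?thesis using d by simp
  qed
  let ?b = "c \<cdot> b"
  have bA: "?b \<in> A" using b c sc_closed by blast
  have "perp (J ?w) (J z)" using aut_perp[OF aut] w z A_X by blast
  then have "perp (dr (?b \<uplus> ?w)) (dr (?b \<uplus> z))" using same[OF w(1-3)] same[OF z] by simp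
  then have 0: "form (?b \<uplus> z) (?b \<uplus> ?w) = e"
    using form_zero_iff same[OF w(1-3)] same[OF z] by blast
  have f: "form b z = e" "form z b = e" "form b ?w = e" "form ?w b = e"
    using form_zeroI b z w h perp_sym mX by auto
  have z': "\<And>a. a \<in> U \<Longrightarrow> a \<cdot> e = e" using sc(2) by blast
  have f': "form ?b ?w = e" "form z ?b = e"
    using form_smult_left[of c b ?w] form_smultR[of c z b] f c b z w z' by auto
  have zw: "form z ?w = \<ominus>\<^bsub>K\<^esub> i" using form_minus_one_iff[of z ?w] z w by blast
  have U: "form ?b ?b \<in> U" "form z ?w \<in> U" using form_closed bA z w by auto
  have "form (?b \<uplus> z) (?b \<uplus> ?w) = (form ?b ?b \<uplus> form ?b ?w) \<uplus> (form z ?b \<uplus> form z ?w)"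
    using form_add_left[of ?b z "?b \<uplus> ?w"] form_addR bA z w vadd_closed by simp
  also have "\<dots> = form ?b ?b \<uplus> form z ?w" using f' U U_P vadd_zero_left vadd_zero_right by simp
  finally have "form ?b ?b \<ominus>\<^bsub>K\<^esub> i = \<zero>\<^bsub>K\<^esub>" using 0 zw by (simp add: a_minus_def)
  then have one: "form ?b ?b = i" using S.K_diff_eq_zero[of "form ?b ?b" i] U i0_U by simp
  have bn: "?b \<noteq> e" using one form_zero_left[of e] unit by auto
  have "c \<noteq> e" using bn sc_zero b by auto
  then have "dr ?b = m" using dr_smult c b by simp
  then show ?thesis using that bA bn one by blast
qed

lemma form_square: assumes x: "x \<in> A" shows "\<exists>s\<in>U. form x x = s \<cdot> s"
proof (cases "x = e")
  case True then show ?thesis using form_zero_left sc_zero base_A z0_U by metis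
next
  case False
  obtain b where b: "b \<in> A" "b \<noteq> e" "dr b = dr x" "form b b = i"
    using unit_vector_in_direction dr x False by metis
  then obtain s where s: "s \<in> U" "x = s \<cdot> b" using dr_eq_multiple[of b x] x False by metis
  then have "form x x = s \<cdot> (s \<cdot> i)"
    using form_smult_left[of s b x] form_smultR[of s b b] b x by simp
  then show ?thesis using s sc(3) by auto
qed

lemma orthonormal_pair:
  obtains b c where "b \<in> A" "c \<in> A" "form b b = i" "form c c = i" "form b c = e" "form c b = e"
proof -
  obtain m where m: "m \<in> M" by (rule M_nonempty)
  have mX: "m \<in> X" using m M_X by blast
  obtain k where k: "k \<in> X" "perp k e" "perp k m" using rank_ge_4[OF base mX mX] by blast
  have kM: "k \<in> M" using k by (simp add: M_def)
  obtain b where b: "b \<in> A" "b \<noteq> e" "dr b = m" "form b b = i" using unit_vector_in_direction[OF m] .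
  obtain c where c: "c \<in> A" "c \<noteq> e" "dr c = k" "form c c = i"
    using unit_vector_in_direction[OF kM] .
  have "form c b = e" using form_zeroI b c k by blast
  moreover have "form b c = e" using form_zeroI b c k perp_sym mX by blast
  ultimately show ?thesis using that b c by blast
qed

text \<open>For an orthonormal pair \<open>b\<close>, \<open>c\<close> the norm of
  \<open>s b + t c\<close> is \<open>s^2 + t^2\<close>, which is a square because all norms are. If
  \<open>s^2 = -1\<close>, the vector \<open>s b + c\<close> would be isotropic.\<close>

sublocale F: formally_real_pythagorean K
proof
  obtain b c where bc: "b \<in> A" "c \<in> A" "form b b = i" "form c c = i" "form b c = e" "form c b = e"
    by (rule orthonormal_pair)
  have z': "\<And>a. a \<in> U \<Longrightarrow> a \<cdot> e = e" using sc(2) by blast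
  have form_comb: "form (s \<cdot> b \<uplus> t \<cdot> c) (s \<cdot> b \<uplus> t \<cdot> c) = s \<cdot> s \<uplus> t \<cdot> t" if st: "s \<in> U" "t \<in> U" for s t
  proof -
    have A: "s \<cdot> b \<in> A" "t \<cdot> c \<in> A" "s \<cdot> b \<uplus> t \<cdot> c \<in> A" using st bc sc_closed vadd_closed by auto
    have "form b (s \<cdot> b \<uplus> t \<cdot> c) = s" "form c (s \<cdot> b \<uplus> t \<cdot> c) = t"
      using form_addR form_smultR A bc st z' sc(3) vadd_zero_right vadd_zero_left U_P by simp_all
    then show ?thesis using form_add_left[of "s \<cdot> b" "t \<cdot> c"] form_smult_left st bc A by simp
  qed
  show "\<exists>r\<in>carrier K. s \<otimes>\<^bsub>K\<^esub> s \<oplus>\<^bsub>K\<^esub> t \<otimes>\<^bsub>K\<^esub> t = r \<otimes>\<^bsub>K\<^esub> r" if st: "s \<in> carrier K" "t \<in> carrier K" for s t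
    using form_square[of "s \<cdot> b \<uplus> t \<cdot> c"] form_comb[of s t] st bc sc_closed vadd_closed by simp
  show "s \<otimes>\<^bsub>K\<^esub> s \<noteq> \<ominus>\<^bsub>K\<^esub> \<one>\<^bsub>K\<^esub>" if s: "s \<in> carrier K" for s
  proof
    assume "s \<otimes>\<^bsub>K\<^esub> s = \<ominus>\<^bsub>K\<^esub> \<one>\<^bsub>K\<^esub>"
    then have "s \<cdot> s \<uplus> i \<cdot> i = e" using S.K.l_neg[of i] i0_U sc_one U_P by simp
    then have "form (s \<cdot> b \<uplus> i \<cdot> c) (s \<cdot> b \<uplus> i \<cdot> c) = e" using form_comb[of s i] s i0_U by simp
    then have "s \<cdot> b \<uplus> i \<cdot> c = e"
      using S.form_anisotropic[of "s \<cdot> b \<uplus> i \<cdot> c"] s bc i0_U sc_closed vadd_closed by simp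
    then have "form c (s \<cdot> b \<uplus> c) = e" using form_zero_right bc sc_one by simp
    moreover have "form c (s \<cdot> b \<uplus> c) = i"
      using form_addR[of c "s \<cdot> b" c] form_smultR[of s c b] s bc sc_closed z' vadd_zero_left U_P
        i0_U by simp
    ultimately show False using unit by simp
  qed
qed

lemma extended_form_space:
  assumes "inj_on \<iota> (U \<times> A)"
  shows "extended_form_space K V form \<iota>"
  by unfold_locales
    (use assms form_closed S.form_symmetric form_addR form_smultR S.form_anisotropic form_square in auto)

end

section \<open>The representation\<close>

context rotation_orthoset
begin

definition vec :: "'a \<Rightarrow> 'a" where "vec m = (SOME x. x \<in> A \<and> x \<noteq> e \<and> dr x = m)"

lemma vec: assumes "m \<in> M" shows "vec m \<in> A" "vec m \<noteq> e" "dr (vec m) = m"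
proof -
  have "\<exists>x. x \<in> A \<and> x \<noteq> e \<and> dr x = m" using direction_vector[OF assms] by blast
  from someI_ex[OF this] show "vec m \<in> A" "vec m \<noteq> e" "dr (vec m) = m" by (auto simp: vec_def)
qed

lemma not_A_M: "x \<in> X \<Longrightarrow> x \<notin> A \<Longrightarrow> x \<in> M"
  by (auto simp: A_def)

text \<open>Homogeneous coordinates: an affine point \<open>x\<close> becomes \<open>(1, x)\<close>,
  a point at infinity becomes \<open>(0, v)\<close> for a vector \<open>v\<close> in its direction.
  Orthogonality is checked separately for affine and infinite points, and here the normalisation of
  \<open>form\<close> to \<open>-1\<close> on polars is used.\<close>

lemma representation:
  assumes inj: "inj_on \<iota> (U \<times> A)"
  shows "orthoset_isomorphic X perp
    (proj_points K (extended_form_space.H K V \<iota>))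
    (proj_perp K (extended_form_space.H K V \<iota>) (extended_form_space.formH K V form \<iota>))"
proof -
  interpret E: extended_form_space K V form \<iota> by (rule extended_form_space[OF inj])
  define hv where "hv x = (if x \<in> A then \<iota> (i, x) else \<iota> (e, vec x))" for x
  let ?f = "\<lambda>x. line_span K E.H (hv x)"
  have hvA: "hv x = \<iota> (i, x)" if "x \<in> A" for x using that by (simp add: hv_def)
  have hvM: "hv x = \<iota> (e, vec x)" if "x \<in> M" for x using that A_M by (auto simp: hv_def)
  have H0: "\<zero>\<^bsub>E.H\<^esub> = \<iota> (e, e)" using E.H_zero by simp
  have hv: "hv x \<in> carrier E.H" "hv x \<noteq> \<zero>\<^bsub>E.H\<^esub>" if "x \<in> X" for x
    using that E.H_carrier E.\<iota>_eq vec not_A_M H0 i0_U z0_U base_A unit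
    by (cases "x \<in> A"; auto simp: hv_def)+
  have fH: "E.formH (\<iota> (a, x)) (\<iota> (b, y)) = a \<cdot> b \<uplus> form x y" if "a \<in> U" "b \<in> U" "x \<in> A" "y \<in> A" for a b x y
    using E.formH that by simp
  have AA: "i \<uplus> form x y = e \<longleftrightarrow> perp x y" if xy: "x \<in> A" "y \<in> A" for x y
  proof -
    have U: "form x y \<in> U" using form_closed xy by blast
    have "i \<uplus> form x y = e \<longleftrightarrow> form x y = \<ominus>\<^bsub>K\<^esub> i"
      using S.K.minus_equality[of "form x y" i] S.K.r_neg[of i] U i0_U vadd_comm U_P by auto
    moreover have "form x y = \<ominus>\<^bsub>K\<^esub> i \<longleftrightarrow> perp y x"
    proof (cases "x = e")
      case True
      have "\<not> perp y e" using xy A_X A_M by (auto simp: M_def)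
      then show ?thesis using True form_zero_left minus_i by auto
    next
      case False then show ?thesis using form_minus_one_iff xy by blast
    qed
    moreover have "perp y x \<longleftrightarrow> perp x y" using perp_comm xy A_X by blast
    ultimately show ?thesis by blast
  qed
  have AM: "form x (vec m) = e \<longleftrightarrow> perp m x" if x: "x \<in> A" and m: "m \<in> M" for x m
  proof (cases "x = e")
    case True then show ?thesis using m form_zero_left by (simp add: M_def)
  next
    case False
    have mX: "m \<in> X" "perp m e" using m by (auto simp: M_def)
    have "form x (vec m) = e \<longleftrightarrow> perp m (dr x)"
      using form_zero_iff[of x "vec m"] vec[OF m] x False by simp
    also have "\<dots> \<longleftrightarrow> perp m x"
      using perp_cl[of m "{e, x}" "dr x"] perp_cl[of m "{e, dr x}" x] mX dr[OF x False]
        in_dr_line[OF x False] by blast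
    finally show ?thesis .
  qed
  have perp_form: "perp x y \<longleftrightarrow> E.formH (hv x) (hv y) = e" if xy: "x \<in> X" "y \<in> X" for x y
  proof -
    have z: "i \<cdot> e = e" "e \<cdot> i = e" "i \<cdot> i = i" "e \<cdot> e = e"
      using sc_zero sc_one unit base_A by auto
    have add0: "e \<uplus> form a b = form a b" if "a \<in> A" "b \<in> A" for a b
      using vadd_zero_left U_P[OF form_closed] that by simp
    consider "x \<in> A" "y \<in> A" | "x \<in> A" "y \<in> M" | "x \<in> M" "y \<in> A" | "x \<in> M" "y \<in> M"
      using xy not_A_M by blast
    then show ?thesis
    proof cases
      case 1 then show ?thesis using AA hvA fH i0_U z by simp
    next
      case 2
      then show ?thesis using AM[of x y] hvA hvM fH i0_U z0_U z add0 vec perp_comm[OF xy] by simp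
    next
      case 3
      then show ?thesis
        using AM[of y x] hvA hvM fH i0_U z0_U z add0 vec S.form_symmetric[of "vec x" y] by simp
    next
      case 4
      then show ?thesis
        using form_zero_iff[of "vec x" "vec y"] hvM fH z0_U z add0 vec perp_comm[OF xy] by simp
    qed
  qed
  have pp: "perp x y \<longleftrightarrow> proj_perp K E.H E.formH (?f x) (?f y)" if "x \<in> X" "y \<in> X" for x y
    using E.proj_perp_iff[of "hv x" "hv y"] hv that perp_form by simp
  have "inj_on ?f X"
  proof (rule inj_onI)
    fix x y assume xy: "x \<in> X" "y \<in> X" "?f x = ?f y"
    \<comment> \<open>Points with the same image have the same polar, and singletons are
      closed.\<close>
    then have "perp z x \<longleftrightarrow> perp z y" if "z \<in> X" for z using pp that by simp
    then have "x \<in> cl {y}" using xy by (auto simp: cl_def)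
    then show "x = y" using cl_single xy by blast
  qed
  moreover have "?f ` X = proj_points K E.H"
  proof
    show "?f ` X \<subseteq> proj_points K E.H" using hv by (auto simp: proj_points_def)
    show "proj_points K E.H \<subseteq> ?f ` X"
    proof
      fix S assume "S \<in> proj_points K E.H"
      then obtain u where u: "u \<in> carrier E.H" "u \<noteq> \<zero>\<^bsub>E.H\<^esub>" "S = line_span K E.H u"
        by (auto simp: proj_points_def)
      obtain a x where ax: "a \<in> U" "x \<in> A" "u = \<iota> (a, x)" using E.H_carrierE[OF u(1)] by auto
      show "S \<in> ?f ` X"
      proof (cases "a = e")
        case False
        \<comment> \<open>Scaling by the inverse of the first coordinate brings the vector into the
          form \<open>(1, x)\<close>.\<close>
        obtain b where b: "b \<in> U" "b \<cdot> a = i" using K_inverse ax False by blast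
        have bn: "b \<noteq> e" using b sc_zero ax U_P unit by auto
        have "b \<odot>\<^bsub>E.H\<^esub> u = hv (b \<cdot> x)" using E.H_smult[of b a x] ax b hvA sc_closed by simp
        then have "?f (b \<cdot> x) = S" using E.line_span_smult[of b u] u b bn by simp
        then show ?thesis using sc_closed b ax A_X by blast
      next
        case True
        then have xn: "x \<noteq> e" using u ax H0 by auto
        have d: "dr x \<in> M" "dr x \<in> X" using dr ax xn M_X by auto
        obtain c where c: "c \<in> U" "c \<noteq> e" "x = c \<cdot> vec (dr x)"
          using dr_eq_multiple[of "vec (dr x)" x] vec[OF d(1)] ax xn by metis
        have "c \<odot>\<^bsub>E.H\<^esub> hv (dr x) = u"
          using E.H_smult[of c e "vec (dr x)"] ax True c hvM d vec sc(2) by simp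
        then have "?f (dr x) = S" using E.line_span_smult[of c "hv (dr x)"] u c hv d by simp
        then show ?thesis using d by blast
      qed
    qed
  qed
  ultimately have "orthoset_iso ?f X perp (proj_points K E.H) (proj_perp K E.H E.formH)"
    using pp by (simp add: orthoset_iso_def bij_betw_def)
  then show ?thesis unfolding orthoset_isomorphic_def by blast
qed

text \<open>The ordering comes before the space: it makes \<open>K\<close>, and with it
  \<open>A\<close>, infinite, and the resulting bijection of \<open>A x A\<close> with
  \<open>A\<close> supplies the coding \<iota>.\<close>

lemma quadratic_representation:
  "\<exists>(K :: 'a ring) (le :: 'a \<Rightarrow> 'a \<Rightarrow> bool) (H :: ('a, 'a) module) (form :: 'a \<Rightarrow> 'a \<Rightarrow> 'a).
     ordered_field K le \<and> positive_definite_quadratic_space K le H form \<and>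
     unit_vector_in_each_line K H form \<and>
     orthoset_isomorphic X perp (proj_points K H) (proj_perp K H form)"
proof -
  obtain le where le: "ordered_field K le" "\<And>a. a \<in> carrier K \<Longrightarrow> le \<zero>\<^bsub>K\<^esub> (a \<otimes>\<^bsub>K\<^esub> a)"
    using F.ordering_exists by blast
  have "infinite U" using ordered_field.infinite_carrier[OF le(1)] by simp
  moreover have "U \<subseteq> A" using U_P by blast
  ultimately have "infinite A" using infinite_super by blast
  then have "|A \<times> A| =o |A|" by (rule card_of_Times_same_infinite)
  then obtain \<iota> where "bij_betw \<iota> (A \<times> A) A" using card_of_ordIso by blast
  then have inj: "inj_on \<iota> (U \<times> A)"
    by (rule inj_on_subset[OF bij_betw_imp_inj_on]) (auto intro: U_P)
  interpret E: extended_form_space K V form \<iota> by (rule extended_form_space[OF inj])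
  show ?thesis
    using le(1) E.positive_definite_H[OF le] E.unit_vector_H representation[OF inj] by blast
qed

end

section \<open>From divisible transitivity to a linear orthoset with rotations\<close>

lemma divisible_part_cong:
  assumes "\<And>x. x \<in> X \<Longrightarrow> perp x p \<and> perp x q \<longleftrightarrow> perp x p' \<and> perp x q'"
  shows "divisible_part X perp p q = divisible_part X perp p' q'"
proof -
  have "fix_group X perp p q = fix_group X perp p' q'"
    using assms unfolding fix_group_def by blast
  then show ?thesis by (simp add: divisible_part_def)
qed

lemma aut_group_aut: "\<phi> \<in> carrier (orthoset_aut_group X perp) \<Longrightarrow> orthoset_aut X perp \<phi>"
  by (auto simp: orthoset_aut_group_def Bij_def orthoset_aut_def)

lemma aut_group_mult:
  assumes "\<phi> \<in> carrier (orthoset_aut_group X perp)" "\<psi> \<in> carrier (orthoset_aut_group X perp)" "x \<in> X"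
  shows "(\<phi> \<otimes>\<^bsub>orthoset_aut_group X perp\<^esub> \<psi>) x = \<phi> (\<psi> x)"
  using assms by (auto simp: orthoset_aut_group_def BijGroup_def compose_eq)

lemma divisible_part_group: "\<phi> \<in> divisible_part X perp p q \<Longrightarrow> \<phi> \<in> carrier (orthoset_aut_group X perp)"
  by (auto simp: divisible_part_def fix_group_def)

lemma divisible_part_fix:
  "\<lbrakk>\<phi> \<in> divisible_part X perp p q; x \<in> X; perp x p; perp x q\<rbrakk> \<Longrightarrow> \<phi> x = x"
  by (auto simp: divisible_part_def fix_group_def)

locale divisibly_transitive_orthoset = orthoset X perp for X :: "'a set" and perp +
  assumes DT: "divisibly_transitive X perp"
    and quadruple: "\<exists>B. B \<subseteq> X \<and> finite B \<and> card B = 4 \<and> pairwise perp B"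
begin

abbreviation "G \<equiv> orthoset_aut_group X perp"
abbreviation "R \<equiv> divisible_part X perp"

sublocale G: group G by (rule group_orthoset_aut_group)

lemma DT_D:
  assumes "p \<in> X" "q \<in> X" "p \<noteq> q" shows "DT0 X perp p q" "DT1 X perp p q" "DT2 X perp p q"
  using DT assms by (auto simp: divisibly_transitive_def)

text \<open>With \<tau> from (DT2), let \<open>g\<close> be the point that \<tau> takes to
  \<open>q'\<close>. Conjugating a rotation from \<open>p'\<close> to \<open>q'\<close> gives one in
  \<open>R p q\<close> from \<open>p\<close> to \<open>g\<close>. It fixes every \<open>x\<close>
  orthogonal to \<open>p\<close> and \<open>q\<close>, so \<open>x\<close> is orthogonal to
  \<open>g\<close>. Conversely, if \<open>x\<close> is orthogonal to \<open>p\<close> and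
  \<open>g\<close>, the rotations conjugate to \<open>R p' q'\<close> fix \<open>x\<close>, among
  them one taking \<open>p\<close> to \<open>q\<close>.\<close>

lemma partner_like:
  assumes ef: "p \<in> X" "q \<in> X" "p \<noteq> q" and ef': "p' \<in> X" "q' \<in> X" "p' \<noteq> q'"
  obtains g where "g \<in> X" "g \<noteq> p" "perp p g \<longleftrightarrow> perp p' q'"
    "\<And>x. \<lbrakk>x \<in> X; perp x p\<rbrakk> \<Longrightarrow> perp x q \<longleftrightarrow> perp x g"
proof -
  obtain \<tau> where t: "\<tau> \<in> carrier G" "\<tau> p = p'"
    and R: "R p q = (\<lambda>\<rho>. inv\<^bsub>G\<^esub> \<tau> \<otimes>\<^bsub>G\<^esub> \<rho> \<otimes>\<^bsub>G\<^esub> \<tau>) ` R p' q'"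
    using DT_D(3)[OF ef] ef' unfolding DT2_def by metis
  let ?t = "inv\<^bsub>G\<^esub> \<tau>"
  have ti: "?t \<in> carrier G" using t by simp
  have tauX: "\<tau> x \<in> X" "?t x \<in> X" if "x \<in> X" for x
    using aut_group_aut[OF t(1)] aut_group_aut[OF ti] that
      by (auto simp: orthoset_aut_def bij_betw_def)
  have oneG: "(\<one>\<^bsub>G\<^esub>) x = x" if "x \<in> X" for x
    using that by (simp add: orthoset_aut_group_def BijGroup_def)
  have t1: "?t (\<tau> x) = x" "\<tau> (?t x) = x" if "x \<in> X" for x
    using aut_group_mult[OF ti t(1) that] aut_group_mult[OF t(1) ti that] G.l_inv[OF t(1)]
      G.r_inv[OF t(1)]
      oneG[OF that] by auto
  have tp: "perp (\<tau> x) (\<tau> y) \<longleftrightarrow> perp x y" if "x \<in> X" "y \<in> X" for x y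
    using aut_group_aut[OF t(1)] that by (auto simp: orthoset_aut_def)
  define g where "g = ?t q'"
  have gX: "g \<in> X" using tauX ef' by (simp add: g_def)
  have tg: "\<tau> g = q'" using t1 ef' by (simp add: g_def)
  have conj: "(?t \<otimes>\<^bsub>G\<^esub> \<rho> \<otimes>\<^bsub>G\<^esub> \<tau>) x = ?t (\<rho> (\<tau> x))" if "\<rho> \<in> R p' q'" "x \<in> X" for \<rho> x
    using aut_group_mult[of "?t \<otimes>\<^bsub>G\<^esub> \<rho>" X perp \<tau> x] aut_group_mult[of ?t X perp \<rho> "\<tau> x"]
      divisible_part_group[OF that(1)] t that tauX by simp
  have Rp: "perp x s \<Longrightarrow> \<phi> x = x \<Longrightarrow> perp x (\<phi> s)" if "\<phi> \<in> R p q" "x \<in> X" "s \<in> X" for \<phi> x s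
    using aut_group_aut[OF divisible_part_group[OF that(1)]] that unfolding orthoset_aut_def
      by metis
  have "perp p g \<longleftrightarrow> perp p' q'" using tp[OF ef(1) gX] t tg by simp
  moreover have "g \<noteq> p" using tg t ef' by auto
  moreover have "perp x q \<longleftrightarrow> perp x g" if x: "x \<in> X" "perp x p" for x
  proof
    assume xq: "perp x q"
    obtain \<rho> where r: "\<rho> \<in> R p' q'" "\<rho> p' = q'" using DT_D(2)[OF ef'] by (auto simp: DT1_def)
    let ?s = "?t \<otimes>\<^bsub>G\<^esub> \<rho> \<otimes>\<^bsub>G\<^esub> \<tau>"
    have s: "?s \<in> R p q" using R r by blast
    have "?s p = g" using conj[OF r(1) ef(1)] r t by (simp add: g_def)
    moreover have "?s x = x" using divisible_part_fix[OF s x(1)] x xq by blast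
    ultimately show "perp x g" using Rp[OF s x(1) ef(1)] x by simp
  next
    assume xg: "perp x g"
    obtain \<phi> where f: "\<phi> \<in> R p q" "\<phi> p = q" using DT_D(2)[OF ef] by (auto simp: DT1_def)
    then obtain \<rho> where r: "\<rho> \<in> R p' q'" "\<phi> = ?t \<otimes>\<^bsub>G\<^esub> \<rho> \<otimes>\<^bsub>G\<^esub> \<tau>" using R by blast
    have "perp (\<tau> x) p'" "perp (\<tau> x) q'" using tp[OF x(1) ef(1)] tp[OF x(1) gX] t tg x xg by auto
    then have "\<rho> (\<tau> x) = \<tau> x" using divisible_part_fix[OF r(1)] tauX x by blast
    then have "\<phi> x = x" using conj[OF r(1) x(1)] r t1 x by simp
    then show "perp x q" using Rp[OF f(1) x(1) ef(1)] f x by simp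
  qed
  ultimately show ?thesis using that gX by blast
qed

lemma orthogonal_pair: "\<exists>p\<in>X. \<exists>q\<in>X. p \<noteq> q \<and> perp p q"
proof -
  obtain B where B: "B \<subseteq> X" "finite B" "card B = 4" "pairwise perp B" using quadruple by blast
  then have "\<not> card B \<le> Suc 0" by simp
  then obtain p q where "p \<in> B" "q \<in> B" "p \<noteq> q" using card_le_Suc0_iff_eq[OF B(2)] by blast
  then show ?thesis using B unfolding pairwise_def by blast
qed

text \<open>Otherwise an element of \<open>fix_group X perp p q\<close> moves no point besides
  \<open>p\<close> and \<open>q\<close>. The rotation taking \<open>p\<close> to \<open>q\<close>
  would then exchange them, but it has a square root in the same group, and no permutation of two
  points squares to their exchange.\<close>

lemma nonorthogonal_pair: "\<exists>p\<in>X. \<exists>q\<in>X. p \<noteq> q \<and> \<not> perp p q"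
proof (rule ccontr)
  assume "\<not> ?thesis"
  then have all: "perp p q" if "p \<in> X" "q \<in> X" "p \<noteq> q" for p q using that by blast
  obtain p q where X: "p \<in> X" "q \<in> X" and pq: "p \<noteq> q" using orthogonal_pair by blast
  obtain \<phi> where f: "\<phi> \<in> R p q" "\<phi> p = q" using DT_D(2)[OF X pq] by (auto simp: DT1_def)
  then have "\<forall>k::nat. k \<ge> 1 \<longrightarrow> (\<exists>\<psi>\<in>fix_group X perp p q. \<phi> = \<psi> [^]\<^bsub>G\<^esub> k)"
    by (simp add: divisible_part_def)
  from this[rule_format, of 2] obtain \<psi> where
    psi: "\<psi> \<in> fix_group X perp p q" "\<phi> = \<psi> [^]\<^bsub>G\<^esub> (2::nat)" by auto
  have pG: "\<psi> \<in> carrier G" using psi by (simp add: fix_group_def)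
  have "\<phi> = \<psi> \<otimes>\<^bsub>G\<^esub> \<psi>" using psi pG by (simp add: numeral_2_eq_2)
  then have pp: "\<psi> (\<psi> p) = q" using aut_group_mult[OF pG pG X(1)] f by simp
  have fx: "\<psi> x = x" if "x \<in> X" "x \<noteq> p" "x \<noteq> q" for x
    using psi all[of x p] all[of x q] X that by (simp add: fix_group_def)
  have pX: "\<psi> x \<in> X" if "x \<in> X" for x
    using aut_group_aut[OF pG] that by (auto simp: orthoset_aut_def bij_betw_def)
  have inj: "x = y" if "\<psi> x = \<psi> y" "x \<in> X" "y \<in> X" for x y
    using aut_group_aut[OF pG] that by (auto simp: orthoset_aut_def bij_betw_def inj_on_def)
  have "\<psi> p = p \<or> \<psi> p = q" using fx[OF pX[OF X(1)]] inj[OF _ pX[OF X(1)] X(1)] by blast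
  moreover have "\<psi> p \<noteq> p" using pp pq by auto
  ultimately have "\<psi> p = q" by blast
  then show False using pp inj[of q p] X pq by auto
qed

sublocale linear_orthoset X perp
proof
  fix p q assume pq: "p \<in> X" "q \<in> X" "p \<noteq> q"
  obtain p' q' where "p' \<in> X" "q' \<in> X" "p' \<noteq> q'" "perp p' q'" using orthogonal_pair by blast
  then show "\<exists>g\<in>X. perp p g \<and> (\<forall>x\<in>X. perp x p \<longrightarrow> (perp x q \<longleftrightarrow> perp x g))"
    using partner_like[OF pq] by metis
qed

lemma third: assumes pq: "p \<in> X" "q \<in> X" "p \<noteq> q" shows "\<exists>r\<in>cl {p, q}. r \<noteq> p \<and> r \<noteq> q"
proof -
  \<comment> \<open>Choosing a pair whose orthogonality is opposite to that of \<open>p\<close>,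
    \<open>q\<close> ensures that the transported point differs from \<open>q\<close>.\<close>
  obtain p' q' where *: "p' \<in> X" "q' \<in> X" "p' \<noteq> q'" "perp p' q' \<longleftrightarrow> \<not> perp p q"
    using orthogonal_pair nonorthogonal_pair by blast
  obtain g where g: "g \<in> X" "g \<noteq> p" "perp p g \<longleftrightarrow> perp p' q'"
    "\<And>x. \<lbrakk>x \<in> X; perp x p\<rbrakk> \<Longrightarrow> perp x q \<longleftrightarrow> perp x g" using partner_like[OF pq *(1-3)] by metis
  have "g \<in> cl {p, q}" using g pq by (auto simp: cl_def)
  moreover have "g \<noteq> q" using g * by auto
  ultimately show ?thesis using g by blast
qed

lemma orthogonal_to_three:
  assumes "p \<in> X" "q \<in> X" "r \<in> X" shows "\<exists>w\<in>X. perp w p \<and> perp w q \<and> perp w r"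
proof -
  obtain B where B: "B \<subseteq> X" "finite B" "card B = 4" "pairwise perp B" using quadruple by blast
  have "b \<notin> cl (B - {b})" if "b \<in> B" for b
  proof
    assume "b \<in> cl (B - {b})"
    moreover have "perp b s" if "s \<in> B - {b}" for s
      using B \<open>b \<in> B\<close> that by (auto simp: pairwise_def)
    ultimately have "perp b b" using perp_cl[of b "B - {b}" b] B that by blast
    then show False using perp_irrefl B that by blast
  qed
  moreover have "card {p, q, r} < card B"
    using B card_insert_le_m1[of 3 "{q,r}" p] card_insert_le_m1[of 2 "{r}" q] by simp
  ultimately obtain w where "w \<in> cl B" "\<forall>s\<in>{p, q, r}. perp w s"
    using orthogonal_to_smaller_set[of "{p,q,r}" B] assms B by auto
  then show ?thesis using cl_closed by blast
qed

end

text \<open>If all orthogonal subsets had at most \<open>n\<close> elements, the cardinal of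
  \<open>{..<n}\<close> would be a bound. As it lives on \<open>nat\<close>, minimality of the rank
  is applied across types through \<open>is_rank_minimal\<close>.\<close>

lemma rank_orthogonal_subset:
  fixes X :: "'a set" and r :: "'a rel"
  assumes r: "is_rank X perp r" and le: "natLeq_on (Suc n) \<le>o r"
  shows "\<exists>B. B \<subseteq> X \<and> finite B \<and> card B = Suc n \<and> pairwise perp B"
proof (rule ccontr)
  assume no: "\<not> ?thesis"
  have "finite D \<and> card D \<le> n" if D: "orthogonal_subset X perp D" for D
  proof (rule ccontr)
    assume "\<not> (finite D \<and> card D \<le> n)"
    then obtain B where "B \<subseteq> D" "finite B" "card B = Suc n"
      using infinite_arbitrarily_large[of D "Suc n"] obtain_subset_with_card_n[of "Suc n" D]
      by (metis not_less_eq_eq)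
    moreover have "D \<subseteq> X" "pairwise perp D" using D by (auto simp: orthogonal_subset_def)
    ultimately show False using no pairwise_subset[of perp D B] by blast
  qed
  then have "|D| \<le>o |{..<n}|" if "orthogonal_subset X perp D" for D
    using that card_le_inj[of D "{..<n}"] by (auto simp: card_of_ordLeq[symmetric])
  then have "bounds_orthogonal_subsets X perp |{..<n}|"
    using card_of_Card_order by (auto simp: bounds_orthogonal_subsets_def)
  then have "r \<le>o |{..<n}|" using is_rank_minimal[OF r] by blast
  then have "natLeq_on (Suc n) \<le>o |{..<n}|" using ordLeq_transitive[OF le] by blast
  then have "|{x. x < Suc n}| \<le>o |{..<n}|"
    using card_of_mono2[of "natLeq_on (Suc n)" "|{..<n}|"]
      by (simp only: Field_natLeq_on Field_card_of)
  then obtain g where "inj_on g {..<Suc n}" "g ` {..<Suc n} \<subseteq> {..<n}"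
    by (auto simp: card_of_ordLeq[symmetric] lessThan_def)
  then show False using card_inj_on_le[of g "{..<Suc n}" "{..<n}"] by simp
qed

theorem theorem6p11:
  fixes X :: "'a set" and perp :: "'a \<Rightarrow> 'a \<Rightarrow> bool" and r :: "'a rel"
  assumes "orthoset X perp"
    and "divisibly_transitive X perp"
    and "is_rank X perp r"
    and "natLeq_on 4 \<le>o r"
  shows "\<exists>(K :: 'a ring) (le :: 'a \<Rightarrow> 'a \<Rightarrow> bool) (H :: ('a, 'a) module) (form :: 'a \<Rightarrow> 'a \<Rightarrow> 'a).
           ordered_field K le \<and>
           positive_definite_quadratic_space K le H form \<and>
           unit_vector_in_each_line K H form \<and>
           orthoset_isomorphic X perp (proj_points K H) (proj_perp K H form)"
proof -
  interpret orthoset X perp by fact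
  interpret divisibly_transitive_orthoset X perp
    by unfold_locales (use assms rank_orthogonal_subset[of X perp r 3] in simp_all)
  obtain e where e: "e \<in> X" using nonempty by blast
  interpret P: pointed_orthoset X perp e
    by unfold_locales (use e third orthogonal_to_three in auto)
  \<comment> \<open>The degenerate plane \<open>{e, e, e}\<close> only serves to make
    \<open>i\<close> different from \<open>e\<close>; any such affine point can be the unit of the
    scalars.\<close>
  obtain i where i: "i \<in> P.A" "i \<notin> cl {e, e, e}" using P.point_outside_plane[OF e e e] .
  have "i \<noteq> e" using i e by (auto simp: cl_incl)
  interpret rotation_orthoset X perp e i R
  proof
    show "i \<in> P.A" "i \<noteq> e" by fact+
  next
    fix p q \<phi> assume "\<phi> \<in> R p q"
    then show "orthoset_aut X perp \<phi>" by (rule aut_group_aut[OF divisible_part_group])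
  next
    fix p q \<phi> x assume "\<phi> \<in> R p q" "x \<in> X" "perp x p" "perp x q"
    then show "\<phi> x = x" by (rule divisible_part_fix)
  next
    fix p q \<phi> \<psi> x assume *: "p \<in> X" "q \<in> X" "p \<noteq> q" "\<phi> \<in> R p q" "\<psi> \<in> R p q" "x \<in> X"
    have "comm_group (G\<lparr>carrier := R p q\<rparr>)" using DT_D(1)[OF *(1-3)] by (simp add: DT0_def)
    then interpret C: comm_group "G\<lparr>carrier := R p q\<rparr>" .
    have "\<phi> \<otimes>\<^bsub>G\<^esub> \<psi> = \<psi> \<otimes>\<^bsub>G\<^esub> \<phi>" using C.m_comm[of \<phi> \<psi>] * by simp
    then show "\<phi> (\<psi> x) = \<psi> (\<phi> x)"
      using aut_group_mult[of \<phi> X perp \<psi> x] aut_group_mult[of \<psi> X perp \<phi> x] * divisible_part_group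
        by metis
  next
    fix p q r assume *: "p \<in> X" "q \<in> X" "p \<noteq> q" "r \<in> cl {p, q}" "r \<noteq> p"
    have rX: "r \<in> X" using * cl_closed by blast
    \<comment> \<open>\<open>q\<close> and \<open>r\<close> span the same line with
      \<open>p\<close>, so \<open>R p q = R p r\<close>, and (DT1) for the pair \<open>p\<close>,
      \<open>r\<close> supplies the rotation.\<close>
    have "q \<in> cl {p, r}" using cl_pair_exchange * by blast
    then have "perp x p \<and> perp x q \<longleftrightarrow> perp x p \<and> perp x r" if "x \<in> X" for x
      using perp_cl[of x "{p,q}" r] perp_cl[of x "{p,r}" q] * that by blast
    then have "R p q = R p r" by (rule divisible_part_cong)
    then show "\<exists>\<phi>\<in>R p q. \<phi> p = r" using DT_D(2)[of p r] * rX by (auto simp: DT1_def)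
  qed
  show ?thesis by (rule quadratic_representation)
qed

end
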